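(* Suppose that for all $c\in\mathbb{N}^+$ and all $\gamma>0$, as $n\to\infty$, $$\sup\left\{\frac{|f|_{\mathcal{C}}}{|f|_{\mathcal{U}^c}}: f\in H^n,\ |f|_{\mathcal{U}^c}<+\infty\right\}\in O(n^{1+\gamma}).$$ Then $\mathbf{P}\neq\mathbf{NP}$.
   Context: Let $\mathcal{B}=\{0,1\}$, let $\mathcal{B}^*$ be the set of finite binary strings and $|h|$ the length of $h\in\mathcal{B}^*$. For $n\in\mathbb{N}^+$, $H^n$ is the set of all functions $\mathcal{B}^n\to\mathcal{B}$. An interpreter is a Turing machine computing a partial function $\varphi:\mathcal{B}^*\times\mathcal{B}^*\to\mathcal{B}\cup\{\bot\}$, where $\bot$ denotes non-halting (or invalid) output. For $f\in H^n$, $|f|_\varphi=\min\{|h|:\varphi(h,x)=f(x)\ \forall x\in\mathcal{B}^n\}$ ($+\infty$ if no such $h$). Turing machines have alphabet $\{0,1,b\}$ ($b$ blank), a finite state set containing an initial state and two final states accept/reject; the output is $1$ if halting in accept, $0$ if halting in reject, $\bot$ otherwise; multi-tape machines have read-only input tapes and read/write work tapes, and the transition function is a finite list of rules. $E(T)$ is a fixed prefix-free binary encoding of a machine $T$ listing its rules (of length at least 2 for every machine). For $c\in\mathbb{N}^+$, $\mathcal{U}^c$ is a time-bounded universal interpreter (a 2-input-tape, 3-work-tape machine): on $(p,x)$ with $n=|x|$, it checks within $n^c$ steps whether $p=E(T)u$ for a two-input-tape machine $T$ and $u\in\mathcal{B}^*$ (outputting $\bot$ if not, or if the check does not finish), then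 simulates $T$ on $(u,x)$ with an efficient universal simulation (Hennie–Stearns, overhead $O(t\log t)$ for $t$ simulated steps), devoting at most $n^c$ of its own steps to the simulation; it outputs $T$'s output if $T$ halts within this budget and $0$ otherwise. For fixed $p$ it runs in at most $\beta n^c$ steps for a constant $\beta$. In particular, if a Turing machine computes $g:\mathcal{B}^*\to\mathcal{B}$ in time $O(n^{c'})$ with $c'<c$, there is $h\in\mathcal{B}^*$ with $\mathcal{U}^c(h,x)=g(x)$ for all $x$ of sufficiently large length. A Boolean circuit on $n$ inputs is a DAG with a unique sink (output) whose sources are labelled by input indices in $\{1,\dots,n\}$ and whose other vertices (gates) are labelled AND, OR (two incoming edges) or NOT (one incoming edge); its size $|C|$ is its number of vertices. The circuit interpreter $\mathcal{C}$ reads a program $h=0^{\lceil\log_2 n\rceil}1\,[\text{binary expansion of } n]\,0^{|C|}1\,[\text{description of vertex } i]_{i=1}^{|C|}$, each vertex being described by its label and its parents/input index using $\max\{2\lceil\log_2|C|\rceil,\lceil\log_2 n\rceil\}$ bits beyond the label bits, so a circuit $C$ on $n$ inputs has encoding length $L(|C|,n)=2\lceil\log_2 n\rceil+2+|C|(3+\max\{2\lceil\log_2|C|\rceil,\lceil\log_2 n\rceil\})$; $\mathcal{C}(h,x)$ is the circuit's output on $x\in\mathcal{B}^n$, and $\bot$ if $h$ is malformed. Hence $|f|_{\mathcal{C}}=\min\{L(|C|,n): C \text{ computes } f\}$. $\mathbf{P}$ and $\mathbf{NP}$ are the usual complexity classes. *)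

theory Defs
  imports Complex_Main "HOL-Library.Extended_Nat"
begin

datatype sym = S0 | S1 | Blank

text \<open>States are 0..<tm_nstates; 0 is initial, 1 is accept, 2 is reject.
  The machine has tm_nin read-only input tapes and tm_nwork read/write work tapes.
  tm_delta q reads = None means there is no applicable rule (the machine is stuck
  forever, i.e. does not halt in a final state).  Otherwise it yields the new state,
  the symbols written on the work tapes and the head moves (input tapes first, then
  work tapes), each in {-1,0,1}.\<close>

record tm =
  tm_nstates :: nat
  tm_nin :: nat
  tm_nwork :: nat
  tm_delta :: "nat \<Rightarrow> sym list \<Rightarrow> (nat \<times> sym list \<times> int list) option"

record config =
  c_st :: nat
  c_inpos :: "int list"
  c_tapes :: "(int \<Rightarrow> sym) list"
  c_wpos :: "int list"

definition wf_tm :: "nat \<Rightarrow> tm \<Rightarrow> bool" where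
  "wf_tm m M \<longleftrightarrow> tm_nin M = m \<and> 3 \<le> tm_nstates M \<and>
     (\<forall>q rd q' ws mv. tm_delta M q rd = Some (q', ws, mv) \<longrightarrow>
        q < tm_nstates M \<and> length rd = tm_nin M + tm_nwork M \<and>
        q' < tm_nstates M \<and> length ws = tm_nwork M \<and>
        length mv = tm_nin M + tm_nwork M \<and> set mv \<subseteq> {-1, 0, 1})"

definition inp_sym :: "bool list \<Rightarrow> int \<Rightarrow> sym" where
  "inp_sym xs i = (if 0 \<le> i \<and> i < int (length xs) then (if xs ! nat i then S1 else S0) else Blank)"

definition init_config :: "tm \<Rightarrow> config" where
  "init_config M = \<lparr> c_st = 0, c_inpos = replicate (tm_nin M) 0,
     c_tapes = replicate (tm_nwork M) (\<lambda>_. Blank), c_wpos = replicate (tm_nwork M) 0 \<rparr>"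

definition step :: "tm \<Rightarrow> bool list list \<Rightarrow> config \<Rightarrow> config" where
  "step M xs cf =
    (if c_st cf \<in> {1, 2} then cf else
     (let rd = map (\<lambda>i. inp_sym (xs ! i) (c_inpos cf ! i)) [0..<tm_nin M]
             @ map (\<lambda>j. (c_tapes cf ! j) (c_wpos cf ! j)) [0..<tm_nwork M]
      in case tm_delta M (c_st cf) rd of
           None \<Rightarrow> cf
         | Some (q, ws, mv) \<Rightarrow>
             \<lparr> c_st = q,
               c_inpos = map (\<lambda>i. c_inpos cf ! i + mv ! i) [0..<tm_nin M],
               c_tapes = map (\<lambda>j. (c_tapes cf ! j)(c_wpos cf ! j := ws ! j)) [0..<tm_nwork M],
               c_wpos = map (\<lambda>j. c_wpos cf ! j + mv ! (tm_nin M + j)) [0..<tm_nwork M] \<rparr>))"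

definition run :: "tm \<Rightarrow> bool list list \<Rightarrow> nat \<Rightarrow> config" where
  "run M xs t = (step M xs ^^ t) (init_config M)"

definition halts_within :: "tm \<Rightarrow> bool list list \<Rightarrow> nat \<Rightarrow> bool" where
  "halts_within M xs t \<longleftrightarrow> c_st (run M xs t) \<in> {1, 2}"

definition tm_output :: "tm \<Rightarrow> bool list list \<Rightarrow> bool option" where
  "tm_output M xs = (if \<exists>t. halts_within M xs t
     then Some (c_st (run M xs (LEAST t. halts_within M xs t)) = 1) else None)"

definition inP :: "bool list set \<Rightarrow> bool" where
  "inP L \<longleftrightarrow> (\<exists>M k a. wf_tm 1 M \<and>
     (\<forall>x. \<exists>t \<le> a * length x ^ k + a. halts_within M [x] t) \<and>
     (\<forall>x. tm_output M [x] = Some (x \<in> L)))"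

definition inNP :: "bool list set \<Rightarrow> bool" where
  "inNP L \<longleftrightarrow> (\<exists>M k a. wf_tm 2 M \<and>
     (\<forall>x w. length w \<le> a * length x ^ k + a \<longrightarrow>
        (\<exists>t \<le> a * length x ^ k + a. halts_within M [x, w] t)) \<and>
     (\<forall>x. x \<in> L \<longleftrightarrow> (\<exists>w. length w \<le> a * length x ^ k + a \<and> tm_output M [x, w] = Some True)))"

definition P_class :: "bool list set set" where "P_class = {L. inP L}"
definition NP_class :: "bool list set set" where "NP_class = {L. inNP L}"

text \<open>An interpreter maps (program, input) to an output bit or \<bottom> (None).
  A function f in H^n is represented by f :: bool list \<Rightarrow> bool, only its values on
  strings of length n being relevant.\<close>

type_synonym interpreter = "bool list \<Rightarrow> bool list \<Rightarrow> bool option"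

definition prog_cplx :: "interpreter \<Rightarrow> nat \<Rightarrow> (bool list \<Rightarrow> bool) \<Rightarrow> enat" where
  "prog_cplx \<phi> n f =
     (if \<exists>h. \<forall>x. length x = n \<longrightarrow> \<phi> h x = Some (f x)
      then enat (LEAST m. \<exists>h. length h = m \<and> (\<forall>x. length x = n \<longrightarrow> \<phi> h x = Some (f x)))
      else \<infinity>)"

text \<open>The properties of the time-bounded universal interpreters U^c used here:
  whenever a Turing machine computes g in time O(n^c') with c' < c, some program h
  makes U^c compute g on all inputs of sufficiently large length.\<close>

definition universal_family :: "(nat \<Rightarrow> interpreter) \<Rightarrow> bool" where
  "universal_family U \<longleftrightarrow>
    (\<forall>(c::nat) (c'::real) M (g :: bool list \<Rightarrow> bool) (a::real).
       1 \<le> c \<longrightarrow> c' < real c \<longrightarrow> wf_tm 1 M \<longrightarrow>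
       (\<forall>x. (\<exists>t. real t \<le> a * real (length x) powr c' + a \<and> halts_within M [x] t) \<and>
            tm_output M [x] = Some (g x)) \<longrightarrow>
       (\<exists>h N. \<forall>x. N \<le> length x \<longrightarrow> U c h x = Some (g x)))"

datatype gate = Inp nat | AndG nat nat | OrG nat nat | NotG nat

text \<open>A circuit is a list of vertices in topological order; parents are referred to
  by (0-based) position, inputs by index in {1..n}; the last vertex is the output,
  which must be the unique sink.\<close>

fun parents :: "gate \<Rightarrow> nat set" where
  "parents (Inp j) = {}"
| "parents (AndG a b) = {a, b}"
| "parents (OrG a b) = {a, b}"
| "parents (NotG a) = {a}"

definition wf_circuit :: "nat \<Rightarrow> gate list \<Rightarrow> bool" where
  "wf_circuit n C \<longleftrightarrow> C \<noteq> [] \<and>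
     (\<forall>i < length C. (\<forall>j. C ! i = Inp j \<longrightarrow> 1 \<le> j \<and> j \<le> n) \<and> (\<forall>p \<in> parents (C ! i). p < i)) \<and>
     (\<forall>i < length C - 1. \<exists>k < length C. i \<in> parents (C ! k))"

fun gval :: "bool list \<Rightarrow> bool list \<Rightarrow> gate \<Rightarrow> bool" where
  "gval x vs (Inp j) = x ! (j - 1)"
| "gval x vs (AndG a b) = (vs ! a \<and> vs ! b)"
| "gval x vs (OrG a b) = (vs ! a \<or> vs ! b)"
| "gval x vs (NotG a) = (\<not> vs ! a)"

definition circ_vals :: "gate list \<Rightarrow> bool list \<Rightarrow> bool list" where
  "circ_vals C x = foldl (\<lambda>vs g. vs @ [gval x vs g]) [] C"

definition circ_eval :: "gate list \<Rightarrow> bool list \<Rightarrow> bool" where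
  "circ_eval C x = last (circ_vals C x)"

definition clog2 :: "nat \<Rightarrow> nat" where
  "clog2 m = nat \<lceil>log 2 (real m)\<rceil>"

definition enc_len :: "nat \<Rightarrow> nat \<Rightarrow> nat" where
  "enc_len s n = 2 * clog2 n + 2 + s * (3 + max (2 * clog2 s) (clog2 n))"

definition circ_cplx :: "nat \<Rightarrow> (bool list \<Rightarrow> bool) \<Rightarrow> nat" where
  "circ_cplx n f = (LEAST l. \<exists>C. wf_circuit n C \<and>
      (\<forall>x. length x = n \<longrightarrow> circ_eval C x = f x) \<and> l = enc_len (length C) n)"

end

theory Submission
  imports Defs
begin

text \<open>
  Kannan's argument. If \<open>P = NP\<close>, the class \<open>P\<close> is closed under polynomially bounded
  quantifiers, so the language whose slice at length \<open>n\<close> is computed by the first circuit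
  (in the order of codes) that disagrees with every circuit of code length at most \<open>n\<^sup>4\<close> lies in
  \<open>P\<close>. Then some fixed program of some \<open>U c\<close> decides it on all long inputs, and the
  hypothesis with \<open>\<gamma> = 1/2\<close> gives circuits of size \<open>O(n powr 1.5)\<close>, whose codes have
  length \<open>O(n\<^sup>3)\<close>: a contradiction.

  Circuits are coded as NOR matrices, since these can be evaluated by a very simple machine: a row
  is as long as the list of values computed so far, so no separators or pointers are needed.
  The witness bound in \<open>NP\<close> is kept linear by handing polynomially long paddings to the
  machines as additional inputs.
\<close>

section \<open>A structured language for Turing machines\<close>

text \<open>The threshold n^4 is fixed by two requirements. A circuit of size s has a NOR code of
  length O((n + s)^2), since every row mentions all values before it; for s = O(n powr (1 +
  \<gamma>)) with \<gamma> < 1 this is o(n^4). On the other side, n^4 + 1 points carry more Boolean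
  functions than there are codes of length at most n^4, and a table of these points has a code of
  polynomial length, so the search for the first hard code is polynomially bounded. Its description
  has a fixed number of alternating quantifiers, and each is removed by one application of P = NP.

  The program deciding the language does not depend on n, so its length is a constant and the
  hypothesis on the quotient becomes a bound on circuit size alone. The obstacle is a program of
  length zero: there the quotient is 0 by convention and bounds nothing. The complement of the
  language is therefore carried along, since the empty program cannot compute both.\<close>

text \<open>Tapes are centred at their heads, so the scanned cell is always \<open>0\<close> and a head move shifts
  the tape; this makes machines insensitive to the absolute position of their data.\<close>

type_synonym tape = "int \<Rightarrow> sym"
type_synonym state = "nat \<times> (nat \<Rightarrow> tape)"

definition shift :: "int \<Rightarrow> tape \<Rightarrow> tape" where
  "shift d t = (\<lambda>z. t (z + d))"

definition heads :: "nat \<Rightarrow> (nat \<Rightarrow> tape) \<Rightarrow> sym list" where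
  "heads N T = map (\<lambda>j. T j 0) [0..<N]"

lemma length_heads [simp]: "length (heads N T) = N"
  by (simp add: heads_def)

lemma nth_heads [simp]: "j < N \<Longrightarrow> heads N T ! j = T j 0"
  by (simp add: heads_def)

lemma shift_0 [simp]: "shift 0 t = t"
  by (simp add: shift_def)

datatype prog =
    Do "nat \<Rightarrow> sym list \<Rightarrow> nat \<times> (nat \<Rightarrow> sym) \<times> (nat \<Rightarrow> int)"
  | Seq prog prog
  | Cond "nat \<Rightarrow> sym list \<Rightarrow> bool" prog prog
  | While "nat \<Rightarrow> sym list \<Rightarrow> bool" prog

text \<open>The control state of a program is its stack of pending commands, of which only finitely many
  occur, together with a store. Every control transition is one machine step, and a program accepts by
  ending with store \<open>1\<close>.\<close>

fun ctl :: "prog list \<times> nat \<Rightarrow> sym list \<Rightarrow> (prog list \<times> nat) \<times> (nat \<Rightarrow> sym) \<times> (nat \<Rightarrow> int)" where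
  "ctl ([], s) r = (([], s), (\<lambda>j. r ! j), (\<lambda>_. 0))"
| "ctl (Do f # ks, s) r = ((ks, fst (f s r)), fst (snd (f s r)), snd (snd (f s r)))"
| "ctl (Seq a b # ks, s) r = ((a # b # ks, s), (\<lambda>j. r ! j), (\<lambda>_. 0))"
| "ctl (Cond c a b # ks, s) r = (((if c s r then a else b) # ks, s), (\<lambda>j. r ! j), (\<lambda>_. 0))"
| "ctl (While c a # ks, s) r = ((if c s r then a # While c a # ks else ks, s), (\<lambda>j. r ! j), (\<lambda>_. 0))"

definition upd :: "nat \<Rightarrow> (nat \<Rightarrow> sym) \<Rightarrow> (nat \<Rightarrow> int) \<Rightarrow> (nat \<Rightarrow> tape) \<Rightarrow> nat \<Rightarrow> tape" where
  "upd N w d T = (\<lambda>j. if j < N then shift (d j) ((T j)(0 := w j)) else T j)"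

definition sstep :: "nat \<Rightarrow> prog list \<times> state \<Rightarrow> prog list \<times> state" where
  "sstep N c = (case c of (ks, (s, T)) \<Rightarrow>
     (case ctl (ks, s) (heads N T) of ((ks', s'), w, d) \<Rightarrow> (ks', (s', upd N w d T))))"

lemma upd_keep [simp]: "upd N (\<lambda>j. heads N T ! j) (\<lambda>_. 0) T = T"
  by (auto simp: upd_def fun_eq_iff)

text \<open>One \<open>t\<close> must serve every stack \<open>ks\<close>, so an execution can be
  embedded above any pending commands, and composition is concatenation of runs. Only a bound on
  \<open>t\<close> is recorded, which lets costs be rounded up freely.\<close>

definition ex :: "nat \<Rightarrow> prog \<Rightarrow> state \<Rightarrow> nat \<Rightarrow> state \<Rightarrow> bool" where
  "ex N p \<sigma> B \<sigma>' \<longleftrightarrow> (\<exists>t\<le>B. \<forall>ks. (sstep N ^^ t) (p # ks, \<sigma>) = (ks, \<sigma>'))"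

lemma ex_mono: "ex N p \<sigma> B \<sigma>' \<Longrightarrow> B \<le> B' \<Longrightarrow> ex N p \<sigma> B' \<sigma>'"
  unfolding ex_def by (meson le_trans)

lemma ex_Do:
  assumes "f s (heads N T) = (s', w, d)"
  shows "ex N (Do f) (s, T) 1 (s', upd N w d T)"
  unfolding ex_def by (rule exI[of _ 1]) (simp add: sstep_def assms)

lemma ex_Seq:
  assumes "ex N a \<sigma> B1 \<sigma>1" "ex N b \<sigma>1 B2 \<sigma>2"
  shows "ex N (Seq a b) \<sigma> (B1 + B2 + 1) \<sigma>2"
proof -
  obtain t1 t2 where t: "t1 \<le> B1" "t2 \<le> B2" "\<And>ks. (sstep N ^^ t1) (a # ks, \<sigma>) = (ks, \<sigma>1)"
    "\<And>ks. (sstep N ^^ t2) (b # ks, \<sigma>1) = (ks, \<sigma>2)"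
    using assms unfolding ex_def by auto
  have "sstep N (Seq a b # ks, \<sigma>) = (a # b # ks, \<sigma>)" for ks
    by (cases \<sigma>) (simp add: sstep_def)
  then have "(sstep N ^^ (t2 + (t1 + 1))) (Seq a b # ks, \<sigma>) = (ks, \<sigma>2)" for ks
    unfolding funpow_add o_apply by (simp add: t)
  then show ?thesis unfolding ex_def using t(1,2) by (intro exI[of _ "t2 + (t1 + 1)"]) auto
qed

lemma ex_Cond:
  assumes "ex N (if c s (heads N T) then a else b) (s, T) B \<sigma>'"
  shows "ex N (Cond c a b) (s, T) (B + 1) \<sigma>'"
proof -
  obtain t where t: "t \<le> B" "\<And>ks. (sstep N ^^ t) ((if c s (heads N T) then a else b) # ks, (s, T)) = (ks, \<sigma>')"
    using assms unfolding ex_def by auto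
  have "(sstep N ^^ (t + 1)) (Cond c a b # ks, (s, T)) = (ks, \<sigma>')" for ks
    unfolding funpow_add o_apply using t(2) by (simp add: sstep_def)
  then show ?thesis unfolding ex_def using t(1) by (intro exI[of _ "t + 1"]) auto
qed

lemma ex_While_False:
  assumes "\<not> c s (heads N T)"
  shows "ex N (While c a) (s, T) 1 (s, T)"
  unfolding ex_def by (rule exI[of _ 1]) (simp add: sstep_def assms)

lemma ex_While_True:
  assumes "c s (heads N T)" "ex N a (s, T) B1 \<sigma>1" "ex N (While c a) \<sigma>1 B2 \<sigma>2"
  shows "ex N (While c a) (s, T) (B1 + B2 + 1) \<sigma>2"
proof -
  obtain t1 t2 where t: "t1 \<le> B1" "t2 \<le> B2" "\<And>ks. (sstep N ^^ t1) (a # ks, (s, T)) = (ks, \<sigma>1)"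
    "\<And>ks. (sstep N ^^ t2) (While c a # ks, \<sigma>1) = (ks, \<sigma>2)"
    using assms unfolding ex_def by auto
  have "(sstep N ^^ (t2 + (t1 + 1))) (While c a # ks, (s, T)) = (ks, \<sigma>2)" for ks
    unfolding funpow_add o_apply by (simp add: sstep_def t assms(1))
  then show ?thesis unfolding ex_def using t(1,2) by (intro exI[of _ "t2 + (t1 + 1)"]) auto
qed

section \<open>Compilation of programs to Turing machines\<close>

fun wfp :: "nat \<Rightarrow> nat \<Rightarrow> nat \<Rightarrow> prog \<Rightarrow> bool" where
  "wfp m N Q (Do f) = (\<forall>s<Q. \<forall>r. length r = N \<longrightarrow> (case f s r of (s', w, d) \<Rightarrow>
      s' < Q \<and> (\<forall>j<N. d j \<in> {-1, 0, 1}) \<and> (\<forall>j<m. w j = r ! j)))"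
| "wfp m N Q (Seq a b) = (wfp m N Q a \<and> wfp m N Q b)"
| "wfp m N Q (Cond c a b) = (wfp m N Q a \<and> wfp m N Q b)"
| "wfp m N Q (While c a) = wfp m N Q a"

text \<open>These are the stacks met while \<open>p\<close> is pending above \<open>ks\<close>. A
  loop body always runs above the same \<open>While c a # ks\<close>, so iterating creates no new
  stacks and the set stays finite.\<close>

fun conts :: "prog \<Rightarrow> prog list \<Rightarrow> prog list set" where
  "conts (Do f) ks = {Do f # ks}"
| "conts (Seq a b) ks = {Seq a b # ks} \<union> conts a (b # ks) \<union> conts b ks"
| "conts (Cond c a b) ks = {Cond c a b # ks} \<union> conts a ks \<union> conts b ks"
| "conts (While c a) ks = {While c a # ks} \<union> conts a (While c a # ks)"

lemma finite_conts: "finite (conts p ks)"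
  by (induction p arbitrary: ks) auto

lemma conts_start: "p # ks \<in> conts p ks"
  by (cases p) auto

lemma conts_nonempty: "[] \<notin> conts p ks"
  by (induction p arbitrary: ks) auto

lemma conts_closed:
  "ks' \<in> conts p ks \<Longrightarrow> fst (fst (ctl (ks', s) r)) \<in> insert ks (conts p ks)"
proof (induction p arbitrary: ks)
  case (Seq a b)
  from Seq.prems consider "ks' = Seq a b # ks" | "ks' \<in> conts a (b # ks)" | "ks' \<in> conts b ks" by auto
  then show ?case
    using Seq.IH(1)[of "b # ks"] Seq.IH(2)[of ks] conts_start[of a "b # ks"] conts_start[of b ks]
    by cases (simp; metis insert_iff)+
next
  case (Cond c a b)
  from Cond.prems consider "ks' = Cond c a b # ks" | "ks' \<in> conts a ks" | "ks' \<in> conts b ks" by auto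
  then show ?case
    using Cond.IH(1)[of ks] Cond.IH(2)[of ks] conts_start[of a "ks"] conts_start[of b ks]
    by cases (simp; metis insert_iff)+
next
  case (While c a)
  from While.prems consider "ks' = While c a # ks" | "ks' \<in> conts a (While c a # ks)" by auto
  then show ?case
    using While.IH[of "While c a # ks"] conts_start[of a "While c a # ks"]
    by cases (simp; metis insert_iff)+
qed auto

lemma conts_wfp: "ks' \<in> conts p ks \<Longrightarrow> wfp m N Q p \<Longrightarrow> ks' \<noteq> [] \<and> wfp m N Q (hd ks')"
  by (induction p arbitrary: ks) auto

lemma ctl_wf:
  assumes "ks \<noteq> []" "wfp m N Q (hd ks)" "s < Q" "length r = N" "m \<le> N"
    "ctl (ks, s) r = ((ks', s'), w, d)"
  shows "s' < Q" "\<And>j. j < N \<Longrightarrow> d j \<in> {-1, 0, 1}" "\<And>j. j < m \<Longrightarrow> w j = r ! j"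
proof -
  obtain p ks0 where ks: "ks = p # ks0" using assms(1) by (cases ks) auto
  have "s' < Q \<and> (\<forall>j<N. d j \<in> {-1, 0, 1}) \<and> (\<forall>j<m. w j = r ! j)"
  proof (cases p)
    case (Do f)
    have "case f s r of (s', w, d) \<Rightarrow> s' < Q \<and> (\<forall>j<N. d j \<in> {-1, 0, 1}) \<and> (\<forall>j<m. w j = r ! j)"
      using assms(2,3,4) ks Do by simp
    then show ?thesis using assms(6) ks Do by auto
  qed (use assms ks in auto)
  then show "s' < Q" "\<And>j. j < N \<Longrightarrow> d j \<in> {-1, 0, 1}" "\<And>j. j < m \<Longrightarrow> w j = r ! j" by auto
qed

text \<open>The parameter \<open>b\<close> locates the tapes of a machine inside a larger bank:
  compilation uses \<open>b = 0\<close>, a machine run as a subroutine sits at an arbitrary offset.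
  The shifts reconcile tapes centred at the head with absolute head positions.\<close>

definition tapes_match :: "nat \<Rightarrow> nat \<Rightarrow> nat \<Rightarrow> bool list list \<Rightarrow> config \<Rightarrow> (nat \<Rightarrow> tape) \<Rightarrow> bool" where
  "tapes_match b m kw xs cf T \<longleftrightarrow>
     length (c_inpos cf) = m \<and> length (c_tapes cf) = kw \<and> length (c_wpos cf) = kw \<and>
     (\<forall>i<m. T (b + i) = shift (c_inpos cf ! i) (inp_sym (xs ! i))) \<and>
     (\<forall>i<kw. T (b + m + i) = shift (c_wpos cf ! i) (c_tapes cf ! i))"

definition upd_config :: "nat \<Rightarrow> nat \<Rightarrow> config \<Rightarrow> nat \<times> sym list \<times> int list \<Rightarrow> config" where
  "upd_config m kw cf a = (case a of (q, ws, mv) \<Rightarrow>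
     \<lparr> c_st = q,
       c_inpos = map (\<lambda>i. c_inpos cf ! i + mv ! i) [0..<m],
       c_tapes = map (\<lambda>j. (c_tapes cf ! j)(c_wpos cf ! j := ws ! j)) [0..<kw],
       c_wpos = map (\<lambda>j. c_wpos cf ! j + mv ! (m + j)) [0..<kw] \<rparr>)"

lemma tapes_match_reads:
  assumes "tapes_match b m kw xs cf T"
  shows "map (\<lambda>i. inp_sym (xs ! i) (c_inpos cf ! i)) [0..<m]
             @ map (\<lambda>j. (c_tapes cf ! j) (c_wpos cf ! j)) [0..<kw]
         = map (\<lambda>i. T (b + i) 0) [0..<m + kw]"
  using assms unfolding tapes_match_def
  by (intro nth_equalityI)
     (auto simp: nth_append shift_def,
       metis (no_types, lifting) add.assoc add_diff_inverse_nat add.commute add_0 nat_add_left_cancel_less)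

lemma tapes_match_upd:
  assumes m: "tapes_match b m kw xs cf T"
    and T1: "\<And>i. i < m \<Longrightarrow> T' (b + i) = shift (mv ! i) (T (b + i))"
    and T2: "\<And>i. i < kw \<Longrightarrow> T' (b + m + i) = shift (mv ! (m + i)) ((T (b + m + i))(0 := ws ! i))"
  shows "tapes_match b m kw xs (upd_config m kw cf (q, ws, mv)) T'"
  unfolding tapes_match_def
proof (intro conjI allI impI)
  fix i assume i: "i < m"
  then have "T (b + i) = shift (c_inpos cf ! i) (inp_sym (xs ! i))"
    using m unfolding tapes_match_def by simp
  then show "T' (b + i) = shift (c_inpos (upd_config m kw cf (q, ws, mv)) ! i) (inp_sym (xs ! i))"
    using i by (simp add: T1 upd_config_def shift_def add_ac)
next
  fix i assume i: "i < kw"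
  then have "T (b + m + i) = shift (c_wpos cf ! i) (c_tapes cf ! i)"
    using m unfolding tapes_match_def by simp
  then show "T' (b + m + i) = shift (c_wpos (upd_config m kw cf (q, ws, mv)) ! i)
      (c_tapes (upd_config m kw cf (q, ws, mv)) ! i)"
    unfolding T2[OF i] using i by (auto simp: upd_config_def shift_def fun_eq_iff algebra_simps)
qed (simp_all add: upd_config_def)

lemma step_eq:
  assumes "tapes_match b (tm_nin M) (tm_nwork M) xs cf T" "c_st cf \<notin> {1, 2}"
  shows "step M xs cf = (case tm_delta M (c_st cf) (map (\<lambda>i. T (b + i) 0) [0..<tm_nin M + tm_nwork M]) of
     None \<Rightarrow> cf | Some a \<Rightarrow> upd_config (tm_nin M) (tm_nwork M) cf a)"
  unfolding step_def Let_def tapes_match_reads[OF assms(1)] upd_config_def using assms(2)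
  by (auto split: option.splits)

definition init_tapes :: "nat \<Rightarrow> bool list list \<Rightarrow> nat \<Rightarrow> tape" where
  "init_tapes m xs j = (if j < m then inp_sym (xs ! j) else (\<lambda>_. Blank))"

lemma tapes_match_init:
  assumes "\<And>i. i < tm_nin M \<Longrightarrow> T (b + i) = inp_sym (xs ! i)"
    "\<And>i. i < tm_nwork M \<Longrightarrow> T (b + tm_nin M + i) = (\<lambda>_. Blank)"
  shows "tapes_match b (tm_nin M) (tm_nwork M) xs (init_config M) T"
  using assms unfolding tapes_match_def init_config_def by (auto simp: shift_def fun_eq_iff)

lemma step_halted: "c_st cf \<in> {1, 2} \<Longrightarrow> (step M xs ^^ t) cf = cf"
  by (induction t) (auto simp: step_def)

lemma run_halted:
  assumes "halts_within M xs t" "t \<le> t'"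
  shows "run M xs t' = run M xs t"
proof -
  have "run M xs t' = (step M xs ^^ (t' - t)) (run M xs t)"
    using assms(2) unfolding run_def by (metis funpow_add le_add_diff_inverse2 o_apply)
  then show ?thesis using step_halted assms(1) unfolding halts_within_def by simp
qed

lemma tm_output_eq:
  assumes "halts_within M xs t"
  shows "tm_output M xs = Some (c_st (run M xs t) = 1)"
proof -
  let ?l = "LEAST t. halts_within M xs t"
  have "halts_within M xs ?l" "?l \<le> t" using assms by (auto intro: LeastI Least_le)
  then show ?thesis using run_halted[of M xs ?l t] assms unfolding tm_output_def by auto
qed

text \<open>A machine state is the number of a reachable pair of stack and store; there are finitely
  many by \<open>finite_conts\<close> and the bound \<open>Q\<close>. One program step is one
  machine step, so time bounds carry over unchanged.\<close>

theorem compile: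
  assumes wf: "wfp m N Q p" and mN: "m \<le> N" and Q: "0 < Q"
  shows "\<exists>M. wf_tm m M \<and> (\<forall>xs t s T. (sstep N ^^ t) ([p], (0, init_tapes m xs)) = ([], (s, T)) \<longrightarrow>
           halts_within M xs t \<and> tm_output M xs = Some (s = 1))"
proof -
  define X where "X = conts p [] \<times> {..<Q}"
  have finX: "finite X" unfolding X_def by (simp add: finite_conts)
  obtain idx :: "prog list \<times> nat \<Rightarrow> nat" where idx: "inj_on idx X"
    using finite_imp_inj_to_nat_seg[OF finX] by metis
  \<comment> \<open>States 0, 1 and 2 are prescribed by the machine model, all others are numbered
    from 3. Finished configurations are merged into the two final states, so injectivity holds only
    on \<open>X\<close>, where stacks are nonempty.\<close>
  define code where "code c = (if fst c = [] then (if snd c = 1 then 1 else 2)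
     else if c = ([p], 0) then 0 else 3 + idx c)" for c
  have Xne: "fst c \<noteq> []" if "c \<in> X" for c
    using that conts_nonempty unfolding X_def by (metis mem_Times_iff)
  have inj: "inj_on code X"
    using idx Xne unfolding inj_on_def code_def by (auto split: if_splits)
  have code_nh: "code c \<notin> {1, 2}" if "c \<in> X" for c
    using Xne[OF that] unfolding code_def by auto
  define kw where "kw = N - m"
  define dl where "dl q rd = (if q \<in> code ` X \<and> length rd = N then
      (case ctl (inv_into X code q) rd of (c, w, d) \<Rightarrow>
         Some (code c, map (\<lambda>j. w (m + j)) [0..<kw], map d [0..<N])) else None)" for q rd
  define M where "M = \<lparr> tm_nstates = 3 + Max (insert 0 (code ` X)), tm_nin = m, tm_nwork = kw, tm_delta = dl \<rparr>"
  have N: "N = m + kw" unfolding kw_def using mN by simp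
  have closed: "c' \<in> X \<or> fst c' = []" and sQ: "snd c' < Q"
      and dok: "\<And>j. j < N \<Longrightarrow> d j \<in> {-1, 0, 1}" and wok: "\<And>j. j < m \<Longrightarrow> w j = rd ! j"
    if "c \<in> X" "length rd = N" "ctl c rd = (c', w, d)" for c rd c' w d
  proof -
    obtain ks s where c: "c = (ks, s)" by force
    obtain ks' s' where c': "c' = (ks', s')" by force
    have *: "ks \<in> conts p []" "s < Q" using that(1) unfolding X_def c by auto
    have ks: "ks \<noteq> []" "wfp m N Q (hd ks)" using conts_wfp[OF *(1) wf] by auto
    note cw = ctl_wf[OF ks *(2) that(2) mN, of ks' s' w d]
    have ct: "ctl (ks, s) rd = ((ks', s'), w, d)" using that(3) c c' by simp
    show "\<And>j. j < N \<Longrightarrow> d j \<in> {-1, 0, 1}" "\<And>j. j < m \<Longrightarrow> w j = rd ! j" "snd c' < Q"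
      using cw[OF ct] c' by auto
    show "c' \<in> X \<or> fst c' = []"
      using conts_closed[OF *(1), of s rd] ct cw(1)[OF ct] c' unfolding X_def by auto
  qed
  have code_le: "code c < tm_nstates M" if "c \<in> X \<or> fst c = []" for c
  proof (cases "c \<in> X")
    case True
    then have "code c \<le> Max (insert 0 (code ` X))" using finX by (intro Max_ge) auto
    then show ?thesis unfolding M_def by simp
  next
    case False
    then show ?thesis using that unfolding M_def code_def by auto
  qed
  have wfM: "wf_tm m M"
    unfolding wf_tm_def
  proof (intro conjI allI impI)
    show "tm_nin M = m" "3 \<le> tm_nstates M" unfolding M_def by auto
    fix q rd q' ws mv assume "tm_delta M q rd = Some (q', ws, mv)"
    then have d: "dl q rd = Some (q', ws, mv)" by (simp add: M_def)
    then have q: "q \<in> code ` X" "length rd = N" unfolding dl_def by (auto split: if_splits)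
    define c where "c = inv_into X code q"
    have c: "c \<in> X" "code c = q" unfolding c_def using q by (auto simp: inv_into_into f_inv_into_f)
    obtain c' w dd where ct: "ctl c rd = (c', w, dd)" by (metis prod_cases3)
    have e: "q' = code c'" "ws = map (\<lambda>j. w (m + j)) [0..<kw]" "mv = map dd [0..<N]"
      using d q ct unfolding dl_def c_def by auto
    show "q < tm_nstates M" using code_le c by blast
    show "length rd = tm_nin M + tm_nwork M" using q N unfolding M_def by simp
    show "q' < tm_nstates M" using code_le closed[OF c(1) q(2) ct] e by blast
    show "length ws = tm_nwork M" "length mv = tm_nin M + tm_nwork M" using e N unfolding M_def by auto
    show "set mv \<subseteq> {-1, 0, 1}" unfolding e using dok[OF c(1) q(2) ct] by fastforce
  qed
  have sim: "tapes_match 0 m kw xs (run M xs t) T \<and> c_st (run M xs t) = code (ks, s) \<and> ((ks, s) \<in> X \<or> ks = [])"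
    if "(sstep N ^^ t) ([p], (0, init_tapes m xs)) = (ks, (s, T))" for xs t ks s T
    using that
  proof (induction t arbitrary: ks s T)
    case 0
    have "([p], 0) \<in> X" using Q conts_start[of p "[]"] unfolding X_def by auto
    moreover have "tapes_match 0 m kw xs (init_config M) (init_tapes m xs)"
      using tapes_match_init[of M "init_tapes m xs" 0 xs] by (auto simp: M_def init_tapes_def)
    ultimately show ?case using 0 unfolding run_def code_def by (auto simp: init_config_def)
  next
    case (Suc t)
    obtain ks0 s0 T0 where prev: "(sstep N ^^ t) ([p], (0, init_tapes m xs)) = (ks0, (s0, T0))"
      by (metis prod_cases3)
    note IH = Suc.IH[OF prev]
    have st: "sstep N (ks0, (s0, T0)) = (ks, (s, T))" using Suc.prems prev by simp
    have run: "run M xs (Suc t) = step M xs (run M xs t)" unfolding run_def by simp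
    show ?case
    proof (cases "ks0 = []")
      case True
      then have "c_st (run M xs t) \<in> {1, 2}" using IH unfolding code_def by auto
      then have "run M xs (Suc t) = run M xs t" unfolding run step_def by auto
      moreover have "(ks, (s, T)) = (ks0, (s0, T0))" using st True by (simp add: sstep_def)
      ultimately show ?thesis using IH by auto
    next
      case False
      then have X: "(ks0, s0) \<in> X" using IH by auto
      obtain w d where ct: "ctl (ks0, s0) (heads N T0) = ((ks, s), w, d)" and T: "T = upd N w d T0"
        using st unfolding sstep_def by (auto split: prod.splits)
      have rd: "map (\<lambda>i. T0 (0 + i) 0) [0..<tm_nin M + tm_nwork M] = heads N T0"
        unfolding heads_def N M_def by simp
      have nh: "c_st (run M xs t) \<notin> {1, 2}" using IH code_nh[OF X] by simp
      let ?cf = "run M xs t"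
      have iv: "inv_into X code (code (ks0, s0)) = (ks0, s0)" using inj X by simp
      have dl: "dl (code (ks0, s0)) (heads N T0) = Some (code (ks, s), map (\<lambda>j. w (m + j)) [0..<kw], map d [0..<N])"
        unfolding dl_def iv ct using X by simp
      have "step M xs ?cf = upd_config m kw ?cf (code (ks, s), map (\<lambda>j. w (m + j)) [0..<kw], map d [0..<N])"
        using step_eq[of 0 M xs ?cf T0] IH nh dl unfolding rd by (auto simp: M_def)
      moreover have "tapes_match 0 m kw xs (upd_config m kw ?cf (code (ks, s), map (\<lambda>j. w (m + j)) [0..<kw], map d [0..<N])) T"
      proof (rule tapes_match_upd[of _ _ _ _ _ T0])
        show "tapes_match 0 m kw xs ?cf T0" using IH by simp
        fix i assume "i < m"
        \<comment> \<open>The machine has no way to write on an input tape; the program matches this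
          because there it only writes back the scanned symbol.\<close>
        then have "w i = T0 i 0" using wok[OF X _ ct] N by simp
        then have "(T0 i)(0 := w i) = T0 i" by auto
        then show "T (0 + i) = shift (map d [0..<N] ! i) (T0 (0 + i))"
          unfolding T upd_def using \<open>i < m\<close> N by simp
      next
        fix i assume "i < kw"
        then show "T (0 + m + i) = shift (map d [0..<N] ! (m + i)) ((T0 (0 + m + i))(0 := map (\<lambda>j. w (m + j)) [0..<kw] ! i))"
          unfolding T upd_def using N by simp
      qed
      moreover have "(ks, s) \<in> X \<or> ks = []" using closed[OF X _ ct] by simp
      ultimately show ?thesis unfolding run by (simp add: upd_config_def)
    qed
  qed
  show ?thesis
  proof (rule exI[of _ M], intro conjI allI impI)
    show "wf_tm m M" by fact
    fix xs t s T assume "(sstep N ^^ t) ([p], (0, init_tapes m xs)) = ([], (s, T))"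
    from sim[OF this] have c: "c_st (run M xs t) = (if s = 1 then 1 else 2)"
      unfolding code_def by simp
    then show h: "halts_within M xs t" unfolding halts_within_def by auto
    show "tm_output M xs = Some (s = 1)" using tm_output_eq[OF h] c by simp
  qed
qed

section \<open>Polynomial-time relations\<close>

definition poly_bounded :: "(nat \<Rightarrow> nat) \<Rightarrow> bool" where
  "poly_bounded f \<longleftrightarrow> (\<exists>a k. \<forall>n. f n \<le> a * n ^ k + a)"

lemma power_le_Suc_power: "k \<le> l \<Longrightarrow> (n::nat) ^ k \<le> n ^ l + 1"
  using power_increasing[of k l n] by (cases "n = 0") (auto simp: power_0_left)

lemma poly_bounded_mono: "poly_bounded g \<Longrightarrow> (\<And>n. f n \<le> g n) \<Longrightarrow> poly_bounded f"
  unfolding poly_bounded_def by (meson le_trans)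

lemma poly_bounded_const: "poly_bounded (\<lambda>_. c)"
  unfolding poly_bounded_def by (intro exI[of _ c]) auto

lemma poly_bounded_id: "poly_bounded (\<lambda>n. n)"
  unfolding poly_bounded_def by (intro exI[of _ 1]) auto

lemma poly_bounded_add:
  assumes "poly_bounded f" "poly_bounded g"
  shows "poly_bounded (\<lambda>n. f n + g n)"
proof -
  obtain a k b l where f: "\<And>n. f n \<le> a * n ^ k + a" and g: "\<And>n. g n \<le> b * n ^ l + b"
    using assms unfolding poly_bounded_def by metis
  have "f n + g n \<le> (2 * a + 2 * b) * n ^ (k + l) + (2 * a + 2 * b)" for n
  proof -
    have "a * n ^ k \<le> a * (n ^ (k + l) + 1)" "b * n ^ l \<le> b * (n ^ (k + l) + 1)"
      by (intro mult_left_mono power_le_Suc_power; simp)+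
    then show ?thesis using f[of n] g[of n] unfolding distrib_left distrib_right by simp
  qed
  then show ?thesis unfolding poly_bounded_def by blast
qed

lemma poly_bounded_mult:
  assumes "poly_bounded f" "poly_bounded g"
  shows "poly_bounded (\<lambda>n. f n * g n)"
proof -
  obtain a k b l where f: "\<And>n. f n \<le> a * n ^ k + a" and g: "\<And>n. g n \<le> b * n ^ l + b"
    using assms unfolding poly_bounded_def by metis
  have "f n * g n \<le> (3 * (a * b)) * n ^ (k + l) + 3 * (a * b)" for n
  proof -
    have "f n * g n \<le> (a * n ^ k + a) * (b * n ^ l + b)" by (intro mult_mono f g) auto
    also have "\<dots> = (a * b) * (n ^ (k + l) + n ^ k + n ^ l + 1)"
      by (simp add: algebra_simps power_add)
    also have "\<dots> \<le> (a * b) * (n ^ (k + l) + (n ^ (k + l) + 1) + (n ^ (k + l) + 1) + 1)"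
      by (intro mult_left_mono add_mono power_le_Suc_power order_refl) auto
    finally show ?thesis by (simp add: algebra_simps)
  qed
  then show ?thesis unfolding poly_bounded_def by blast
qed

lemma poly_bounded_power: "poly_bounded f \<Longrightarrow> poly_bounded (\<lambda>n. f n ^ k)"
  by (induction k) (auto intro: poly_bounded_const poly_bounded_mult)

lemma poly_bounded_compose:
  assumes "poly_bounded g" "poly_bounded f"
  shows "poly_bounded (\<lambda>n. g (f n))"
proof -
  obtain a k where g: "\<And>n. g n \<le> a * n ^ k + a"
    using assms unfolding poly_bounded_def by metis
  have "poly_bounded (\<lambda>n. a * f n ^ k + a)"
    by (intro poly_bounded_add poly_bounded_mult poly_bounded_power poly_bounded_const assms)
  then show ?thesis by (rule poly_bounded_mono) (rule g)
qed

lemmas poly_bounded_intros = poly_bounded_const poly_bounded_id poly_bounded_add poly_bounded_mult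
  poly_bounded_power

definition tot :: "bool list list \<Rightarrow> nat" where
  "tot xs = sum_list (map length xs)"

lemma length_le_tot: "i < length xs \<Longrightarrow> length (xs ! i) \<le> tot xs"
  unfolding tot_def by (simp add: member_le_sum_list)

text \<open>The version of P for tuples, with time measured in the total length. Monotonicity of
  \<open>B\<close> turns a bound on the length of the arguments handed to a subroutine into a bound
  on its time.\<close>

definition inPm :: "nat \<Rightarrow> (bool list list \<Rightarrow> bool) \<Rightarrow> bool" where
  "inPm m R \<longleftrightarrow> (\<exists>M B. wf_tm m M \<and> mono B \<and> poly_bounded B \<and>
     (\<forall>xs. length xs = m \<longrightarrow> (\<exists>t\<le>B (tot xs). halts_within M xs t) \<and> tm_output M xs = Some (R xs)))"

text \<open>Here the bound may depend on the tuple in any way: the verifier of an NP language needs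
  a time governed by its first input alone, which \<open>tot\<close> cannot express.\<close>

lemma tm_of_prog:
  assumes wf: "wfp m N Q p" "m \<le> N" "0 < Q"
    and ex: "\<And>xs. length xs = m \<Longrightarrow> \<exists>T. ex N p (0, init_tapes m xs) (B xs) (if R xs then 1 else 2, T)"
  shows "\<exists>M. wf_tm m M \<and> (\<forall>xs. length xs = m \<longrightarrow>
    (\<exists>t\<le>B xs. halts_within M xs t) \<and> tm_output M xs = Some (R xs))"
proof -
  obtain M where M: "wf_tm m M"
    "\<And>xs t s T. (sstep N ^^ t) ([p], (0, init_tapes m xs)) = ([], (s, T)) \<Longrightarrow>
           halts_within M xs t \<and> tm_output M xs = Some (s = 1)"
    using compile[OF wf] by blast
  have "(\<exists>t\<le>B xs. halts_within M xs t) \<and> tm_output M xs = Some (R xs)"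
    if l: "length xs = m" for xs
  proof -
    obtain s T where sT: "ex N p (0, init_tapes m xs) (B xs) (s, T)" "s = 1 \<longleftrightarrow> R xs"
      using ex[OF l] that[of "if R xs then 1 else 2"] by auto
    then obtain t where t: "t \<le> B xs" "\<And>ks. (sstep N ^^ t) (p # ks, (0, init_tapes m xs)) = (ks, (s, T))"
      unfolding ex_def by auto
    then show ?thesis using M(2)[OF t(2)] sT(2) by auto
  qed
  then show ?thesis using M(1) by blast
qed

lemma inPm_I:
  assumes wf: "wfp m N Q p" "m \<le> N" "0 < Q"
    and B: "poly_bounded B"
    and ex: "\<And>xs. length xs = m \<Longrightarrow>
      \<exists>T. ex N p (0, init_tapes m xs) (B (tot xs)) (if R xs then 1 else 2, T)"
  shows "inPm m R"
proof -
  obtain M where M: "wf_tm m M" "\<And>xs. length xs = m \<Longrightarrow>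
      (\<exists>t\<le>B (tot xs). halts_within M xs t) \<and> tm_output M xs = Some (R xs)"
    using tm_of_prog[where B = "\<lambda>xs. B (tot xs)", OF wf ex] by blast
  \<comment> \<open>The given \<open>B\<close> may fail to be monotone; its polynomial majorant is
    monotone and replaces it.\<close>
  obtain a k where a: "\<And>n. B n \<le> a * n ^ k + a" using B unfolding poly_bounded_def by auto
  have "(\<exists>t\<le>a * tot xs ^ k + a. halts_within M xs t) \<and> tm_output M xs = Some (R xs)"
    if "length xs = m" for xs
    using M(2)[OF that] a[of "tot xs"] by (meson le_trans)
  moreover have "mono (\<lambda>n. a * n ^ k + a)"
    by (intro monoI) (simp add: power_mono)
  moreover have "poly_bounded (\<lambda>n. a * n ^ k + a)" by (intro poly_bounded_intros)
  ultimately show ?thesis unfolding inPm_def using M(1) by blast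
qed

section \<open>Elementary commands and machines as subroutines\<close>

definition act :: "nat \<Rightarrow> (nat \<Rightarrow> sym list \<Rightarrow> sym) \<Rightarrow> int \<Rightarrow> prog" where
  "act j g d = Do (\<lambda>s r. (s, (\<lambda>i. if i = j then g s r else r ! i), (\<lambda>i. if i = j then d else 0)))"

definition setst :: "(nat \<Rightarrow> sym list \<Rightarrow> nat) \<Rightarrow> prog" where
  "setst h = Do (\<lambda>s r. (h s r, (\<lambda>i. r ! i), (\<lambda>_. 0)))"

lemma ex_Do_eq:
  assumes "f s (heads N T) = (s', w, d)" "upd N w d T = T'"
  shows "ex N (Do f) (s, T) 1 (s', T')"
  using ex_Do[where f = f and s = s and N = N and T = T and s' = s' and w = w and d = d] assms by simp

lemma ex_act:
  "j < N \<Longrightarrow> ex N (act j g d) (s, T) 1 (s, T(j := shift d ((T j)(0 := g s (heads N T)))))"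
  unfolding act_def by (rule ex_Do_eq, rule refl) (auto simp: upd_def fun_eq_iff)

lemma ex_setst: "ex N (setst h) (s, T) 1 (h s (heads N T), T)"
  unfolding setst_def by (rule ex_Do_eq, rule refl) simp

lemma wfp_act [simp]:
  "j < N \<Longrightarrow> d \<in> {-1, 0, 1} \<Longrightarrow> m \<le> j \<Longrightarrow> wfp m N Q (act j g d)"
  unfolding act_def by auto

definition move :: "nat \<Rightarrow> int \<Rightarrow> prog" where
  "move j d = act j (\<lambda>s r. r ! j) d"

lemma wfp_move [simp]: "j < N \<Longrightarrow> d \<in> {-1, 0, 1} \<Longrightarrow> wfp m N Q (move j d)"
  unfolding move_def act_def by auto

lemma ex_move: "j < N \<Longrightarrow> ex N (move j d) (s, T) 1 (s, T(j := shift d (T j)))"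
  using ex_act[of j N "\<lambda>s r. r ! j" d s T] unfolding move_def by simp

lemma wfp_setst [simp]:
  "(\<And>s r. s < Q \<Longrightarrow> h s r < Q) \<Longrightarrow> wfp m N Q (setst h)"
  unfolding setst_def by auto

text \<open>The store plays the role of the state of \<open>M\<close>. Without an applicable rule
  nothing changes, exactly as in \<open>step\<close>, so a stuck machine makes the surrounding loop
  run forever.\<close>

definition mstep :: "tm \<Rightarrow> nat \<Rightarrow> prog" where
  "mstep M b = Do (\<lambda>s r. case tm_delta M s (map (\<lambda>i. r ! (b + i)) [0..<tm_nin M + tm_nwork M]) of
      None \<Rightarrow> (s, (\<lambda>i. r ! i), (\<lambda>_. 0))
    | Some (q, ws, mv) \<Rightarrow> (q,
        (\<lambda>j. if b + tm_nin M \<le> j \<and> j < b + tm_nin M + tm_nwork M then ws ! (j - (b + tm_nin M)) else r ! j),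
        (\<lambda>j. if b \<le> j \<and> j < b + tm_nin M + tm_nwork M then mv ! (j - b) else 0)))"

definition sim :: "tm \<Rightarrow> nat \<Rightarrow> prog" where
  "sim M b = Seq (setst (\<lambda>_ _. 0)) (While (\<lambda>s r. s \<notin> {1, 2}) (mstep M b))"

lemma wfp_sim [simp]:
  assumes "wf_tm k M" "b + tm_nin M + tm_nwork M \<le> N" "m \<le> b" "tm_nstates M \<le> Q"
  shows "wfp m N Q (sim M b)"
proof -
  have "wfp m N Q (mstep M b)"
    unfolding mstep_def wfp.simps
  proof (intro allI impI)
    fix s and r :: "sym list" assume s: "s < Q" "length r = N"
    let ?rd = "map (\<lambda>i. r ! (b + i)) [0..<tm_nin M + tm_nwork M]"
    show "case (case tm_delta M s ?rd of
      None \<Rightarrow> (s, (\<lambda>i. r ! i), (\<lambda>_. 0))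
    | Some (q, ws, mv) \<Rightarrow> (q,
        (\<lambda>j. if b + tm_nin M \<le> j \<and> j < b + tm_nin M + tm_nwork M then ws ! (j - (b + tm_nin M)) else r ! j),
        (\<lambda>j. if b \<le> j \<and> j < b + tm_nin M + tm_nwork M then mv ! (j - b) else 0))) of (s', w, d) \<Rightarrow>
      s' < Q \<and> (\<forall>j<N. d j \<in> {-1, 0, 1}) \<and> (\<forall>j<m. w j = r ! j)"
    proof (cases "tm_delta M s ?rd")
      case None
      then show ?thesis using s by simp
    next
      case (Some a)
      obtain q ws mv where a: "a = (q, ws, mv)" by (metis prod_cases3)
      have "q < tm_nstates M" and l: "length mv = tm_nin M + tm_nwork M" and S: "set mv \<subseteq> {-1, 0, 1}"
        using assms(1) Some a unfolding wf_tm_def by blast+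
      moreover have "mv ! (j - b) \<in> {-1, 0, 1}" if "b \<le> j" "j < b + tm_nin M + tm_nwork M" for j
        using S nth_mem[of "j - b" mv] that l by fastforce
      ultimately show ?thesis unfolding Some a using assms(3,4) by auto
    qed
  qed
  moreover have "0 < Q" using assms(1,4) unfolding wf_tm_def by simp
  ultimately show ?thesis unfolding sim_def by simp
qed

text \<open>Each simulated step costs one loop test and one \<open>mstep\<close>, and the closing
  test adds one. The number \<open>t\<close> may exceed the halting time because \<open>step\<close>
  is idle on halted configurations.\<close>

lemma ex_sim_loop:
  assumes "b + tm_nin M + tm_nwork M \<le> N" "tapes_match b (tm_nin M) (tm_nwork M) xs cf T"
    "c_st ((step M xs ^^ t) cf) \<in> {1, 2}"
  shows "\<exists>T'. ex N (While (\<lambda>s r. s \<notin> {1, 2}) (mstep M b)) (c_st cf, T) (2 * t + 1)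
     (c_st ((step M xs ^^ t) cf), T')"
  using assms(2,3)
proof (induction t arbitrary: cf T)
  case 0
  then show ?case using ex_While_False[of "\<lambda>s r. s \<notin> {1, 2}" "c_st cf" N T] by auto
next
  case (Suc t)
  show ?case
  proof (cases "c_st cf \<in> {1, 2}")
    case True
    then have "(step M xs ^^ Suc t) cf = cf" by (rule step_halted)
    then show ?thesis
      using ex_While_False[of "\<lambda>s r. s \<notin> {1, 2}" "c_st cf" N T "mstep M b"] True ex_mono by fastforce
  next
    case False
    let ?rd = "map (\<lambda>i. T (b + i) 0) [0..<tm_nin M + tm_nwork M]"
    have rd: "map (\<lambda>i. heads N T ! (b + i)) [0..<tm_nin M + tm_nwork M] = ?rd"
      using assms(1) by simp
    have "\<exists>T1. ex N (mstep M b) (c_st cf, T) 1 (c_st (step M xs cf), T1)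
        \<and> tapes_match b (tm_nin M) (tm_nwork M) xs (step M xs cf) T1"
    proof (cases "tm_delta M (c_st cf) ?rd")
      case None
      then have "step M xs cf = cf" using step_eq[OF Suc.prems(1) False] by simp
      moreover have "ex N (mstep M b) (c_st cf, T) 1 (c_st cf, T)"
        unfolding mstep_def by (rule ex_Do_eq[of _ _ _ _ _ "\<lambda>i. heads N T ! i" "\<lambda>_. 0"]) (simp_all add: rd None)
      ultimately show ?thesis using Suc.prems(1) by auto
    next
      case (Some a)
      obtain q ws mv where a: "a = (q, ws, mv)" by (metis prod_cases3)
      have st: "step M xs cf = upd_config (tm_nin M) (tm_nwork M) cf (q, ws, mv)"
        using step_eq[OF Suc.prems(1) False] Some a by simp
      let ?w = "\<lambda>j. if b + tm_nin M \<le> j \<and> j < b + tm_nin M + tm_nwork M then ws ! (j - (b + tm_nin M)) else heads N T ! j"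
      let ?d = "\<lambda>j. if b \<le> j \<and> j < b + tm_nin M + tm_nwork M then mv ! (j - b) else 0"
      have "ex N (mstep M b) (c_st cf, T) 1 (q, upd N ?w ?d T)"
        unfolding mstep_def by (rule ex_Do) (simp add: rd Some a)
      moreover have "tapes_match b (tm_nin M) (tm_nwork M) xs (step M xs cf) (upd N ?w ?d T)"
        unfolding st by (rule tapes_match_upd[OF Suc.prems(1)]) (use assms(1) in \<open>auto simp: upd_def\<close>)
      ultimately show ?thesis unfolding st by (auto simp: upd_config_def)
    qed
    then obtain T1 where T1: "ex N (mstep M b) (c_st cf, T) 1 (c_st (step M xs cf), T1)"
      "tapes_match b (tm_nin M) (tm_nwork M) xs (step M xs cf) T1" by auto
    have e: "(step M xs ^^ Suc t) cf = (step M xs ^^ t) (step M xs cf)"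
      by (simp add: funpow_swap1)
    obtain T' where T': "ex N (While (\<lambda>s r. s \<notin> {1, 2}) (mstep M b)) (c_st (step M xs cf), T1) (2 * t + 1)
     (c_st ((step M xs ^^ Suc t) cf), T')"
      using Suc.IH[OF T1(2)] Suc.prems(2) unfolding e by auto
    have "ex N (While (\<lambda>s r. s \<notin> {1, 2}) (mstep M b)) (c_st cf, T) (1 + (2 * t + 1) + 1)
        (c_st ((step M xs ^^ Suc t) cf), T')"
      by (rule ex_While_True[OF _ T1(1) T']) (use False in auto)
    then show ?thesis by (auto intro: ex_mono)
  qed
qed

text \<open>The simulation only asserts that some final \<open>T'\<close> exists. What it leaves
  untouched is read off from the run itself: only three stacks occur in it, and \<open>mstep\<close>
  alone changes tapes, all inside its window.\<close>

lemma mstep_frame: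
  assumes "ex N (While c (mstep M b)) (s, T) B (s', T')" "j < b \<or> b + tm_nin M + tm_nwork M \<le> j"
  shows "T' j = T j"
proof -
  have inv: "fst c' \<in> {[mstep M b, While c (mstep M b)], [While c (mstep M b)], []} \<and> snd (snd c') j = T j"
    if "c' = (sstep N ^^ t) ([While c (mstep M b)], (s, T))" for c' t
    using that
  proof (induction t arbitrary: c')
    case 0
    then show ?case by auto
  next
    case (Suc t)
    obtain ks s1 T1 where e: "(sstep N ^^ t) ([While c (mstep M b)], (s, T)) = (ks, (s1, T1))"
      by (metis prod_cases3)
    have IH: "ks \<in> {[mstep M b, While c (mstep M b)], [While c (mstep M b)], []}" "T1 j = T j"
      using Suc.IH[OF refl] e by auto
    have c': "c' = sstep N (ks, (s1, T1))" using Suc.prems e by simp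
    from IH(1) consider "ks = [mstep M b, While c (mstep M b)]" | "ks = [While c (mstep M b)]" | "ks = []" by auto
    then show ?case
    proof cases
      case 1
      then show ?thesis unfolding c' mstep_def sstep_def using IH(2) assms(2)
        by (auto simp: upd_def fun_eq_iff split: option.splits prod.splits)
    qed (use IH(2) in \<open>auto simp: c' sstep_def\<close>)
  qed
  obtain t where "\<And>ks. (sstep N ^^ t) (While c (mstep M b) # ks, (s, T)) = (ks, (s', T'))"
    using assms(1) unfolding ex_def by auto
  from this[of "[]"] show ?thesis using inv[OF refl, of t] by simp
qed

lemma ex_sim:
  assumes "b + tm_nin M + tm_nwork M \<le> N" "halts_within M xs t"
    "\<And>i. i < tm_nin M \<Longrightarrow> T (b + i) = inp_sym (xs ! i)"
    "\<And>i. i < tm_nwork M \<Longrightarrow> T (b + tm_nin M + i) = (\<lambda>_. Blank)"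
  shows "\<exists>T'. ex N (sim M b) (s, T) (2 * t + 3) (if tm_output M xs = Some True then 1 else 2, T')
    \<and> (\<forall>j. j < b \<or> b + tm_nin M + tm_nwork M \<le> j \<longrightarrow> T' j = T j)"
proof -
  have h: "c_st ((step M xs ^^ t) (init_config M)) \<in> {1, 2}"
    using assms(2) unfolding halts_within_def run_def .
  obtain T' where T': "ex N (While (\<lambda>s r. s \<notin> {1, 2}) (mstep M b)) (c_st (init_config M), T) (2 * t + 1)
     (c_st ((step M xs ^^ t) (init_config M)), T')"
    using ex_sim_loop[OF assms(1) tapes_match_init[of M T b xs] h] assms(3,4) by blast
  have c: "c_st ((step M xs ^^ t) (init_config M)) = (if tm_output M xs = Some True then 1 else 2)"
    using h tm_output_eq[OF assms(2)] unfolding run_def by auto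
  have i: "c_st (init_config M) = 0" by (simp add: init_config_def)
  have A: "ex N (sim M b) (s, T) (1 + (2 * t + 1) + 1) (if tm_output M xs = Some True then 1 else 2, T')"
    unfolding sim_def by (rule ex_Seq[OF ex_setst]) (use T' in \<open>simp only: c i\<close>)
  have "ex N (sim M b) (s, T) (2 * t + 3) (if tm_output M xs = Some True then 1 else 2, T')"
    by (rule ex_mono[OF A]) simp
  moreover have "\<forall>j. j < b \<or> b + tm_nin M + tm_nwork M \<le> j \<longrightarrow> T' j = T j"
    using mstep_frame[OF T'] by blast
  ultimately show ?thesis by blast
qed

text \<open>A tape with the cells of \<open>r\<close> from the head on and those of \<open>L\<close> (nearest first) to its
  left; all other cells are blank.\<close>

definition tp :: "sym list \<Rightarrow> sym list \<Rightarrow> tape" where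
  "tp L r = (\<lambda>z. if 0 \<le> z then (if nat z < length r then r ! nat z else Blank)
     else (if nat (- z - 1) < length L then L ! nat (- z - 1) else Blank))"

definition bsym :: "bool \<Rightarrow> sym" where
  "bsym b = (if b then S1 else S0)"

lemma bsym_simps [simp]: "bsym b \<noteq> Blank" "bsym b = S1 \<longleftrightarrow> b" "bsym True = S1" "bsym False = S0"
  by (auto simp: bsym_def)

lemma inp_sym_tp: "inp_sym xs = tp [] (map bsym xs)"
  by (auto simp: inp_sym_def tp_def fun_eq_iff bsym_def)

lemma blank_tp: "(\<lambda>_. Blank) = tp [] []"
  by (auto simp: tp_def)

lemma tp_head [simp]: "tp L [] 0 = Blank" "tp L (a # r) 0 = a"
  by (auto simp: tp_def)

lemma tp_right [simp]: "shift 1 (tp L (a # r)) = tp (a # L) r"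
proof
  fix z :: int
  consider "z \<ge> 0" | "z = -1" | "z < -1" by linarith
  then show "shift 1 (tp L (a # r)) z = tp (a # L) r z"
  proof cases
    case 1
    then have "nat (z + 1) = Suc (nat z)" by simp
    then show ?thesis using 1 by (simp add: tp_def shift_def)
  next
    case 3
    then have "nat (- z - 1) = Suc (nat (- (z + 1) - 1))" by linarith
    then show ?thesis using 3 by (simp add: tp_def shift_def)
  qed (simp add: tp_def shift_def)
qed

lemma tp_left [simp]: "shift (-1) (tp (a # L) r) = tp L (a # r)"
proof
  fix z :: int
  consider "z \<ge> 1" | "z = 0" | "z < 0" by linarith
  then show "shift (-1) (tp (a # L) r) z = tp L (a # r) z"
  proof cases
    case 1
    then have "nat z = Suc (nat (z - 1))" by simp
    then show ?thesis using 1 by (simp add: tp_def shift_def)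
  next
    case 3
    then have "nat (- (z - 1) - 1) = Suc (nat (- z - 1))" by linarith
    then show ?thesis using 3 by (simp add: tp_def shift_def)
  qed (simp add: tp_def shift_def)
qed

lemma tp_write [simp]: "(tp L (a # r))(0 := b) = tp L (b # r)" "(tp L [])(0 := b) = tp L [b]"
  by (auto simp: tp_def fun_eq_iff nth_Cons split: nat.splits)

lemma tp_left_Nil [simp]: "shift (-1) (tp [] r) = tp [] (Blank # r)"
  by (auto simp: tp_def shift_def fun_eq_iff nth_Cons nat_add_distrib nat_diff_distrib split: nat.splits)

text \<open>A blank at the end of the left part is indistinguishable from the background. This lets
  a head that ran one cell past the data return to exactly the original tape.\<close>

lemma tp_blank_left [simp]: "tp [Blank] r = tp [] r"
  by (auto simp: tp_def fun_eq_iff)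

text \<open>Unfolding the updates would obscure the tape functions, which only ever need to be
  looked up at known positions.\<close>

declare fun_upd_apply [simp del] fun_upd_same [simp] fun_upd_other [simp]

lemma ex_setst_eq: "h s (heads N T) = s' \<Longrightarrow> ex N (setst h) (s, T) 1 (s', T)"
  using ex_setst[of N h s T] by simp

definition nonblank :: "nat \<Rightarrow> nat \<Rightarrow> sym list \<Rightarrow> bool" where
  "nonblank j s r \<longleftrightarrow> r ! j \<noteq> Blank"

lemma nonblank_heads [simp]: "j < N \<Longrightarrow> nonblank j s (heads N T) \<longleftrightarrow> T j 0 \<noteq> Blank"
  by (simp add: nonblank_def)

section \<open>Rewinding and copying tapes\<close>

definition rewind :: "nat \<Rightarrow> prog" where
  "rewind j = Seq (move j (-1)) (Seq (While (nonblank j) (move j (-1))) (move j 1))"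

lemma wfp_rewind [simp]: "j < N \<Longrightarrow> wfp m N Q (rewind j)"
  by (simp add: rewind_def)

lemma ex_rewind_loop:
  assumes "j < N" "T j = tp (map bsym L) (bsym b # r)"
  shows "ex N (While (nonblank j) (move j (-1))) (s, T) (2 * length L + 3)
    (s, T(j := tp [] (Blank # map bsym (rev L) @ bsym b # r)))"
  using assms(2)
proof (induction L arbitrary: T b r)
  case Nil
  have "ex N (move j (-1)) (s, T) 1 (s, T(j := tp [] (Blank # bsym b # r)))"
    using ex_move[OF assms(1), of "-1" s T] Nil by simp
  moreover have "ex N (While (nonblank j) (move j (-1))) (s, T(j := tp [] (Blank # bsym b # r))) 1
    (s, T(j := tp [] (Blank # bsym b # r)))"
    by (rule ex_While_False) (simp add: assms(1))
  ultimately have "ex N (While (nonblank j) (move j (-1))) (s, T) (1 + 1 + 1) (s, T(j := tp [] (Blank # bsym b # r)))"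
    by (rule ex_While_True[rotated]) (simp add: assms(1) Nil)
  then show ?case unfolding rev.simps list.map append_Nil by (rule ex_mono) simp
next
  case (Cons c L)
  let ?T = "T(j := tp (map bsym L) (bsym c # bsym b # r))"
  have "ex N (move j (-1)) (s, T) 1 (s, ?T)"
    using ex_move[OF assms(1), of "-1" s T] Cons.prems by simp
  moreover have "ex N (While (nonblank j) (move j (-1))) (s, ?T) (2 * length L + 3)
      (s, T(j := tp [] (Blank # map bsym (rev L) @ bsym c # bsym b # r)))"
    using Cons.IH[of ?T c "bsym b # r"] by simp
  ultimately have "ex N (While (nonblank j) (move j (-1))) (s, T) (1 + (2 * length L + 3) + 1)
      (s, T(j := tp [] (Blank # map bsym (rev L) @ bsym c # bsym b # r)))"
    by (rule ex_While_True[rotated]) (simp add: assms(1) Cons.prems)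
  then show ?case unfolding rev.simps map_append list.map append_assoc append_Cons append_Nil
    by (rule ex_mono) simp
qed

text \<open>The unconditional first move allows the head to start on the blank behind the data. The
  loop then crosses \<open>L\<close>, which must consist of bits, and stops on the blank in front of
  it; the last move steps back, and that blank is absorbed by \<open>tp_blank_left\<close>. The part
  \<open>r\<close> is arbitrary.\<close>

lemma ex_rewind:
  assumes "j < N" "T j = tp (map bsym L) r"
  shows "ex N (rewind j) (s, T) (2 * length L + 6) (s, T(j := tp [] (map bsym (rev L) @ r)))"
proof -
  let ?T = "T(j := tp [] (Blank # map bsym (rev L) @ r))"
  have fin: "ex N (move j 1) (s, ?T) 1 (s, T(j := tp [] (map bsym (rev L) @ r)))"
    using ex_move[OF assms(1), of 1 s ?T] by simp
  have "ex N (Seq (move j (-1)) (Seq (While (nonblank j) (move j (-1))) (move j 1))) (s, T)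
     (1 + ((2 * length L + 1) + 1 + 1) + 1) (s, T(j := tp [] (map bsym (rev L) @ r)))"
  proof (cases L)
    case Nil
    have mid: "ex N (While (nonblank j) (move j (-1))) (s, ?T) (2 * length L + 1) (s, ?T)"
      by (rule ex_mono[OF ex_While_False]) (simp_all add: assms(1))
    have "ex N (move j (-1)) (s, T) 1 (s, ?T)"
      using ex_move[OF assms(1), of "-1" s T] assms(2) Nil by simp
    then show ?thesis by (intro ex_Seq[OF _ ex_Seq[OF mid fin]])
  next
    case (Cons b L')
    let ?T' = "T(j := tp (map bsym L') (bsym b # r))"
    have "ex N (While (nonblank j) (move j (-1))) (s, ?T') (2 * length L' + 3) (s, ?T)"
      using ex_rewind_loop[OF assms(1), of ?T' L' b r s] Cons by simp
    then have mid: "ex N (While (nonblank j) (move j (-1))) (s, ?T') (2 * length L + 1) (s, ?T)"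
      by (rule ex_mono) (simp add: Cons)
    have "ex N (move j (-1)) (s, T) 1 (s, ?T')"
      using ex_move[OF assms(1), of "-1" s T] assms(2) Cons by simp
    then show ?thesis by (intro ex_Seq[OF _ ex_Seq[OF mid fin]])
  qed
  then show ?thesis unfolding rewind_def by (rule ex_mono) simp
qed

definition copy :: "nat \<Rightarrow> nat \<Rightarrow> prog" where
  "copy i j = Seq (While (nonblank i) (Seq (act j (\<lambda>s r. r ! i) 1) (move i 1))) (Seq (rewind i) (rewind j))"

lemma wfp_copy [simp]: "i < N \<Longrightarrow> j < N \<Longrightarrow> m \<le> j \<Longrightarrow> wfp m N Q (copy i j)"
  by (simp add: copy_def)

lemma ex_copy_loop:
  assumes "i < N" "j < N" "i \<noteq> j" "T i = tp L (map bsym x)" "T j = tp K []"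
  shows "ex N (While (nonblank i) (Seq (act j (\<lambda>s r. r ! i) 1) (move i 1))) (s, T) (4 * length x + 1)
    (s, T(i := tp (map bsym (rev x) @ L) [], j := tp (map bsym (rev x) @ K) []))"
  using assms(4,5)
proof (induction x arbitrary: T L K)
  case Nil
  then have e: "T(i := tp (map bsym (rev []) @ L) [], j := tp (map bsym (rev []) @ K) []) = T"
    by (auto simp: fun_eq_iff fun_upd_apply)
  show ?case unfolding e
    by (rule ex_mono[OF ex_While_False]) (use Nil assms in auto)
next
  case (Cons b x)
  let ?T1 = "T(j := tp (bsym b # K) [])"
  let ?T2 = "T(j := tp (bsym b # K) [], i := tp (bsym b # L) (map bsym x))"
  have "ex N (act j (\<lambda>s r. r ! i) 1) (s, T) 1 (s, ?T1)"
    using ex_act[OF assms(2), of "\<lambda>s r. r ! i" 1 s T] Cons.prems assms(1) by simp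
  moreover have "ex N (move i 1) (s, ?T1) 1 (s, ?T2)"
    using ex_move[OF assms(1), of 1 s ?T1] Cons.prems assms(3) by simp
  ultimately have a: "ex N (Seq (act j (\<lambda>s r. r ! i) 1) (move i 1)) (s, T) (1 + 1 + 1) (s, ?T2)"
    by (rule ex_Seq)
  have "ex N (While (nonblank i) (Seq (act j (\<lambda>s r. r ! i) 1) (move i 1))) (s, ?T2) (4 * length x + 1)
    (s, ?T2(i := tp (map bsym (rev x) @ bsym b # L) [], j := tp (map bsym (rev x) @ bsym b # K) []))"
    using Cons.IH[of ?T2 "bsym b # L" "bsym b # K"] assms(3)
    by simp
  moreover have "?T2(i := tp (map bsym (rev x) @ bsym b # L) [], j := tp (map bsym (rev x) @ bsym b # K) [])
    = T(i := tp (map bsym (rev (b # x)) @ L) [], j := tp (map bsym (rev (b # x)) @ K) [])"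
    by (auto simp: fun_eq_iff fun_upd_apply)
  ultimately have "ex N (While (nonblank i) (Seq (act j (\<lambda>s r. r ! i) 1) (move i 1))) (s, T)
     ((1 + 1 + 1) + (4 * length x + 1) + 1)
     (s, T(i := tp (map bsym (rev (b # x)) @ L) [], j := tp (map bsym (rev (b # x)) @ K) []))"
    by (intro ex_While_True[OF _ a]) (simp_all add: assms(1) Cons.prems)
  then show ?case by (rule ex_mono) simp
qed

lemma ex_copy:
  assumes "i < N" "j < N" "i \<noteq> j" "T i = tp [] (map bsym x)" "T j = tp [] []"
  shows "ex N (copy i j) (s, T) (8 * length x + 15) (s, T(j := tp [] (map bsym x)))"
proof -
  let ?T1 = "T(i := tp (map bsym (rev x)) [], j := tp (map bsym (rev x)) [])"
  have 1: "ex N (While (nonblank i) (Seq (act j (\<lambda>s r. r ! i) 1) (move i 1))) (s, T) (4 * length x + 1) (s, ?T1)"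
    using ex_copy_loop[OF assms] by simp
  have "ex N (rewind i) (s, ?T1) (2 * length x + 6) (s, ?T1(i := tp [] (map bsym x)))"
    using ex_rewind[OF assms(1), of ?T1 "rev x" "[]" s] assms(3) by simp
  moreover have "ex N (rewind j) (s, ?T1(i := tp [] (map bsym x))) (2 * length x + 6)
     (s, ?T1(i := tp [] (map bsym x), j := tp [] (map bsym x)))"
    using ex_rewind[OF assms(2), of "?T1(i := tp [] (map bsym x))" "rev x" "[]" s] assms(3) by simp
  moreover have "?T1(i := tp [] (map bsym x), j := tp [] (map bsym x)) = T(j := tp [] (map bsym x))"
    using assms(4) by (auto simp: fun_eq_iff fun_upd_apply)
  ultimately have 2: "ex N (Seq (rewind i) (rewind j)) (s, ?T1) ((2 * length x + 6) + (2 * length x + 6) + 1)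
     (s, T(j := tp [] (map bsym x)))"
    using ex_Seq by metis
  show ?thesis unfolding copy_def by (rule ex_mono[OF ex_Seq[OF 1 2]]) simp
qed

fun copies :: "(nat \<times> nat) list \<Rightarrow> prog" where
  "copies [] = setst (\<lambda>s r. s)"
| "copies ((i, j) # ps) = Seq (copy i j) (copies ps)"

lemma wfp_copies [simp]:
  "(\<And>i j. (i, j) \<in> set ps \<Longrightarrow> i < N \<and> j < N \<and> m \<le> j) \<Longrightarrow> wfp m N Q (copies ps)"
proof (induction ps rule: copies.induct)
  case (2 i j ps)
  have "wfp m N Q (copies ps)" by (rule "2.IH") (use "2.prems" in auto)
  then show ?case using "2.prems"[of i j] by simp
qed simp

lemma ex_copies:
  assumes "\<And>i j. (i, j) \<in> set ps \<Longrightarrow> i < N \<and> j < N \<and> (\<exists>x. length x \<le> B \<and> T i = tp [] (map bsym x)) \<and> T j = tp [] []"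
    and "distinct (map snd ps)" "fst ` set ps \<inter> snd ` set ps = {}"
  shows "\<exists>T'. ex N (copies ps) (s, T) (length ps * (8 * B + 16) + 1) (s, T')
    \<and> (\<forall>(i, j) \<in> set ps. T' j = T i) \<and> (\<forall>j. j \<notin> snd ` set ps \<longrightarrow> T' j = T j)"
  using assms
proof (induction ps arbitrary: T rule: copies.induct)
  case 1
  have "ex N (copies []) (s, T) 1 (s, T)" using ex_setst[of N "\<lambda>s r. s" s T] by simp
  then show ?case by auto
next
  case (2 i j ps)
  obtain x where x: "length x \<le> B" "T i = tp [] (map bsym x)" and ij: "i < N" "j < N" "T j = tp [] []" "i \<noteq> j"
    using "2.prems"(1)[of i j] "2.prems"(3) by auto
  let ?T = "T(j := tp [] (map bsym x))"
  have sep: "fst p \<noteq> j" "snd p \<noteq> j" if "p \<in> set ps" for p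
    using "2.prems"(2,3) that by (force, force)
  have c: "ex N (copy i j) (s, T) (8 * B + 15) (s, ?T)"
    by (rule ex_mono[OF ex_copy[OF ij(1,2,4) x(2) ij(3)]]) (use x(1) in simp)
  have "\<exists>T'. ex N (copies ps) (s, ?T) (length ps * (8 * B + 16) + 1) (s, T')
    \<and> (\<forall>(i, j) \<in> set ps. T' j = ?T i) \<and> (\<forall>j. j \<notin> snd ` set ps \<longrightarrow> T' j = ?T j)"
  proof (rule "2.IH")
    fix i' j' assume p: "(i', j') \<in> set ps"
    show "i' < N \<and> j' < N \<and> (\<exists>x. length x \<le> B \<and> ?T i' = tp [] (map bsym x)) \<and> ?T j' = tp [] []"
      using "2.prems"(1)[of i' j'] p sep[OF p] by auto
  qed (use "2.prems"(2,3) in auto)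
  then obtain T' where T': "ex N (copies ps) (s, ?T) (length ps * (8 * B + 16) + 1) (s, T')"
    "\<And>i j. (i, j) \<in> set ps \<Longrightarrow> T' j = ?T i" "\<And>j. j \<notin> snd ` set ps \<Longrightarrow> T' j = ?T j" by auto
  have "ex N (copies ((i, j) # ps)) (s, T) ((8 * B + 15) + (length ps * (8 * B + 16) + 1) + 1) (s, T')"
    unfolding copies.simps by (rule ex_Seq[OF c T'(1)])
  then have "ex N (copies ((i, j) # ps)) (s, T) (length ((i, j) # ps) * (8 * B + 16) + 1) (s, T')"
    by (rule ex_mono) simp
  moreover have "T' j' = T i'" if "(i', j') \<in> set ((i, j) # ps)" for i' j'
  proof (cases "(i', j') \<in> set ps")
    case True
    then show ?thesis using T'(2)[of i' j'] sep[OF True] by simp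
  next
    case False
    then have "i' = i" "j' = j" using that by auto
    moreover have "j \<notin> snd ` set ps" using sep by auto
    ultimately show ?thesis using T'(3)[of j] x(2) by simp
  qed
  moreover have "T' j' = T j'" if "j' \<notin> snd ` set ((i, j) # ps)" for j'
    using T'(3)[of j'] that by auto
  ultimately show ?case by auto
qed

section \<open>Boolean combinations of relations\<close>

lemma tot_select:
  assumes "set I \<subseteq> {..<length xs}"
  shows "tot (map (\<lambda>i. xs ! i) I) \<le> length I * tot xs"
proof -
  have "sum_list (map (\<lambda>i. length (xs ! i)) I) \<le> sum_list (map (\<lambda>_. tot xs) I)"
  proof (rule sum_list_mono)
    fix i assume "i \<in> set I"
    then show "length (xs ! i) \<le> tot xs" using assms by (intro length_le_tot) auto
  qed
  then show ?thesis unfolding tot_def by (simp add: comp_def sum_list_triv)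
qed

text \<open>Projections, permutations, repetitions and Boolean connectives are all instances of
  this. Each machine receives fresh copies of its arguments in its own block of tapes, the second
  block starting at \<open>b2\<close>, so neither run disturbs the other and an input may be used
  several times.\<close>

lemma inPm_combine:
  assumes R1: "inPm (length is1) R1" and R2: "inPm (length is2) R2"
    and I: "set is1 \<subseteq> {..<m}" "set is2 \<subseteq> {..<m}"
  shows "inPm m (\<lambda>xs. g (R1 (map (\<lambda>i. xs ! i) is1)) (R2 (map (\<lambda>i. xs ! i) is2)))"
proof -
  obtain M1 B1 where M1: "wf_tm (length is1) M1" "mono B1" "poly_bounded B1"
     "\<And>xs. length xs = length is1 \<Longrightarrow> (\<exists>t\<le>B1 (tot xs). halts_within M1 xs t) \<and> tm_output M1 xs = Some (R1 xs)"
    using R1 unfolding inPm_def by auto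
  obtain M2 B2 where M2: "wf_tm (length is2) M2" "mono B2" "poly_bounded B2"
     "\<And>xs. length xs = length is2 \<Longrightarrow> (\<exists>t\<le>B2 (tot xs). halts_within M2 xs t) \<and> tm_output M2 xs = Some (R2 xs)"
    using R2 unfolding inPm_def by auto
  define m1 m2 b2 N Q where "m1 = length is1" and "m2 = length is2"
    and "b2 = m + m1 + tm_nwork M1" and "N = b2 + m2 + tm_nwork M2"
    and "Q = tm_nstates M1 + tm_nstates M2"
  have nin: "tm_nin M1 = m1" "tm_nin M2 = m2" and Q3: "3 \<le> Q"
    using M1(1) M2(1) unfolding wf_tm_def m1_def m2_def Q_def by auto
  define ps where "ps = zip is1 [m..<m + m1] @ zip is2 [b2..<b2 + m2]"
  \<comment> \<open>The second simulation overwrites the store, so the verdict of the first is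
    remembered in the control: one of two copies of \<open>fin\<close> is entered.\<close>
  define fin where "fin b = Seq (sim M2 b2) (setst (\<lambda>s r. if g b (s = 1) then 1 else 2))" for b
  define p where "p = Seq (copies ps) (Seq (sim M1 m) (Cond (\<lambda>s r. s = 1) (fin True) (fin False)))"
  have ps: "i < m \<and> m \<le> j \<and> j < N \<and> (j < m + m1 \<or> b2 \<le> j \<and> j < b2 + m2)" if "(i, j) \<in> set ps" for i j
    using that I unfolding ps_def N_def b2_def by (fastforce dest: set_zip_leftD set_zip_rightD)
  have "b2 \<ge> m + m1" unfolding b2_def by simp
  then have dist: "distinct (map snd ps)"
    unfolding ps_def m1_def m2_def by auto
  have wf: "wfp m N Q p"
    unfolding p_def fin_def using ps Q3
    by (fastforce intro!: wfp_copies wfp_sim[OF M1(1)] wfp_sim[OF M2(1)] wfp_setst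
      simp: nin N_def b2_def Q_def)
  define B where "B n = (m1 + m2) * (8 * n + 16) + (2 * B1 (m1 * n) + 2 * B2 (m2 * n)) + 20" for n
  have "poly_bounded (\<lambda>n. B1 (m1 * n))" "poly_bounded (\<lambda>n. B2 (m2 * n))"
    by (intro poly_bounded_compose[OF M1(3)] poly_bounded_compose[OF M2(3)] poly_bounded_intros)+
  then have Bp: "poly_bounded B" unfolding B_def by (intro poly_bounded_intros)
  show ?thesis
  proof (rule inPm_I[OF wf _ _ Bp])
    show "m \<le> N" "0 < Q" using Q3 unfolding N_def b2_def by auto
    fix xs :: "bool list list" assume xs: "length xs = m"
    let ?T0 = "init_tapes m xs"
    let ?x1 = "map (\<lambda>i. xs ! i) is1" and ?x2 = "map (\<lambda>i. xs ! i) is2"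
    have src: "?T0 i = tp [] (map bsym (xs ! i))" if "i < m" for i
      using that by (simp add: init_tapes_def inp_sym_tp)
    have blank: "?T0 j = tp [] []" if "m \<le> j" for j
      using that by (simp add: init_tapes_def blank_tp)
    have "\<exists>T'. ex N (copies ps) (0, ?T0) (length ps * (8 * tot xs + 16) + 1) (0, T')
      \<and> (\<forall>(i, j) \<in> set ps. T' j = ?T0 i) \<and> (\<forall>j. j \<notin> snd ` set ps \<longrightarrow> T' j = ?T0 j)"
    proof (rule ex_copies[OF _ dist])
      fix i j assume ij: "(i, j) \<in> set ps"
      then show "i < N \<and> j < N \<and> (\<exists>x. length x \<le> tot xs \<and> ?T0 i = tp [] (map bsym x)) \<and> ?T0 j = tp [] []"
        using ps[OF ij] src[of i] blank[of j] length_le_tot[of i xs] xs by auto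
    next
      have "fst ` set ps \<subseteq> {..<m}" "snd ` set ps \<subseteq> {m..}" using ps by fastforce+
      then show "fst ` set ps \<inter> snd ` set ps = {}" by fastforce
    qed
    then obtain T1 where T1: "ex N (copies ps) (0, ?T0) (length ps * (8 * tot xs + 16) + 1) (0, T1)"
      "\<And>i j. (i, j) \<in> set ps \<Longrightarrow> T1 j = ?T0 i" "\<And>j. j \<notin> snd ` set ps \<Longrightarrow> T1 j = ?T0 j" by auto
    have T1_in1: "T1 (m + i) = inp_sym (?x1 ! i)" if "i < m1" for i
    proof -
      have "(is1 ! i, m + i) \<in> set ps" using that unfolding ps_def m1_def by (auto simp: set_zip)
      then show ?thesis using T1(2) ps that by (simp add: src inp_sym_tp m1_def) 
    qed
    have T1_in2: "T1 (b2 + i) = inp_sym (?x2 ! i)" if "i < m2" for i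
    proof -
      have "(is2 ! i, b2 + i) \<in> set ps" using that unfolding ps_def m2_def by (auto simp: set_zip)
      then show ?thesis using T1(2) ps that by (simp add: src inp_sym_tp m2_def)
    qed
    have T1_blank: "T1 j = (\<lambda>_. Blank)" if "m + m1 \<le> j \<and> j < b2 \<or> b2 + m2 \<le> j" for j
    proof -
      have "j \<notin> snd ` set ps" using ps that unfolding b2_def by fastforce
      moreover have "m \<le> j" using that unfolding b2_def by auto
      ultimately show ?thesis using T1(3) blank by (simp add: blank_tp)
    qed
    obtain t1 where t1: "t1 \<le> B1 (tot ?x1)" "halts_within M1 ?x1 t1" and o1: "tm_output M1 ?x1 = Some (R1 ?x1)"
      using M1(4)[of ?x1] by auto
    obtain t2 where t2: "t2 \<le> B2 (tot ?x2)" "halts_within M2 ?x2 t2" and o2: "tm_output M2 ?x2 = Some (R2 ?x2)"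
      using M2(4)[of ?x2] by auto
    have "B1 (tot ?x1) \<le> B1 (m1 * tot xs)" "B2 (tot ?x2) \<le> B2 (m2 * tot xs)"
      using tot_select[of is1 xs] tot_select[of is2 xs] I xs unfolding m1_def m2_def
      by (auto intro!: monoD[OF M1(2)] monoD[OF M2(2)])
    then have tb: "t1 \<le> B1 (m1 * tot xs)" "t2 \<le> B2 (m2 * tot xs)" using t1(1) t2(1) by auto
    obtain T2 where T2: "ex N (sim M1 m) (0, T1) (2 * t1 + 3) (if R1 ?x1 then 1 else 2, T2)"
      "\<And>j. b2 \<le> j \<Longrightarrow> T2 j = T1 j"
      using ex_sim[OF _ t1(2), of m N T1 0] T1_in1 T1_blank o1 unfolding nin N_def b2_def by auto
    obtain T3 where T3: "ex N (sim M2 b2) (if R1 ?x1 then 1 else 2, T2) (2 * t2 + 3) (if R2 ?x2 then 1 else 2, T3)"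
      using ex_sim[OF _ t2(2), of b2 N T2 "if R1 ?x1 then 1 else 2"] T1_in2 T1_blank o2 T2(2) unfolding nin N_def by auto
    have "ex N (fin b) (if R1 ?x1 then 1 else 2, T2) (2 * t2 + 3 + 1 + 1)
       (if g b (R2 ?x2) then 1 else 2, T3)" for b
      unfolding fin_def
      by (rule ex_Seq[OF T3], rule ex_setst_eq) auto
    from this[of "R1 ?x1"] have "ex N (Cond (\<lambda>s r. s = 1) (fin True) (fin False)) (if R1 ?x1 then 1 else 2, T2) (2 * t2 + 3 + 1 + 1 + 1)
       (if g (R1 ?x1) (R2 ?x2) then 1 else 2, T3)"
      by (intro ex_Cond) (cases "R1 ?x1"; simp)
    note ex_Seq[OF T1(1)[folded p_def] ex_Seq[OF T2(1) this]]
    then have "ex N p (0, ?T0) (B (tot xs)) (if g (R1 ?x1) (R2 ?x2) then 1 else 2, T3)"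
      unfolding p_def by (rule ex_mono) (use tb in \<open>simp add: B_def ps_def m1_def m2_def algebra_simps\<close>)
    then show "\<exists>T. ex N p (0, ?T0) (B (tot xs)) (if g (R1 ?x1) (R2 ?x2) then 1 else 2, T)"
      by blast
  qed
qed

lemma inPm_cong:
  assumes R: "inPm m R" and e: "\<And>xs. length xs = m \<Longrightarrow> R xs = R' xs"
  shows "inPm m R'"
proof -
  obtain M B where M: "wf_tm m M" "mono B" "poly_bounded B"
     "\<And>xs. length xs = m \<Longrightarrow> (\<exists>t\<le>B (tot xs). halts_within M xs t) \<and> tm_output M xs = Some (R xs)"
    using R unfolding inPm_def by auto
  have "(\<exists>t\<le>B (tot xs). halts_within M xs t) \<and> tm_output M xs = Some (R' xs)" if "length xs = m" for xs
    using M(4)[OF that] e[OF that] by simp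
  then show ?thesis unfolding inPm_def using M(1-3) by blast
qed

lemma inPm_combineI:
  assumes "inPm m1 R1" "inPm m2 R2" "length I = m1" "length J = m2" "set I \<subseteq> {..<m}" "set J \<subseteq> {..<m}"
    and "\<And>xs. length xs = m \<Longrightarrow> R xs \<longleftrightarrow> g (R1 (map (\<lambda>i. xs ! i) I)) (R2 (map (\<lambda>i. xs ! i) J))"
  shows "inPm m R"
  by (rule inPm_cong[OF inPm_combine[of I R1 J R2 m g]]) (use assms in auto)

section \<open>Comparing strings and evaluating NOR circuits\<close>

text \<open>The number whose binary expansion is 1 followed by the reversed string. It compares
  lengths before anything else, so a string of smaller rank is never longer, which is what bounds
  the quantifier over earlier programs. The first bit is the least significant, which suits a single
  scan from left to right.\<close>

fun rank :: "bool list \<Rightarrow> nat" where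
  "rank [] = 1"
| "rank (a # u) = 2 * rank u + of_bool a"

lemma rank_bounds: "2 ^ length u \<le> rank u" "rank u < 2 ^ Suc (length u)"
  by (induction u) auto

lemma rank_less_of_length: "length u < length v \<Longrightarrow> rank u < rank v"
  using rank_bounds[of u] rank_bounds[of v] power_increasing[of "Suc (length u)" "length v" "2::nat"]
  by simp

lemma rank_pos: "0 < rank u"
  by (induction u) auto

lemma rank_inject: "rank u = rank v \<Longrightarrow> u = v"
proof (induction u arbitrary: v)
  case Nil
  then show ?case using rank_pos[of "tl v"] by (cases v) auto
next
  case (Cons a u)
  then obtain b v' where v: "v = b # v'" using rank_pos[of u] by (cases v) auto
  have "2 * rank u + of_bool a = 2 * rank v' + of_bool b" using Cons.prems v by simp
  then have "rank u = rank v' \<and> a = b" by (cases a; cases b; simp; presburger)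
  then show ?case using Cons.IH v by simp
qed

fun scan :: "nat \<Rightarrow> bool list \<Rightarrow> bool list \<Rightarrow> nat \<times> bool \<times> bool" where
  "scan s (a # u) (b # v) = scan (if a \<noteq> b then (if b then 1 else 2) else s) u v"
| "scan s u v = (s, u \<noteq> [], v \<noteq> [])"

lemma scan_length: "snd (scan s u v) = (length v < length u, length u < length v)"
  by (induction s u v rule: scan.induct) auto

text \<open>Later bits weigh more, so each difference overrides the verdict of all earlier ones: 1
  if the second string is larger there, 2 if the first is. The initial \<open>s\<close> survives
  only when the strings agree.\<close>

lemma scan_rank:
  "length u = length v \<Longrightarrow> fst (scan s u v) = (if rank u < rank v then 1 else if rank v < rank u then 2 else s)"
proof (induction s u v rule: scan.induct)
  case (1 s a u b v)
  have "2 * rank u + 1 \<noteq> 2 * rank v" "2 * rank u \<noteq> 2 * rank v + 1" by presburger+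
  then show ?case using 1 by (cases a; cases b) auto
qed auto

definition scan_prog :: "(nat \<Rightarrow> bool \<Rightarrow> bool \<Rightarrow> bool) \<Rightarrow> prog" where
  "scan_prog g = Seq (While (\<lambda>s r. r ! 0 \<noteq> Blank \<and> r ! 1 \<noteq> Blank)
       (Seq (setst (\<lambda>s r. if r ! 0 \<noteq> r ! 1 then (if r ! 1 = S1 then 1 else 2) else s))
         (Seq (move 0 1) (move 1 1))))
     (setst (\<lambda>s r. if g s (r ! 0 \<noteq> Blank) (r ! 1 \<noteq> Blank) then 1 else 2))"

lemma bsym_eq [simp]: "bsym a = bsym b \<longleftrightarrow> a = b"
  by (auto simp: bsym_def)

lemma tp_head_blank [simp]: "tp L (map bsym u) 0 = Blank \<longleftrightarrow> u = []"
  by (cases u) auto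

lemma ex_scan_loop:
  assumes "T 0 = tp K (map bsym u)" "T 1 = tp L (map bsym v)"
  shows "\<exists>T'. ex 2 (While (\<lambda>s r. r ! 0 \<noteq> Blank \<and> r ! 1 \<noteq> Blank)
       (Seq (setst (\<lambda>s r. if r ! 0 \<noteq> r ! 1 then (if r ! 1 = S1 then 1 else 2) else s))
         (Seq (move 0 1) (move 1 1)))) (s, T) (6 * length u + 1) (fst (scan s u v), T')
    \<and> (T' 0 0 \<noteq> Blank) = fst (snd (scan s u v)) \<and> (T' 1 0 \<noteq> Blank) = snd (snd (scan s u v))"
  (is "\<exists>T'. ex 2 ?w _ _ _ \<and> _ \<and> _")
  using assms
proof (induction s u v arbitrary: T K L rule: scan.induct)
  case (1 s a u b v)
  let ?s = "if a \<noteq> b then (if b then 1 else 2) else s"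
  let ?T1 = "T(0 := tp (bsym a # K) (map bsym u))"
  let ?T2 = "?T1(1 := tp (bsym b # L) (map bsym v))"
  have s1: "ex 2 (setst (\<lambda>s r. if r ! 0 \<noteq> r ! 1 then (if r ! 1 = S1 then 1 else 2) else s)) (s, T) 1 (?s, T)"
    by (rule ex_setst_eq) (use "1.prems" in auto)
  have s2: "ex 2 (move 0 1) (?s, T) 1 (?s, ?T1)" using ex_move[of 0 2 1 ?s T] "1.prems" by simp
  have s3: "ex 2 (move 1 1) (?s, ?T1) 1 (?s, ?T2)" using ex_move[of 1 2 1 ?s ?T1] "1.prems" by simp
  obtain T' where T': "ex 2 ?w (?s, ?T2) (6 * length u + 1) (fst (scan ?s u v), T')"
     "(T' 0 0 \<noteq> Blank) = fst (snd (scan ?s u v))" "(T' 1 0 \<noteq> Blank) = snd (snd (scan ?s u v))"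
    using "1.IH"[of ?T2 "bsym a # K" "bsym b # L"] by auto
  have "ex 2 ?w (s, T) ((1 + (1 + 1 + 1) + 1) + (6 * length u + 1) + 1) (fst (scan ?s u v), T')"
    by (rule ex_While_True[OF _ ex_Seq[OF s1 ex_Seq[OF s2 s3]] T'(1)]) (use "1.prems" in auto)
  then have "ex 2 ?w (s, T) (6 * length (a # u) + 1) (fst (scan ?s u v), T')"
    by (rule ex_mono) simp
  then show ?case using T'(2,3) by auto
next
  case ("2_1" s v)
  then have "ex 2 ?w (s, T) 1 (s, T)" by (intro ex_While_False) auto
  then show ?case using "2_1" by auto
next
  case ("2_2" s u)
  then have "ex 2 ?w (s, T) 1 (s, T)" by (intro ex_While_False) auto
  then have "ex 2 ?w (s, T) (6 * length u + 1) (s, T)" by (rule ex_mono) simp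
  then show ?case using "2_2" by (cases u) auto
qed

lemma inPm_scan:
  "inPm 2 (\<lambda>xs. case scan 0 (xs ! 0) (xs ! 1) of (s, a, b) \<Rightarrow> g s a b)"
proof (rule inPm_I[where N = 2 and Q = 3 and p = "scan_prog g" and B = "\<lambda>n. 6 * n + 3"])
  show "wfp 2 2 3 (scan_prog g)" unfolding scan_prog_def by auto
  show "poly_bounded (\<lambda>n. 6 * n + 3)" by (intro poly_bounded_intros)
  fix xs :: "bool list list" assume l: "length xs = 2"
  obtain T' where T': "ex 2 (While (\<lambda>s r. r ! 0 \<noteq> Blank \<and> r ! 1 \<noteq> Blank)
       (Seq (setst (\<lambda>s r. if r ! 0 \<noteq> r ! 1 then (if r ! 1 = S1 then 1 else 2) else s))
         (Seq (move 0 1) (move 1 1)))) (0, init_tapes 2 xs) (6 * length (xs ! 0) + 1) (fst (scan 0 (xs ! 0) (xs ! 1)), T')"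
    "(T' 0 0 \<noteq> Blank) = fst (snd (scan 0 (xs ! 0) (xs ! 1)))"
    "(T' 1 0 \<noteq> Blank) = snd (snd (scan 0 (xs ! 0) (xs ! 1)))"
    using ex_scan_loop[of "init_tapes 2 xs" "[]" "xs ! 0" "[]" "xs ! 1" 0]
    by (auto simp: init_tapes_def inp_sym_tp)
  let ?b = "case scan 0 (xs ! 0) (xs ! 1) of (s, a, b) \<Rightarrow> g s a b"
  have f: "ex 2 (setst (\<lambda>s r. if g s (r ! 0 \<noteq> Blank) (r ! 1 \<noteq> Blank) then 1 else 2))
     (fst (scan 0 (xs ! 0) (xs ! 1)), T') 1 (if ?b then 1 else 2, T')"
    by (rule ex_setst_eq) (use T'(2,3) in \<open>auto split: prod.splits\<close>)
  have "ex 2 (scan_prog g) (0, init_tapes 2 xs) (6 * tot xs + 3) (if ?b then 1 else 2, T')"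
    unfolding scan_prog_def
    by (rule ex_mono[OF ex_Seq[OF T'(1) f]]) (use length_le_tot[of 0 xs] l in simp)
  then show "\<exists>T. ex 2 (scan_prog g) (0, init_tapes 2 xs) (6 * tot xs + 3) (if ?b then 1 else 2, T)" by blast
qed auto

lemma inPm_length_le: "inPm 2 (\<lambda>xs. length (xs ! 0) \<le> length (xs ! 1))"
proof -
  have "(case scan 0 u v of (s, a, b) \<Rightarrow> \<not> a) \<longleftrightarrow> length u \<le> length v" for u v
    using scan_length[of 0 u v] by (auto split: prod.splits)
  then show ?thesis using inPm_scan[of "\<lambda>s a b. \<not> a"] by simp
qed

lemma inPm_rank_less: "inPm 2 (\<lambda>xs. rank (xs ! 0) < rank (xs ! 1))"
proof -
  have "(case scan 0 u v of (s, a, b) \<Rightarrow> b \<or> \<not> a \<and> s = 1) \<longleftrightarrow> rank u < rank v" for u v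
    using scan_length[of 0 u v] scan_rank[of u v 0] rank_less_of_length[of u v] rank_less_of_length[of v u]
    by (cases "length u = length v") (auto split: prod.splits if_splits)
  then show ?thesis using inPm_scan[of "\<lambda>s a b. b \<or> \<not> a \<and> s = 1"] by simp
qed

text \<open>A program \<open>w\<close> is read as the rows of a NOR circuit: a row has one bit per value
  computed so far, the values start out as the input, and each completed row appends the NOR of the
  values it selects. The zipper \<open>L\<close>, \<open>r\<close> holds these values during a row.\<close>

function nor_run :: "bool list \<Rightarrow> bool list \<Rightarrow> bool list \<Rightarrow> bool \<Rightarrow> bool" where
  "nor_run [] L r acc = (\<not> acc)"
| "nor_run (b # w) L [] acc = nor_run (b # w) [] (rev L @ [\<not> acc]) False"
| "nor_run (b # w) L (c # r) acc = nor_run w (c # L) r (acc \<or> (b \<and> c))"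
  by pat_completeness auto
termination
  \<comment> \<open>Completing a row consumes no code, but it leaves a nonempty right part, so the
    next call consumes a bit; the second measure accounts for this.\<close>
  by (relation "measures [\<lambda>(w, L, r, acc). length w, \<lambda>(w, L, r, acc). if r = [] then 1 else 0]") auto

text \<open>Every string is a program: when the code ends, the NOR of what the current row has
  selected so far is the output, whether or not the row is complete. No syntax test is needed, and
  the counting argument may range over all strings.\<close>

definition nor_eval :: "bool list \<Rightarrow> bool list \<Rightarrow> bool" where
  "nor_eval w x = nor_run w [] x False"

definition nor_loop :: prog where
  "nor_loop = While (nonblank 0) (Cond (\<lambda>s r. r ! 2 = Blank)
      (Seq (act 2 (\<lambda>s r. if s = 0 then S1 else S0) 0) (Seq (rewind 2) (setst (\<lambda>s r. 0))))
      (Seq (setst (\<lambda>s r. if r ! 0 = S1 \<and> r ! 2 = S1 then 1 else s)) (Seq (move 0 1) (move 2 1))))"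

abbreviation "nor_steps w r \<equiv> 2 * length w + (if r = [] then 1 else 0)"

text \<open>\<open>nor_steps\<close> bounds the rounds still to come: each bit costs one round to
  consume it and at most one to complete a row in front of it. A round lengthens the value list by
  at most one, so list length plus \<open>nor_steps\<close> never grows and bounds the cost of every
  rewind.\<close>

lemma ex_nor_loop:
  assumes "T 0 = tp K (map bsym w)" "T 2 = tp (map bsym L) (map bsym r)"
  shows "\<exists>T' s'. ex 3 nor_loop (of_bool acc, T)
     (nor_steps w r * (2 * (length L + length r + nor_steps w r) + 20) + 1) (s', T')
    \<and> (s' = 0 \<longleftrightarrow> nor_run w L r acc)"
  using assms
proof (induction w L r acc arbitrary: T K rule: nor_run.induct)
  case (1 L r acc)
  have "ex 3 nor_loop (of_bool acc, T) 1 (of_bool acc, T)"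
    unfolding nor_loop_def by (rule ex_While_False) (use 1 in simp)
  then have "ex 3 nor_loop (of_bool acc, T) (nor_steps [] r * (2 * (length L + length r + nor_steps [] r) + 20) + 1) (of_bool acc, T)"
    by (rule ex_mono) simp
  then show ?case by (intro exI[of _ T] exI[of _ "of_bool acc"]) simp
next
  case (2 b w L acc)
  let ?T1 = "T(2 := tp (map bsym L) [bsym (\<not> acc)])"
  let ?T2 = "T(2 := tp [] (map bsym (rev L @ [\<not> acc])))"
  have s1: "ex 3 (act 2 (\<lambda>s r. if s = 0 then S1 else S0) 0) (of_bool acc, T) 1 (of_bool acc, ?T1)"
    using ex_act[of 2 3 "\<lambda>s r. if s = 0 then S1 else S0" 0 "of_bool acc" T] "2.prems"(2) by (cases acc) auto
  have s2: "ex 3 (rewind 2) (of_bool acc, ?T1) (2 * length L + 6) (of_bool acc, ?T2)"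
    using ex_rewind[of 2 3 ?T1 L "[bsym (\<not> acc)]" "of_bool acc"] by simp
  have s3: "ex 3 (setst (\<lambda>s r. 0)) (of_bool acc, ?T2) 1 (of_bool False, ?T2)"
    by (rule ex_setst_eq) simp
  obtain T' s' where T': "ex 3 nor_loop (of_bool False, ?T2)
     (nor_steps (b # w) (rev L @ [\<not> acc]) * (2 * (length ([] :: bool list) + length (rev L @ [\<not> acc]) + nor_steps (b # w) (rev L @ [\<not> acc])) + 20) + 1) (s', T')"
    "s' = 0 \<longleftrightarrow> nor_run (b # w) [] (rev L @ [\<not> acc]) False"
    using "2.IH"[of ?T2 K] "2.prems"(1) by auto
  let ?B = "nor_steps (b # w) (rev L @ [\<not> acc]) * (2 * (length ([] :: bool list) + length (rev L @ [\<not> acc]) + nor_steps (b # w) (rev L @ [\<not> acc])) + 20) + 1"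
  have "ex 3 nor_loop (of_bool acc, T) ((1 + ((2 * length L + 6) + 1 + 1) + 1 + 1) + ?B + 1) (s', T')"
    unfolding nor_loop_def
    by (rule ex_While_True[OF _ ex_Cond T'(1)[unfolded nor_loop_def]])
       (use "2.prems" ex_Seq[OF s1 ex_Seq[OF s2 s3]] in auto)
  then have "ex 3 nor_loop (of_bool acc, T) (nor_steps (b # w) [] * (2 * (length L + length ([] :: bool list) + nor_steps (b # w) []) + 20) + 1) (s', T')"
    by (rule ex_mono) (simp add: algebra_simps)
  then show ?case using T'(2) by (intro exI[of _ T'] exI[of _ s']) simp
next
  case (3 b w L c r acc)
  let ?acc = "acc \<or> (b \<and> c)"
  let ?T1 = "T(0 := tp (bsym b # K) (map bsym w))"
  let ?T2 = "?T1(2 := tp (map bsym (c # L)) (map bsym r))"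
  have s1: "ex 3 (setst (\<lambda>s r. if r ! 0 = S1 \<and> r ! 2 = S1 then 1 else s)) (of_bool acc, T) 1 (of_bool ?acc, T)"
    by (rule ex_setst_eq) (use "3.prems" in auto)
  have s2: "ex 3 (move 0 1) (of_bool ?acc, T) 1 (of_bool ?acc, ?T1)"
    using ex_move[of 0 3 1 "of_bool ?acc" T] "3.prems" by simp
  have s3: "ex 3 (move 2 1) (of_bool ?acc, ?T1) 1 (of_bool ?acc, ?T2)"
    using ex_move[of 2 3 1 "of_bool ?acc" ?T1] "3.prems" by simp
  let ?B = "nor_steps w r * (2 * (length (c # L) + length r + nor_steps w r) + 20) + 1"
  obtain T' s' where T': "ex 3 nor_loop (of_bool ?acc, ?T2) ?B (s', T')"
    "s' = 0 \<longleftrightarrow> nor_run w (c # L) r ?acc"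
    using "3.IH"[of ?T2 "bsym b # K"] by auto
  have "ex 3 nor_loop (of_bool acc, T) ((1 + (1 + 1 + 1) + 1 + 1) + ?B + 1) (s', T')"
    unfolding nor_loop_def
    by (rule ex_While_True[OF _ ex_Cond T'(1)[unfolded nor_loop_def]])
       (use "3.prems" ex_Seq[OF s1 ex_Seq[OF s2 s3]] in auto)
  moreover have "nor_steps w r * (2 * (length (c # L) + length r + nor_steps w r) + 20)
     \<le> (nor_steps (b # w) (c # r) - 1) * (2 * (length L + length (c # r) + nor_steps (b # w) (c # r)) + 20)"
    by (intro mult_mono) auto
  ultimately have "ex 3 nor_loop (of_bool acc, T) (nor_steps (b # w) (c # r) * (2 * (length L + length (c # r) + nor_steps (b # w) (c # r)) + 20) + 1) (s', T')"
    by (elim ex_mono) (simp add: algebra_simps)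
  then show ?case using T'(2) by (intro exI[of _ T'] exI[of _ s']) simp
qed

text \<open>The value list grows in place behind the input, so the input is first copied to a work
  tape. The store holds the accumulated disjunction, hence a final store of 0 means that the NOR is
  true.\<close>

definition nor_prog :: prog where
  "nor_prog = Seq (copy 1 2) (Seq nor_loop (setst (\<lambda>s r. if s = 0 then 1 else 2)))"

lemma inPm_nor_eval: "inPm 2 (\<lambda>xs. nor_eval (xs ! 0) (xs ! 1))"
proof -
  define B where "B n = (8 * n + 15) + ((2 * n + 1) * (2 * (n + (2 * n + 1)) + 20) + 1) + 3" for n :: nat
  have Bp: "poly_bounded B" unfolding B_def by (intro poly_bounded_intros)
  show ?thesis
  proof (rule inPm_I[where N = 3 and Q = 3 and p = nor_prog, OF _ _ _ Bp])
    show "wfp 2 3 3 nor_prog" unfolding nor_prog_def nor_loop_def by auto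
    fix xs :: "bool list list" assume l: "length xs = 2"
    let ?T = "init_tapes 2 xs" and ?w = "xs ! 0" and ?x = "xs ! 1"
    have T: "?T 0 = tp [] (map bsym ?w)" "?T 1 = tp [] (map bsym ?x)" "?T 2 = tp [] []"
      by (auto simp: init_tapes_def inp_sym_tp blank_tp)
    let ?T1 = "?T(2 := tp [] (map bsym ?x))"
    have c: "ex 3 (copy 1 2) (0, ?T) (8 * length ?x + 15) (of_bool False, ?T1)"
      using ex_copy[of 1 3 2 ?T ?x 0] T by simp
    obtain s' T' where T': "ex 3 nor_loop (of_bool False, ?T1)
      (nor_steps ?w ?x * (2 * (length ([] :: bool list) + length ?x + nor_steps ?w ?x) + 20) + 1) (s', T')"
      "s' = 0 \<longleftrightarrow> nor_run ?w [] ?x False"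
      using ex_nor_loop[of ?T1 "[]" ?w "[]" ?x False] T(1) by auto
    have f: "ex 3 (setst (\<lambda>s r. if s = 0 then 1 else 2)) (s', T') 1 (if nor_eval ?w ?x then 1 else 2, T')"
      by (rule ex_setst_eq) (simp add: T'(2) nor_eval_def)
    have le: "length ?w \<le> tot xs" "length ?x \<le> tot xs"
      using length_le_tot[of 0 xs] length_le_tot[of 1 xs] l by auto
    have "nor_steps ?w ?x * (2 * (length ([] :: bool list) + length ?x + nor_steps ?w ?x) + 20)
      \<le> (2 * tot xs + 1) * (2 * (tot xs + (2 * tot xs + 1)) + 20)"
      by (intro mult_mono add_mono) (use le in auto)
    then have "ex 3 nor_prog (0, ?T) (B (tot xs)) (if nor_eval ?w ?x then 1 else 2, T')"
      unfolding nor_prog_def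
      by (intro ex_mono[OF ex_Seq[OF c ex_Seq[OF T'(1) f]]]) (use le in \<open>simp add: B_def\<close>)
    then show "\<exists>T. ex 3 nor_prog (0, ?T) (B (tot xs)) (if nor_eval ?w ?x then 1 else 2, T)" by blast
  qed auto
qed

section \<open>Padding\<close>

lemma tot_snoc: "tot (xs @ [w]) = tot xs + length w"
  by (simp add: tot_def)

definition fill :: "nat \<Rightarrow> nat \<Rightarrow> prog" where
  "fill c d = Seq (While (nonblank c) (Seq (act d (\<lambda>s r. S1) 1) (move c 1))) (rewind c)"

lemma ex_fill_loop:
  assumes "c < N" "d < N" "c \<noteq> d" "T c = tp (map bsym K) (map bsym x)"
    "T d = tp (map bsym (replicate a True)) []"
  shows "ex N (While (nonblank c) (Seq (act d (\<lambda>s r. S1) 1) (move c 1))) (s, T) (4 * length x + 1)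
    (s, T(c := tp (map bsym (rev x @ K)) [], d := tp (map bsym (replicate (a + length x) True)) []))"
    (is "ex N ?w _ _ _")
  using assms(4,5)
proof (induction x arbitrary: T K a)
  case Nil
  then have e: "T(c := tp (map bsym (rev [] @ K)) [], d := tp (map bsym (replicate (a + length []) True)) []) = T"
    by (auto simp: fun_eq_iff fun_upd_apply)
  show ?case unfolding e
    by (rule ex_mono[OF ex_While_False]) (use Nil assms in auto)
next
  case (Cons b x)
  let ?T1 = "T(d := tp (map bsym (replicate (Suc a) True)) [])"
  let ?T2 = "?T1(c := tp (map bsym (b # K)) (map bsym x))"
  have "ex N (act d (\<lambda>s r. S1) 1) (s, T) 1 (s, ?T1)"
    using ex_act[OF assms(2), of "\<lambda>s r. S1" 1 s T] Cons.prems by simp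
  moreover have "ex N (move c 1) (s, ?T1) 1 (s, ?T2)"
    using ex_move[OF assms(1), of 1 s ?T1] Cons.prems assms(3) by simp
  ultimately have a: "ex N (Seq (act d (\<lambda>s r. S1) 1) (move c 1)) (s, T) (1 + 1 + 1) (s, ?T2)"
    by (rule ex_Seq)
  have "ex N ?w (s, ?T2) (4 * length x + 1)
    (s, ?T2(c := tp (map bsym (rev x @ b # K)) [], d := tp (map bsym (replicate (Suc a + length x) True)) []))"
    using Cons.IH[of ?T2 "b # K" "Suc a"] assms(3) by simp
  moreover have "?T2(c := tp (map bsym (rev x @ b # K)) [], d := tp (map bsym (replicate (Suc a + length x) True)) [])
    = T(c := tp (map bsym (rev (b # x) @ K)) [], d := tp (map bsym (replicate (a + length (b # x)) True)) [])"
    by (auto simp: fun_eq_iff fun_upd_apply)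
  ultimately have "ex N ?w (s, T) ((1 + 1 + 1) + (4 * length x + 1) + 1)
     (s, T(c := tp (map bsym (rev (b # x) @ K)) [], d := tp (map bsym (replicate (a + length (b # x)) True)) []))"
    by (intro ex_While_True[OF _ a]) (simp_all add: assms(1) Cons.prems)
  then show ?case by (rule ex_mono) simp
qed

lemma ex_fill:
  assumes "c < N" "d < N" "c \<noteq> d" "T c = tp [] (map bsym x)" "T d = tp (map bsym (replicate a True)) []"
  shows "ex N (fill c d) (s, T) (6 * length x + 8)
    (s, T(d := tp (map bsym (replicate (a + length x) True)) []))"
proof -
  let ?T1 = "T(c := tp (map bsym (rev x)) [], d := tp (map bsym (replicate (a + length x) True)) [])"
  have 1: "ex N (While (nonblank c) (Seq (act d (\<lambda>s r. S1) 1) (move c 1))) (s, T) (4 * length x + 1) (s, ?T1)"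
    using ex_fill_loop[of c N d T "[]" x a s] assms by simp
  have "?T1(c := tp [] (map bsym x)) = T(d := tp (map bsym (replicate (a + length x) True)) [])"
    using assms(3,4) by (auto simp: fun_eq_iff fun_upd_apply)
  then have 2: "ex N (rewind c) (s, ?T1) (2 * length x + 6) (s, T(d := tp (map bsym (replicate (a + length x) True)) []))"
    using ex_rewind[OF assms(1), of ?T1 "rev x" "[]" s] assms(3) by simp
  show ?thesis unfolding fill_def by (rule ex_mono[OF ex_Seq[OF 1 2]]) simp
qed

lemma ex_fill_square:
  assumes "i < N" "c < N" "d < N" "c \<noteq> d" "i \<noteq> c" "i \<noteq> d"
    "T i = tp L (map bsym y)" "T c = tp [] (map bsym x)" "T d = tp (map bsym (replicate a True)) []"
  shows "\<exists>T'. ex N (While (nonblank i) (Seq (fill c d) (move i 1))) (s, T) (length y * (6 * length x + 11) + 1) (s, T')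
    \<and> T' d = tp (map bsym (replicate (a + length y * length x) True)) [] \<and> (\<forall>j. j \<notin> {i, d} \<longrightarrow> T' j = T j)"
    (is "\<exists>T'. ex N ?w _ _ _ \<and> _ \<and> _")
  using assms(7-9)
proof (induction y arbitrary: T L a)
  case Nil
  have "ex N ?w (s, T) 1 (s, T)" by (rule ex_While_False) (use Nil assms in auto)
  then show ?case using Nil by auto
next
  case (Cons b y)
  let ?T1 = "T(d := tp (map bsym (replicate (a + length x) True)) [])"
  let ?T2 = "?T1(i := tp (bsym b # L) (map bsym y))"
  have 1: "ex N (fill c d) (s, T) (6 * length x + 8) (s, ?T1)"
    using ex_fill[OF assms(2-4)] Cons.prems by simp
  have 2: "ex N (move i 1) (s, ?T1) 1 (s, ?T2)"
    using ex_move[OF assms(1), of 1 s ?T1] Cons.prems assms(6) by simp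
  obtain T' where T': "ex N ?w (s, ?T2) (length y * (6 * length x + 11) + 1) (s, T')"
    "T' d = tp (map bsym (replicate (a + length x + length y * length x) True)) []" "\<And>j. j \<notin> {i, d} \<Longrightarrow> T' j = ?T2 j"
    using Cons.IH[of ?T2 "bsym b # L" "a + length x"] Cons.prems assms by auto
  have "ex N ?w (s, T) ((6 * length x + 8 + 1 + 1) + (length y * (6 * length x + 11) + 1) + 1) (s, T')"
    by (rule ex_While_True[OF _ ex_Seq[OF 1 2] T'(1)]) (use assms Cons.prems in auto)
  then have "ex N ?w (s, T) (length (b # y) * (6 * length x + 11) + 1) (s, T')"
    by (rule ex_mono) simp
  then show ?case using T'(2,3) by (intro exI[of _ T']) (auto simp: add.assoc)
qed

text \<open>A nested loop needs two heads on the last argument: the outer one moves along the input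
  tape \<open>i\<close>, the inner one sweeps the copy \<open>c\<close>, which is also what
  \<open>M\<close> reads afterwards. Higher powers come from iterating the lemma.\<close>

lemma inPm_pad_square:
  assumes R: "inPm (Suc m) R" and m: "0 < m"
  shows "inPm m (\<lambda>xs. R (xs @ [replicate ((length (last xs))\<^sup>2) True]))"
proof -
  obtain M B where M: "wf_tm (Suc m) M" "mono B" "poly_bounded B"
     "\<And>xs. length xs = Suc m \<Longrightarrow> (\<exists>t\<le>B (tot xs). halts_within M xs t) \<and> tm_output M xs = Some (R xs)"
    using R unfolding inPm_def by auto
  define N where "N = m + Suc m + tm_nwork M"
  have nin: "tm_nin M = Suc m" and Q3: "3 \<le> tm_nstates M" using M(1) unfolding wf_tm_def by auto
  define ps where "ps = zip [0..<m] [m..<m + m]"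
  define i c d where "i = m - 1" and "c = m + (m - 1)" and "d = m + m"
  define p where "p = Seq (copies ps) (Seq (While (nonblank i) (Seq (fill c d) (move i 1))) (Seq (rewind d) (sim M m)))"
  have ps: "i < m \<and> j = m + i" if "(i, j) \<in> set ps" for i j
    using that unfolding ps_def by (auto simp: set_zip)
  have icd: "i < N" "c < N" "d < N" "c \<noteq> d" "i \<noteq> c" "i \<noteq> d" "m \<le> d"
    using m unfolding i_def c_def d_def N_def by auto
  have wf: "wfp m N (tm_nstates M) p"
    unfolding p_def fill_def using icd Q3
    by (auto intro!: wfp_copies wfp_sim[OF M(1)] simp: nin N_def dest!: ps)
  define B' where "B' n = (m * (8 * n + 16) + 1) + (n * (6 * n + 11) + 1) + (2 * (n * n) + 6) + (2 * B (n + n * n) + 3) + 3" for n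
  have "poly_bounded (\<lambda>n. B (n + n * n))"
    by (intro poly_bounded_compose[OF M(3)] poly_bounded_intros)
  then have Bp: "poly_bounded B'" unfolding B'_def by (intro poly_bounded_intros)
  show ?thesis
  proof (rule inPm_I[OF wf _ _ Bp])
    show "m \<le> N" "0 < tm_nstates M" using Q3 unfolding N_def by auto
    fix xs :: "bool list list" assume xs: "length xs = m"
    let ?T0 = "init_tapes m xs"
    define x where "x = last xs"
    have lx: "x = xs ! i" using xs m unfolding x_def i_def by (subst last_conv_nth) auto
    have lt: "length x \<le> tot xs" unfolding lx using length_le_tot xs m by (simp add: i_def)
    define y where "y = replicate (length x * length x) True"
    have src: "?T0 j = tp [] (map bsym (xs ! j))" if "j < m" for j
      using that by (simp add: init_tapes_def inp_sym_tp)
    have blank: "?T0 j = tp [] []" if "m \<le> j" for j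
      using that by (simp add: init_tapes_def blank_tp)
    have "\<exists>T'. ex N (copies ps) (0, ?T0) (length ps * (8 * tot xs + 16) + 1) (0, T')
      \<and> (\<forall>(i, j) \<in> set ps. T' j = ?T0 i) \<and> (\<forall>j. j \<notin> snd ` set ps \<longrightarrow> T' j = ?T0 j)"
    proof (rule ex_copies)
      fix i j assume ij: "(i, j) \<in> set ps"
      then show "i < N \<and> j < N \<and> (\<exists>x. length x \<le> tot xs \<and> ?T0 i = tp [] (map bsym x)) \<and> ?T0 j = tp [] []"
        using ps[OF ij] src[of i] blank[of j] length_le_tot[of i xs] xs unfolding N_def by auto
    next
      have "fst ` set ps \<subseteq> {..<m}" "snd ` set ps \<subseteq> {m..}" using ps by fastforce+
      then show "fst ` set ps \<inter> snd ` set ps = {}" by fastforce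
      show "distinct (map snd ps)" unfolding ps_def by auto
    qed
    then obtain T1 where T1: "ex N (copies ps) (0, ?T0) (length ps * (8 * tot xs + 16) + 1) (0, T1)"
      "\<And>i j. (i, j) \<in> set ps \<Longrightarrow> T1 j = ?T0 i" "\<And>j. j \<notin> snd ` set ps \<Longrightarrow> T1 j = ?T0 j" by auto
    have T1_cp: "T1 (m + j) = tp [] (map bsym (xs ! j))" if "j < m" for j
    proof -
      have "(j, m + j) \<in> set ps" using that unfolding ps_def by (auto simp: set_zip intro!: exI[of _ j])
      then show ?thesis using T1(2) src that by simp
    qed
    have T1_old: "T1 j = ?T0 j" if "j < m \<or> m + m \<le> j" for j
    proof -
      have "j \<notin> snd ` set ps" using ps that by fastforce
      then show ?thesis using T1(3) by simp
    qed
    have T1icd: "T1 i = tp [] (map bsym x)" "T1 c = tp [] (map bsym x)" "T1 d = tp (map bsym (replicate 0 True)) []"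
      using T1_old[of i] T1_cp[of "m - 1"] T1_old[of d] src[of i] blank[of d] lx m
      unfolding i_def c_def d_def by auto
    obtain T2 where T2: "ex N (While (nonblank i) (Seq (fill c d) (move i 1))) (0, T1) (length x * (6 * length x + 11) + 1) (0, T2)"
      "T2 d = tp (map bsym y) []" "\<And>j. j \<notin> {i, d} \<Longrightarrow> T2 j = T1 j"
      using ex_fill_square[OF icd(1-6) T1icd, of 0] unfolding y_def by auto
    have "rev y = y" unfolding y_def by simp
    then have rw: "ex N (rewind d) (0, T2) (2 * length y + 6) (0, T2(d := tp [] (map bsym y)))"
      using ex_rewind[OF icd(3), of T2 y "[]" 0] T2(2) by simp
    let ?xs = "xs @ [y]"
    obtain t where t: "t \<le> B (tot ?xs)" "halts_within M ?xs t" and o: "tm_output M ?xs = Some (R ?xs)"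
      using M(4)[of ?xs] xs by auto
    let ?T3 = "T2(d := tp [] (map bsym y))"
    have in3: "?T3 (m + j) = inp_sym (?xs ! j)" if "j < Suc m" for j
    proof (cases "j = m")
      case True
      then show ?thesis using xs by (simp add: d_def inp_sym_tp nth_append)
    next
      case False
      then have "m + j \<notin> {i, d}" "j < m" using that m unfolding i_def d_def by auto
      then show ?thesis using T2(3)[of "m + j"] T1_cp[of j] xs by (simp add: inp_sym_tp nth_append)
    qed
    have bl3: "?T3 (m + Suc m + j) = (\<lambda>_. Blank)" for j
    proof -
      have "m + Suc m + j \<notin> {i, d}" unfolding i_def d_def by auto
      then show ?thesis using T2(3)[of "m + Suc m + j"] T1_old[of "m + Suc m + j"] blank by (simp add: blank_tp)
    qed
    obtain T4 where T4: "ex N (sim M m) (0, ?T3) (2 * t + 3) (if R ?xs then 1 else 2, T4)"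
      using ex_sim[OF _ t(2), of m N ?T3 0] in3 bl3 o unfolding nin N_def by auto
    have "length x * length x \<le> tot xs * tot xs" by (intro mult_mono lt) auto
    then have "B (tot ?xs) \<le> B (tot xs + tot xs * tot xs)"
      by (intro monoD[OF M(2)]) (simp add: tot_snoc y_def)
    then have "t \<le> B (tot xs + tot xs * tot xs)" using t(1) by simp
    moreover have "length x * (6 * length x + 11) \<le> tot xs * (6 * tot xs + 11)"
      by (intro mult_mono) (use lt in auto)
    moreover have "length ps = m" unfolding ps_def by simp
    ultimately have "ex N p (0, ?T0) (B' (tot xs)) (if R ?xs then 1 else 2, T4)"
      unfolding p_def B'_def
      by (intro ex_mono[OF ex_Seq[OF T1(1) ex_Seq[OF T2(1) ex_Seq[OF rw T4]]]])
        (use \<open>length x * length x \<le> tot xs * tot xs\<close> in \<open>simp add: y_def\<close>)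
    moreover have "?xs = xs @ [replicate ((length (last xs))\<^sup>2) True]"
      unfolding y_def x_def power2_eq_square ..
    ultimately show "\<exists>T. ex N p (0, ?T0) (B' (tot xs))
        (if R (xs @ [replicate ((length (last xs))\<^sup>2) True]) then 1 else 2, T)" by auto
  qed
qed

section \<open>Bounded existential quantifiers under P = NP\<close>

text \<open>Each bit is preceded by a continuation flag, so the end of a string is recognised
  locally and codes can simply be concatenated.\<close>

fun enc1 :: "bool list \<Rightarrow> bool list" where
  "enc1 [] = [False]"
| "enc1 (b # x) = True # b # enc1 x"

definition enc :: "bool list list \<Rightarrow> bool list" where
  "enc xs = concat (map enc1 xs)"

fun dec1 :: "bool list \<Rightarrow> bool list \<times> bool list" where
  "dec1 (True # b # e) = (b # fst (dec1 e), snd (dec1 e))"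
| "dec1 [True] = ([], [])"
| "dec1 (False # e) = ([], False # e)"
| "dec1 [] = ([], [])"

text \<open>Decoding is total: a malformed code yields some tuple of the right length whose total
  length does not exceed that of the code. Languages of codes therefore contain no syntax test. The
  terminator that \<open>dec1\<close> leaves in place is dropped by \<open>tl\<close>.\<close>

fun dec :: "nat \<Rightarrow> bool list \<Rightarrow> bool list list" where
  "dec 0 e = []"
| "dec (Suc n) e = fst (dec1 e) # dec n (tl (snd (dec1 e)))"

lemma dec1_enc1: "dec1 (enc1 x @ z) = (x, False # z)"
  by (induction x) auto

lemma dec_enc: "dec (length xs) (enc xs) = xs"
  by (induction xs) (auto simp: enc_def dec1_enc1)

lemma length_dec [simp]: "length (dec n e) = n"
  by (induction n arbitrary: e) auto

lemma length_dec1: "length (fst (dec1 e)) + length (snd (dec1 e)) \<le> length e"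
  by (induction e rule: dec1.induct) auto

lemma tot_dec: "tot (dec n e) \<le> length e"
proof (induction n arbitrary: e)
  case (Suc n)
  have "tot (dec (Suc n) e) \<le> length (fst (dec1 e)) + length (tl (snd (dec1 e)))"
    using Suc.IH[of "tl (snd (dec1 e))"] by (simp add: tot_def)
  then show ?case using length_dec1[of e] by simp
qed (simp add: tot_def)

lemma length_enc1: "length (enc1 x) = 2 * length x + 1"
  by (induction x) auto

lemma length_enc: "length (enc xs) = 2 * tot xs + length xs"
  by (induction xs) (auto simp: enc_def tot_def length_enc1)

definition enc_loop :: "nat \<Rightarrow> nat \<Rightarrow> prog" where
  "enc_loop d i = While (nonblank i)
     (Seq (act d (\<lambda>s r. S1) 1) (Seq (act d (\<lambda>s r. r ! i) 1) (move i 1)))"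

fun encs :: "nat \<Rightarrow> nat list \<Rightarrow> prog" where
  "encs d [] = setst (\<lambda>s r. s)"
| "encs d (i # is) = Seq (enc_loop d i) (Seq (act d (\<lambda>s r. S0) 1) (encs d is))"

lemma wfp_encs [simp]: "d < N \<Longrightarrow> m \<le> d \<Longrightarrow> set I \<subseteq> {..<N} \<Longrightarrow> wfp m N Q (encs d I)"
  by (induction I) (auto simp: enc_loop_def)

text \<open>The loop writes flags and bits only, hence \<open>butlast\<close>; the terminator is
  appended by \<open>encs\<close>.\<close>

lemma ex_enc_loop:
  assumes "d < N" "i < N" "i \<noteq> d" "T i = tp L (map bsym x)" "T d = tp (map bsym K) []"
  shows "\<exists>T'. ex N (enc_loop d i) (s, T) (6 * length x + 1) (s, T')
    \<and> T' d = tp (map bsym (rev (butlast (enc1 x)) @ K)) [] \<and> (\<forall>j. j \<notin> {i, d} \<longrightarrow> T' j = T j)"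
  using assms(4,5)
proof (induction x arbitrary: T L K)
  case Nil
  have "ex N (enc_loop d i) (s, T) 1 (s, T)"
    unfolding enc_loop_def by (rule ex_While_False) (use Nil assms in auto)
  then show ?case using Nil by auto
next
  case (Cons b x)
  let ?T1 = "T(d := tp (map bsym (True # K)) [])"
  let ?T2 = "T(d := tp (map bsym (b # True # K)) [])"
  let ?T3 = "?T2(i := tp (bsym b # L) (map bsym x))"
  have 1: "ex N (act d (\<lambda>s r. S1) 1) (s, T) 1 (s, ?T1)"
    using ex_act[OF assms(1), of "\<lambda>s r. S1" 1 s T] Cons.prems by simp
  have 2: "ex N (act d (\<lambda>s r. r ! i) 1) (s, ?T1) 1 (s, ?T2)"
    using ex_act[OF assms(1), of "\<lambda>s r. r ! i" 1 s ?T1] Cons.prems assms(2,3) by simp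
  have 3: "ex N (move i 1) (s, ?T2) 1 (s, ?T3)"
    using ex_move[OF assms(2), of 1 s ?T2] Cons.prems assms(3) by simp
  obtain T' where T': "ex N (enc_loop d i) (s, ?T3) (6 * length x + 1) (s, T')"
    "T' d = tp (map bsym (rev (butlast (enc1 x)) @ b # True # K)) []" "\<And>j. j \<notin> {i, d} \<Longrightarrow> T' j = ?T3 j"
    using Cons.IH[of ?T3 "bsym b # L" "b # True # K"] assms(3) by auto
  have "ex N (enc_loop d i) (s, T) ((1 + (1 + 1 + 1) + 1) + (6 * length x + 1) + 1) (s, T')"
    unfolding enc_loop_def
    by (rule ex_While_True[OF _ ex_Seq[OF 1 ex_Seq[OF 2 3]] T'(1)[unfolded enc_loop_def]])
      (use assms Cons.prems in auto)
  then have "ex N (enc_loop d i) (s, T) (6 * length (b # x) + 1) (s, T')"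
    by (rule ex_mono) simp
  moreover have "butlast (enc1 (b # x)) = True # b # butlast (enc1 x)"
    by (cases x) auto
  ultimately show ?case using T'(2,3) by (intro exI[of _ T']) auto
qed

lemma ex_encs:
  assumes "d < N" "distinct I" "T d = tp (map bsym K) []"
    "\<And>i. i \<in> set I \<Longrightarrow> i < N \<and> i \<noteq> d \<and> length (f i) \<le> B \<and> T i = tp [] (map bsym (f i))"
  shows "\<exists>T'. ex N (encs d I) (s, T) (length I * (6 * B + 4) + 1) (s, T')
    \<and> T' d = tp (map bsym (rev (enc (map f I)) @ K)) [] \<and> (\<forall>j. j \<notin> insert d (set I) \<longrightarrow> T' j = T j)"
  using assms(2-4)
proof (induction I arbitrary: T K)
  case Nil
  have "ex N (encs d []) (s, T) 1 (s, T)" using ex_setst_eq[of "\<lambda>s r. s" s N T s] by simp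
  then show ?case using Nil by (auto simp: enc_def)
next
  case (Cons i I)
  have i: "i < N" "i \<noteq> d" "length (f i) \<le> B" "T i = tp [] (map bsym (f i))" using Cons.prems(3)[of i] by auto
  obtain T1 where T1: "ex N (enc_loop d i) (s, T) (6 * length (f i) + 1) (s, T1)"
    "T1 d = tp (map bsym (rev (butlast (enc1 (f i))) @ K)) []" "\<And>j. j \<notin> {i, d} \<Longrightarrow> T1 j = T j"
    using ex_enc_loop[OF assms(1) i(1,2,4) Cons.prems(2)] by blast
  have e: "enc1 x = butlast (enc1 x) @ [False]" for x
    by (induction x) auto
  let ?T2 = "T1(d := tp (map bsym (rev (enc1 (f i)) @ K)) [])"
  have 2: "ex N (act d (\<lambda>s r. S0) 1) (s, T1) 1 (s, ?T2)"
    using ex_act[OF assms(1), of "\<lambda>s r. S0" 1 s T1] T1(2) by (subst e) simp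
  obtain T' where T': "ex N (encs d I) (s, ?T2) (length I * (6 * B + 4) + 1) (s, T')"
    "T' d = tp (map bsym (rev (enc (map f I)) @ rev (enc1 (f i)) @ K)) []"
    "\<And>j. j \<notin> insert d (set I) \<Longrightarrow> T' j = ?T2 j"
  proof -
    have "\<exists>T'. ex N (encs d I) (s, ?T2) (length I * (6 * B + 4) + 1) (s, T')
      \<and> T' d = tp (map bsym (rev (enc (map f I)) @ rev (enc1 (f i)) @ K)) []
      \<and> (\<forall>j. j \<notin> insert d (set I) \<longrightarrow> T' j = ?T2 j)"
    proof (rule Cons.IH)
      fix j assume j: "j \<in> set I"
      then have "j \<noteq> d" "j \<noteq> i" using Cons.prems(1,3) by auto
      then show "j < N \<and> j \<noteq> d \<and> length (f j) \<le> B \<and> ?T2 j = tp [] (map bsym (f j))"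
        using Cons.prems(3)[of j] T1(3)[of j] j by simp
    qed (use Cons.prems in auto)
    then show ?thesis using that by blast
  qed
  have "ex N (encs d (i # I)) (s, T) ((6 * length (f i) + 1) + (1 + (length I * (6 * B + 4) + 1) + 1) + 1) (s, T')"
    unfolding encs.simps by (rule ex_Seq[OF T1(1) ex_Seq[OF 2 T'(1)]])
  then have "ex N (encs d (i # I)) (s, T) (length (i # I) * (6 * B + 4) + 1) (s, T')"
    by (rule ex_mono) (use i(3) in simp)
  moreover have "T' d = tp (map bsym (rev (enc (map f (i # I))) @ K)) []"
    using T'(2) by (simp add: enc_def)
  ultimately show ?case using T'(3) T1(3) by (intro exI[of _ T']) auto
qed

text \<open>Lets a decider for strings act on tuples: the tuple is encoded on a work tape, and the
  linear length of the code keeps the time polynomial.\<close>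

lemma inPm_enc:
  assumes "inP L"
  shows "inPm m (\<lambda>xs. enc xs \<in> L)"
proof -
  obtain M a k where M: "wf_tm 1 M" "\<And>x. \<exists>t\<le>a * length x ^ k + a. halts_within M [x] t"
      "\<And>x. tm_output M [x] = Some (x \<in> L)"
    using assms unfolding inP_def by auto
  define N where "N = m + 1 + tm_nwork M"
  have nin: "tm_nin M = 1" and Q3: "3 \<le> tm_nstates M" using M(1) unfolding wf_tm_def by auto
  define p where "p = Seq (encs m [0..<m]) (Seq (rewind m) (sim M m))"
  have wf: "wfp m N (tm_nstates M) p"
    unfolding p_def by (auto intro!: wfp_sim[OF M(1)] wfp_encs simp: nin N_def)
  define B where "B n = (m * (6 * n + 4) + 1) + (2 * (2 * n + m) + 6) + (2 * (a * (2 * n + m) ^ k + a) + 3) + 2" for n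
  have Bp: "poly_bounded B" unfolding B_def by (intro poly_bounded_intros)
  show ?thesis
  proof (rule inPm_I[OF wf _ _ Bp])
    show "m \<le> N" "0 < tm_nstates M" using Q3 unfolding N_def by auto
    fix xs :: "bool list list" assume xs: "length xs = m"
    let ?T0 = "init_tapes m xs"
    have "\<exists>T'. ex N (encs m [0..<m]) (0, ?T0) (length [0..<m] * (6 * tot xs + 4) + 1) (0, T')
      \<and> T' m = tp (map bsym (rev (enc (map (\<lambda>i. xs ! i) [0..<m])) @ [])) [] \<and> (\<forall>j. j \<notin> insert m (set [0..<m]) \<longrightarrow> T' j = ?T0 j)"
      by (rule ex_encs) (use xs length_le_tot in \<open>auto simp: N_def init_tapes_def inp_sym_tp blank_tp\<close>)
    then obtain T1 where T1: "ex N (encs m [0..<m]) (0, ?T0) (m * (6 * tot xs + 4) + 1) (0, T1)"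
      "T1 m = tp (map bsym (rev (enc xs))) []" "\<And>j. m < j \<Longrightarrow> T1 j = ?T0 j"
      using xs map_nth[of xs] by auto
    let ?T2 = "T1(m := tp [] (map bsym (enc xs)))"
    have 2: "ex N (rewind m) (0, T1) (2 * length (enc xs) + 6) (0, ?T2)"
      using ex_rewind[of m N T1 "rev (enc xs)" "[]" 0] T1(2) by (simp add: N_def)
    obtain t where t: "t \<le> a * length (enc xs) ^ k + a" "halts_within M [enc xs] t" using M(2) by blast
    obtain T3 where T3: "ex N (sim M m) (0, ?T2) (2 * t + 3) (if enc xs \<in> L then 1 else 2, T3)"
      using ex_sim[OF _ t(2), of m N ?T2 0] T1(3) M(3)[of "enc xs"]
      unfolding nin N_def by (auto simp: inp_sym_tp init_tapes_def)
    have "ex N p (0, ?T0) (B (tot xs)) (if enc xs \<in> L then 1 else 2, T3)"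
      unfolding p_def
      by (rule ex_mono[OF ex_Seq[OF T1(1) ex_Seq[OF 2 T3]]])
        (use t(1) in \<open>simp add: B_def length_enc xs\<close>)
    then show "\<exists>T. ex N p (0, ?T0) (B (tot xs)) (if enc xs \<in> L then 1 else 2, T)" by blast
  qed
qed

definition dec_loop :: "nat \<Rightarrow> prog" where
  "dec_loop d = While (\<lambda>s r. r ! 0 = S1)
     (Seq (move 0 1) (Cond (nonblank 0) (Seq (act d (\<lambda>s r. r ! 0) 1) (move 0 1)) (setst (\<lambda>s r. s))))"

fun decs :: "nat list \<Rightarrow> prog" where
  "decs [] = setst (\<lambda>s r. s)"
| "decs (d # ds) = Seq (dec_loop d)
     (Seq (Cond (nonblank 0) (move 0 1) (setst (\<lambda>s r. s))) (Seq (rewind d) (decs ds)))"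

lemma wfp_decs [simp]: "0 < N \<Longrightarrow> set ds \<subseteq> {m..<N} \<Longrightarrow> wfp m N Q (decs ds)"
  by (induction ds) (auto simp: dec_loop_def)

lemma ex_dec_loop:
  assumes "0 < d" "d < N" "T 0 = tp (map bsym L) (map bsym e)" "T d = tp (map bsym K) []"
  shows "\<exists>T' L'. ex N (dec_loop d) (s, T) (8 * length e + 1) (s, T')
    \<and> T' 0 = tp (map bsym L') (map bsym (snd (dec1 e)))
    \<and> T' d = tp (map bsym (rev (fst (dec1 e)) @ K)) [] \<and> (\<forall>j. j \<notin> {0, d} \<longrightarrow> T' j = T j)"
  using assms(3,4)
proof (induction e arbitrary: T L K rule: dec1.induct)
  case (1 b e)
  let ?T1 = "T(0 := tp (map bsym (True # L)) (map bsym (b # e)))"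
  let ?T2 = "?T1(d := tp (map bsym (b # K)) [])"
  let ?T3 = "?T2(0 := tp (map bsym (b # True # L)) (map bsym e))"
  have N: "0 < N" using assms by simp
  have s1: "ex N (move 0 1) (s, T) 1 (s, ?T1)"
    using ex_move[OF N, of 1 s T] "1.prems" by simp
  have s2: "ex N (act d (\<lambda>s r. r ! 0) 1) (s, ?T1) 1 (s, ?T2)"
    using ex_act[OF assms(2), of "\<lambda>s r. r ! 0" 1 s ?T1] "1.prems" N assms(1) by simp
  have s3: "ex N (move 0 1) (s, ?T2) 1 (s, ?T3)"
    using ex_move[OF N, of 1 s ?T2] assms(1) by simp
  have s4: "ex N (Cond (nonblank 0) (Seq (act d (\<lambda>s r. r ! 0) 1) (move 0 1)) (setst (\<lambda>s r. s)))
     (s, ?T1) (1 + 1 + 1 + 1) (s, ?T3)"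
    by (rule ex_Cond) (use ex_Seq[OF s2 s3] N in simp)
  obtain T' L' where T': "ex N (dec_loop d) (s, ?T3) (8 * length e + 1) (s, T')"
    "T' 0 = tp (map bsym L') (map bsym (snd (dec1 e)))"
    "T' d = tp (map bsym (rev (fst (dec1 e)) @ b # K)) []" "\<And>j. j \<notin> {0, d} \<Longrightarrow> T' j = ?T3 j"
    using "1.IH"[of ?T3 "b # True # L" "b # K"] assms(1) by auto
  have "ex N (dec_loop d) (s, T) ((1 + (1 + 1 + 1 + 1) + 1) + (8 * length e + 1) + 1) (s, T')"
    unfolding dec_loop_def
    by (rule ex_While_True[OF _ ex_Seq[OF s1 s4] T'(1)[unfolded dec_loop_def]])
      (use N "1.prems" in auto)
  then have "ex N (dec_loop d) (s, T) (8 * length (True # b # e) + 1) (s, T')"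
    by (rule ex_mono) simp
  then show ?case using T'(2-4) by (intro exI[of _ T'] exI[of _ L']) auto
next
  case 2
  let ?T1 = "T(0 := tp (map bsym (True # L)) [])"
  have N: "0 < N" using assms by simp
  have s1: "ex N (move 0 1) (s, T) 1 (s, ?T1)"
    using ex_move[OF N, of 1 s T] "2.prems" by simp
  have s2: "ex N (Cond (nonblank 0) (Seq (act d (\<lambda>s r. r ! 0) 1) (move 0 1)) (setst (\<lambda>s r. s)))
     (s, ?T1) (1 + 1) (s, ?T1)"
    by (rule ex_Cond) (use ex_setst_eq[of "\<lambda>s r. s" s N ?T1 s] N in simp)
  have s3: "ex N (dec_loop d) (s, ?T1) 1 (s, ?T1)"
    unfolding dec_loop_def by (rule ex_While_False) (use N in simp)
  have "ex N (dec_loop d) (s, T) ((1 + (1 + 1) + 1) + 1 + 1) (s, ?T1)"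
    unfolding dec_loop_def
    by (rule ex_While_True[OF _ ex_Seq[OF s1 s2] s3[unfolded dec_loop_def]])
      (use N "2.prems" in auto)
  then have "ex N (dec_loop d) (s, T) (8 * length [True] + 1) (s, ?T1)"
    by (rule ex_mono) simp
  then show ?case using assms(1) "2.prems" by (intro exI[of _ ?T1] exI[of _ "True # L"]) auto
next
  case (3 e)
  have "ex N (dec_loop d) (s, T) 1 (s, T)"
    unfolding dec_loop_def by (rule ex_While_False) (use assms "3.prems" in simp)
  then have "ex N (dec_loop d) (s, T) (8 * length (False # e) + 1) (s, T)"
    by (rule ex_mono) simp
  then show ?case using "3.prems" by (intro exI[of _ T] exI[of _ "L"]) auto
next
  case 4
  have "ex N (dec_loop d) (s, T) 1 (s, T)"
    unfolding dec_loop_def by (rule ex_While_False) (use assms "4.prems" in simp)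
  then show ?case using "4.prems" by (intro exI[of _ T] exI[of _ "L"]) auto
qed

lemma ex_decs:
  assumes "0 < N" "T 0 = tp (map bsym L) (map bsym e)" "distinct ds" "length e \<le> B"
    "\<And>d. d \<in> set ds \<Longrightarrow> 0 < d \<and> d < N \<and> T d = tp [] []"
  shows "\<exists>T'. ex N (decs ds) (s, T) (length ds * (10 * B + 20) + 1) (s, T')
    \<and> (\<forall>i<length ds. T' (ds ! i) = tp [] (map bsym (dec (length ds) e ! i)))
    \<and> (\<forall>j. j \<notin> insert 0 (set ds) \<longrightarrow> T' j = T j)"
  using assms(2-5)
proof (induction ds arbitrary: T L e)
  case Nil
  have "ex N (decs []) (s, T) 1 (s, T)" using ex_setst_eq[of "\<lambda>s r. s" s N T s] by simp
  then show ?case using Nil by auto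
next
  case (Cons d ds)
  have d: "0 < d" "d < N" "T d = tp (map bsym []) []" using Cons.prems(4)[of d] by auto
  obtain T1 L1 where T1: "ex N (dec_loop d) (s, T) (8 * length e + 1) (s, T1)"
    "T1 0 = tp (map bsym L1) (map bsym (snd (dec1 e)))"
    "T1 d = tp (map bsym (rev (fst (dec1 e)))) []" "\<And>j. j \<notin> {0, d} \<Longrightarrow> T1 j = T j"
    using ex_dec_loop[OF d(1,2) Cons.prems(1) d(3), of s] by auto
  have "\<exists>T2 L2. ex N (Cond (nonblank 0) (move 0 1) (setst (\<lambda>s r. s))) (s, T1) (1 + 1) (s, T2)
    \<and> T2 0 = tp (map bsym L2) (map bsym (tl (snd (dec1 e)))) \<and> (\<forall>j. j \<noteq> 0 \<longrightarrow> T2 j = T1 j)"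
  proof (cases "snd (dec1 e)")
    case Nil
    have "ex N (Cond (nonblank 0) (move 0 1) (setst (\<lambda>s r. s))) (s, T1) (1 + 1) (s, T1)"
      by (rule ex_Cond) (use ex_setst_eq[of "\<lambda>s r. s" s N T1 s] T1(2) assms(1) Nil in simp)
    then show ?thesis using T1(2) Nil by auto
  next
    case (Cons b e')
    have "ex N (Cond (nonblank 0) (move 0 1) (setst (\<lambda>s r. s))) (s, T1) (1 + 1)
        (s, T1(0 := tp (map bsym (b # L1)) (map bsym e')))"
      by (rule ex_Cond) (use ex_move[OF assms(1), of 1 s T1] T1(2) assms(1) Cons in simp)
    then show ?thesis using Cons
      by (intro exI[of _ "T1(0 := tp (map bsym (b # L1)) (map bsym e'))"] exI[of _ "b # L1"]) auto
  qed
  then obtain T2 L2 where T2: "ex N (Cond (nonblank 0) (move 0 1) (setst (\<lambda>s r. s))) (s, T1) (1 + 1) (s, T2)"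
    "T2 0 = tp (map bsym L2) (map bsym (tl (snd (dec1 e))))" "\<And>j. j \<noteq> 0 \<Longrightarrow> T2 j = T1 j" by blast
  let ?x = "fst (dec1 e)"
  let ?T3 = "T2(d := tp [] (map bsym ?x))"
  have 3: "ex N (rewind d) (s, T2) (2 * length ?x + 6) (s, ?T3)"
    using ex_rewind[OF d(2), of T2 "rev ?x" "[]" s] T2(3)[of d] T1(3) d(1) by simp
  let ?e = "tl (snd (dec1 e))"
  have le: "length ?x \<le> length e" "length ?e \<le> length e"
    using length_dec1[of e] by auto
  have "\<exists>T'. ex N (decs ds) (s, ?T3) (length ds * (10 * B + 20) + 1) (s, T')
    \<and> (\<forall>i<length ds. T' (ds ! i) = tp [] (map bsym (dec (length ds) ?e ! i)))
    \<and> (\<forall>j. j \<notin> insert 0 (set ds) \<longrightarrow> T' j = ?T3 j)"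
  proof (rule Cons.IH)
    show "?T3 0 = tp (map bsym L2) (map bsym ?e)" using T2(2) d(1) by simp
    show "length ?e \<le> B" using le Cons.prems(3) by simp
    fix d' assume d': "d' \<in> set ds"
    then have "d' \<noteq> d" "0 < d'" using Cons.prems(2) Cons.prems(4)[of d'] by auto
    then show "0 < d' \<and> d' < N \<and> ?T3 d' = tp [] []"
      using Cons.prems(4)[of d'] d' T2(3)[of d'] T1(4)[of d'] by simp
  qed (use Cons.prems in auto)
  then obtain T' where T': "ex N (decs ds) (s, ?T3) (length ds * (10 * B + 20) + 1) (s, T')"
    "\<And>i. i < length ds \<Longrightarrow> T' (ds ! i) = tp [] (map bsym (dec (length ds) ?e ! i))"
    "\<And>j. j \<notin> insert 0 (set ds) \<Longrightarrow> T' j = ?T3 j" by auto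
  have "ex N (decs (d # ds)) (s, T)
     ((8 * length e + 1) + ((1 + 1) + ((2 * length ?x + 6) + (length ds * (10 * B + 20) + 1) + 1) + 1) + 1) (s, T')"
    unfolding decs.simps by (rule ex_Seq[OF T1(1) ex_Seq[OF T2(1) ex_Seq[OF 3 T'(1)]]])
  then have "ex N (decs (d # ds)) (s, T) (length (d # ds) * (10 * B + 20) + 1) (s, T')"
    by (rule ex_mono) (use le Cons.prems(3) in simp)
  moreover have "T' ((d # ds) ! i) = tp [] (map bsym (dec (length (d # ds)) e ! i))"
    if "i < length (d # ds)" for i
    using that T'(2)[of "i - 1"] T'(3)[of d] Cons.prems(2) d(1) by (cases i) auto
  moreover have "T' j = T j" if "j \<notin> insert 0 (set (d # ds))" for j
    using that T'(3)[of j] T2(3)[of j] T1(4)[of j] by auto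
  ultimately show ?case by blast
qed

definition take_copy :: "nat \<Rightarrow> prog" where
  "take_copy d = While (\<lambda>s r. r ! 0 \<noteq> Blank \<and> r ! 1 \<noteq> Blank)
     (Seq (act d (\<lambda>s r. r ! 1) 1) (Seq (move 0 1) (move 1 1)))"

text \<open>If the witness is short, the head on tape 0 stops inside \<open>e\<close>; the equation
  \<open>rev L' @ e' = rev L @ e\<close> keeps all of \<open>e\<close> available to the rewind that
  follows. The time depends on \<open>e\<close> alone.\<close>

lemma ex_take_copy:
  assumes "1 < d" "d < N" "T 0 = tp (map bsym L) (map bsym e)" "T 1 = tp J (map bsym w)"
    "T d = tp (map bsym K) []"
  shows "\<exists>T' L' e'. ex N (take_copy d) (s, T) (6 * length e + 1) (s, T')
    \<and> T' 0 = tp (map bsym L') (map bsym e') \<and> rev L' @ e' = rev L @ e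
    \<and> T' d = tp (map bsym (rev (take (length e) w) @ K)) [] \<and> (\<forall>j. j \<notin> {0, 1, d} \<longrightarrow> T' j = T j)"
  using assms(3-5)
proof (induction e arbitrary: T L J w K)
  case Nil
  have "ex N (take_copy d) (s, T) 1 (s, T)"
    unfolding take_copy_def by (rule ex_While_False) (use assms Nil in simp)
  then show ?case using Nil by (intro exI[of _ T] exI[of _ L] exI[of _ "[]"]) auto
next
  case (Cons a e)
  show ?case
  proof (cases w)
    case Nil
    have "ex N (take_copy d) (s, T) 1 (s, T)"
      unfolding take_copy_def by (rule ex_While_False) (use assms Nil Cons.prems in simp)
    then have "ex N (take_copy d) (s, T) (6 * length (a # e) + 1) (s, T)"
      by (rule ex_mono) simp
    then show ?thesis using Nil Cons.prems by (intro exI[of _ T] exI[of _ L] exI[of _ "a # e"]) auto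
  next
    case w: (Cons b w')
    let ?T1 = "T(d := tp (map bsym (b # K)) [])"
    let ?T2 = "?T1(0 := tp (map bsym (a # L)) (map bsym e))"
    let ?T3 = "?T2(1 := tp (bsym b # J) (map bsym w'))"
    have N: "0 < N" "1 < N" using assms by auto
    have s1: "ex N (act d (\<lambda>s r. r ! 1) 1) (s, T) 1 (s, ?T1)"
      using ex_act[OF assms(2), of "\<lambda>s r. r ! 1" 1 s T] Cons.prems N w by simp
    have s2: "ex N (move 0 1) (s, ?T1) 1 (s, ?T2)"
      using ex_move[OF N(1), of 1 s ?T1] Cons.prems assms(1) by simp
    have s3: "ex N (move 1 1) (s, ?T2) 1 (s, ?T3)"
      using ex_move[OF N(2), of 1 s ?T2] Cons.prems assms(1) w by simp
    obtain T' L' e' where T': "ex N (take_copy d) (s, ?T3) (6 * length e + 1) (s, T')"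
      "T' 0 = tp (map bsym L') (map bsym e')" "rev L' @ e' = rev (a # L) @ e"
      "T' d = tp (map bsym (rev (take (length e) w') @ b # K)) []" "\<And>j. j \<notin> {0, 1, d} \<Longrightarrow> T' j = ?T3 j"
      using Cons.IH[of ?T3 "a # L" "bsym b # J" w' "b # K"] assms(1) by auto
    have "ex N (take_copy d) (s, T) ((1 + (1 + 1 + 1) + 1) + (6 * length e + 1) + 1) (s, T')"
      unfolding take_copy_def
      by (rule ex_While_True[OF _ ex_Seq[OF s1 ex_Seq[OF s2 s3]] T'(1)[unfolded take_copy_def]])
        (use N Cons.prems w in auto)
    then have "ex N (take_copy d) (s, T) (6 * length (a # e) + 1) (s, T')"
      by (rule ex_mono) simp
    then show ?thesis using T'(2-5) w by (intro exI[of _ T'] exI[of _ L'] exI[of _ e']) auto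
  qed
qed

text \<open>In \<open>inNP\<close> the same polynomial bounds the witness and the running time, so the verifier
  may only look at a prefix of the witness whose length does not depend on that polynomial.\<close>

lemma inNP_dec:
  assumes R: "inPm (Suc m) R"
  shows "inNP {e. \<exists>w. length w \<le> length e \<and> R (dec m e @ [w])}"
proof -
  obtain M B where M: "wf_tm (Suc m) M" "mono B" "poly_bounded B"
     "\<And>xs. length xs = Suc m \<Longrightarrow> (\<exists>t\<le>B (tot xs). halts_within M xs t) \<and> tm_output M xs = Some (R xs)"
    using R unfolding inPm_def by auto
  define N where "N = 2 + Suc m + tm_nwork M"
  have nin: "tm_nin M = Suc m" and Q3: "3 \<le> tm_nstates M" using M(1) unfolding wf_tm_def by auto
  define d where "d = 2 + m"
  have dN: "1 < d" "d < N" "2 \<le> d" unfolding d_def N_def by auto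
  define p where "p = Seq (take_copy d) (Seq (rewind 0) (Seq (rewind d) (Seq (decs [2..<d]) (sim M 2))))"
  have wf: "wfp 2 N (tm_nstates M) p"
    unfolding p_def take_copy_def using dN by (auto intro!: wfp_sim[OF M(1)] wfp_decs simp: nin N_def)
  define R' where "R' xs = R (dec m (xs ! 0) @ [take (length (xs ! 0)) (xs ! 1)])" for xs
  define B' where "B' n = (6 * n + 1) + ((2 * n + 6) + ((2 * n + 6) + ((m * (10 * n + 20) + 1) + (2 * B (2 * n) + 3) + 1) + 1) + 1) + 1" for n
  have "poly_bounded (\<lambda>n. B (2 * n))"
    by (intro poly_bounded_compose[OF M(3)] poly_bounded_intros)
  then have Bp: "poly_bounded B'" unfolding B'_def by (intro poly_bounded_intros)
  have "\<exists>V. wf_tm 2 V \<and> (\<forall>xs. length xs = 2 \<longrightarrow>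
    (\<exists>t\<le>B' (length (xs ! 0)). halts_within V xs t) \<and> tm_output V xs = Some (R' xs))"
  proof (rule tm_of_prog[OF wf])
    show "2 \<le> N" "0 < tm_nstates M" using Q3 unfolding N_def by auto
    fix xs :: "bool list list" assume xs: "length xs = 2"
    let ?T0 = "init_tapes 2 xs"
    define e w where "e = xs ! 0" and "w = xs ! 1"
    have T0: "?T0 0 = tp (map bsym []) (map bsym e)" "?T0 1 = tp [] (map bsym w)"
       "\<And>j. 2 \<le> j \<Longrightarrow> ?T0 j = tp [] []"
      unfolding e_def w_def by (auto simp: init_tapes_def inp_sym_tp blank_tp)
    define y where "y = take (length e) w"
    obtain T1 L' e' where T1: "ex N (take_copy d) (0, ?T0) (6 * length e + 1) (0, T1)"
      "T1 0 = tp (map bsym L') (map bsym e')" "rev L' @ e' = e"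
      "T1 d = tp (map bsym (rev y)) []" "\<And>j. j \<notin> {0, 1, d} \<Longrightarrow> T1 j = ?T0 j"
      using ex_take_copy[OF dN(1,2) T0(1,2), of "[]" 0] T0(3)[of d] dN(1) unfolding y_def by auto
    have le: "length L' \<le> length e" "length y \<le> length e"
      using arg_cong[OF T1(3), of length] unfolding y_def by auto
    let ?T2 = "T1(0 := tp [] (map bsym e))"
    have "map bsym (rev L') @ map bsym e' = map bsym e" using T1(3) by (metis map_append)
    then have 2: "ex N (rewind 0) (0, T1) (2 * length L' + 6) (0, ?T2)"
      using ex_rewind[of 0 N T1 L' "map bsym e'" 0] T1(2) dN by simp
    let ?T3 = "?T2(d := tp [] (map bsym y))"
    have 3: "ex N (rewind d) (0, ?T2) (2 * length y + 6) (0, ?T3)"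
      using ex_rewind[of d N ?T2 "rev y" "[]" 0] T1(4) dN by simp
    have "\<exists>T'. ex N (decs [2..<d]) (0, ?T3) (length [2..<d] * (10 * length e + 20) + 1) (0, T')
      \<and> (\<forall>i<length [2..<d]. T' ([2..<d] ! i) = tp [] (map bsym (dec (length [2..<d]) e ! i)))
      \<and> (\<forall>j. j \<notin> insert 0 (set [2..<d]) \<longrightarrow> T' j = ?T3 j)"
      by (rule ex_decs[where L = "[]"]) (use dN T0(3) T1(5) in auto)
    moreover have "length [2..<d] = m" unfolding d_def length_upt by simp
    ultimately obtain T4 where T4: "ex N (decs [2..<d]) (0, ?T3) (m * (10 * length e + 20) + 1) (0, T4)"
      "\<And>i. i < m \<Longrightarrow> T4 (2 + i) = tp [] (map bsym (dec m e ! i))"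
      "\<And>j. d \<le> j \<Longrightarrow> T4 j = ?T3 j" using dN by auto
    let ?xs = "dec m e @ [y]"
    obtain t where t: "t \<le> B (tot ?xs)" "halts_within M ?xs t" and o: "tm_output M ?xs = Some (R ?xs)"
      using M(4)[of ?xs] by auto
    have in4: "T4 (2 + i) = inp_sym (?xs ! i)" if "i < Suc m" for i
    proof (cases "i = m")
      case True
      then show ?thesis using T4(3)[of d] by (simp add: d_def nth_append inp_sym_tp)
    next
      case False
      then show ?thesis using T4(2)[of i] that by (simp add: nth_append inp_sym_tp)
    qed
    have bl4: "T4 (2 + Suc m + i) = (\<lambda>_. Blank)" for i
      using T4(3)[of "2 + Suc m + i"] T1(5)[of "2 + Suc m + i"] T0(3)[of "2 + Suc m + i"]
      by (simp add: d_def blank_tp)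
    obtain T5 where T5: "ex N (sim M 2) (0, T4) (2 * t + 3) (if R ?xs then 1 else 2, T5)"
      using ex_sim[OF _ t(2), of 2 N T4 0] in4 bl4 o unfolding nin N_def by auto
    have "B (tot ?xs) \<le> B (2 * length e)"
      by (intro monoD[OF M(2)]) (use tot_dec[of m e] le(2) in \<open>simp add: tot_snoc\<close>)
    then have "ex N p (0, ?T0) (B' (length e)) (if R ?xs then 1 else 2, T5)"
      unfolding p_def B'_def
      by (intro ex_mono[OF ex_Seq[OF T1(1) ex_Seq[OF 2 ex_Seq[OF 3 ex_Seq[OF T4(1) T5]]]]])
        (use le t(1) in simp)
    then show "\<exists>T. ex N p (0, ?T0) (B' (length (xs ! 0))) (if R' xs then 1 else 2, T)"
      unfolding R'_def e_def[symmetric] w_def[symmetric] y_def[symmetric] by blast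
  qed
  then obtain V where V0: "wf_tm 2 V" "\<And>xs. length xs = 2 \<Longrightarrow>
      (\<exists>t\<le>B' (length (xs ! 0)). halts_within V xs t) \<and> tm_output V xs = Some (R' xs)"
    by blast
  have V: "\<exists>t\<le>B' (length e). halts_within V [e, w] t"
    "tm_output V [e, w] = Some (R (dec m e @ [take (length e) w]))" for e w
    using V0(2)[of "[e, w]"] by (simp_all add: R'_def)
  obtain a k where a: "\<And>n. B' n \<le> a * n ^ k + a" using Bp unfolding poly_bounded_def by auto
  have a1: "B' n \<le> (2 * a + 1) * n ^ (k + 1) + (2 * a + 1)" "n \<le> (2 * a + 1) * n ^ (k + 1) + (2 * a + 1)" for n
  proof -
    have "a * n ^ k \<le> a * (n ^ (k + 1) + 1)" by (intro mult_left_mono power_le_Suc_power) auto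
    then show "B' n \<le> (2 * a + 1) * n ^ (k + 1) + (2 * a + 1)" using a[of n] by (simp add: algebra_simps)
    have "n \<le> n ^ (k + 1) + 1" using power_le_Suc_power[of 1 "k + 1" n] by simp
    then show "n \<le> (2 * a + 1) * n ^ (k + 1) + (2 * a + 1)" by (simp add: algebra_simps)
  qed
  show ?thesis
    unfolding inNP_def
  proof (rule exI[of _ V], rule exI[of _ "k + 1"], rule exI[of _ "2 * a + 1"], intro conjI)
    show "wf_tm 2 V" by (rule V0(1))
    have "\<exists>t\<le>(2 * a + 1) * length e ^ (k + 1) + (2 * a + 1). halts_within V [e, w] t" for e w
    proof -
      obtain t where "t \<le> B' (length e)" "halts_within V [e, w] t" using V(1)[of e w] by auto
      then show ?thesis using a1(1)[of "length e"] by (intro exI[of _ t]) simp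
    qed
    then show "\<forall>x w. length w \<le> (2 * a + 1) * length x ^ (k + 1) + (2 * a + 1) \<longrightarrow>
        (\<exists>t\<le>(2 * a + 1) * length x ^ (k + 1) + (2 * a + 1). halts_within V [x, w] t)" by blast
  next
    show "\<forall>e. (e \<in> {e. \<exists>w. length w \<le> length e \<and> R (dec m e @ [w])}) \<longleftrightarrow>
      (\<exists>w. length w \<le> (2 * a + 1) * length e ^ (k + 1) + (2 * a + 1) \<and> tm_output V [e, w] = Some True)"
    proof (intro allI iffI)
      fix e :: "bool list"
      assume "e \<in> {e. \<exists>w. length w \<le> length e \<and> R (dec m e @ [w])}"
      then obtain w where "length w \<le> length e" "R (dec m e @ [w])" by auto
      then show "\<exists>w. length w \<le> (2 * a + 1) * length e ^ (k + 1) + (2 * a + 1) \<and> tm_output V [e, w] = Some True"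
        using V(2)[of e w] a1(2)[of "length e"] by (intro exI[of _ w]) auto
    next
      fix e :: "bool list"
      assume "\<exists>w. length w \<le> (2 * a + 1) * length e ^ (k + 1) + (2 * a + 1) \<and> tm_output V [e, w] = Some True"
      \<comment> \<open>A longer witness is accepted only on account of its prefix of length
        \<open>length e\<close>, and that prefix is a witness of the permitted length.\<close>
      then obtain w where "R (dec m e @ [take (length e) w])" by (auto simp: V(2))
      then show "e \<in> {e. \<exists>w. length w \<le> length e \<and> R (dec m e @ [w])}"
        by (auto intro!: exI[of _ "take (length e) w"])
    qed
  qed
qed

text \<open>The collapse of NP to P enters here: the quantified relation is an NP language of
  encoded tuples, hence in P, and is pulled back along \<open>enc\<close>. The linear bound
  \<open>tot xs\<close> on the witness suffices because codes are at least that long.\<close>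

lemma inPm_Ex:
  assumes PNP: "P_class = NP_class" and R: "inPm (Suc m) R"
    and bd: "\<And>xs w. length xs = m \<Longrightarrow> R (xs @ [w]) \<Longrightarrow> length w \<le> tot xs"
    and R': "\<And>xs. length xs = m \<Longrightarrow> R' xs \<longleftrightarrow> (\<exists>w. R (xs @ [w]))"
  shows "inPm m R'"
proof -
  let ?L = "{e. \<exists>w. length w \<le> length e \<and> R (dec m e @ [w])}"
  have "inP ?L" using inNP_dec[OF R] PNP unfolding P_class_def NP_class_def by auto
  then have "inPm m (\<lambda>xs. enc xs \<in> ?L)" by (rule inPm_enc)
  moreover have "enc xs \<in> ?L \<longleftrightarrow> R' xs" if l: "length xs = m" for xs
  proof
    assume "enc xs \<in> ?L"
    then show "R' xs" using R'[OF l] dec_enc[of xs] l by auto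
  next
    assume "R' xs"
    then obtain w where w: "R (xs @ [w])" using R'[OF l] by auto
    then have "length w \<le> length (enc xs)" using bd[OF l w] length_enc[of xs] by simp
    then show "enc xs \<in> ?L" using w dec_enc[of xs] l by auto
  qed
  ultimately show ?thesis by (rule inPm_cong)
qed

section \<open>Circuits and NOR programs\<close>

definition nor :: "nat set \<Rightarrow> bool list \<Rightarrow> bool" where
  "nor S v \<longleftrightarrow> (\<forall>i<length v. i \<in> S \<longrightarrow> \<not> v ! i)"

fun vals :: "nat set list \<Rightarrow> bool list \<Rightarrow> bool list" where
  "vals [] v = v"
| "vals (S # Ss) v = vals Ss (v @ [nor S v])"

fun nor_code :: "nat \<Rightarrow> nat set list \<Rightarrow> bool list" where
  "nor_code l [] = []"
| "nor_code l (S # Ss) = map (\<lambda>i. i \<in> S) [0..<l] @ nor_code (Suc l) Ss"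

lemma nor_subset: "S \<subseteq> {..<length v} \<Longrightarrow> nor S v \<longleftrightarrow> (\<forall>i\<in>S. \<not> v ! i)"
  unfolding nor_def by auto

lemma nor_run_row:
  "length row = length r \<Longrightarrow>
   nor_run (row @ w) L r acc = nor_run w (rev r @ L) [] (acc \<or> (\<exists>i<length r. row ! i \<and> r ! i))"
proof (induction row r arbitrary: L acc rule: list_induct2)
  case Nil
  then show ?case by simp
next
  case (Cons b row c r)
  have "(\<exists>i<length (c # r). (b # row) ! i \<and> (c # r) ! i) \<longleftrightarrow> (b \<and> c) \<or> (\<exists>i<length r. row ! i \<and> r ! i)"
    by (auto simp: less_Suc_eq_0_disj)
  then show ?case using Cons.IH by (simp add: disj_assoc)
qed

text \<open>The last row is separated from the others because its NOR is the output: the code is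
  exhausted before that value would be appended.\<close>

lemma nor_eval_code: "nor_eval (nor_code (length v) (Ss @ [S])) v = nor S (vals Ss v)"
proof (induction Ss arbitrary: v)
  case Nil
  show ?case using nor_run_row[of "map (\<lambda>i. i \<in> S) [0..<length v]" v "[]" "[]" False]
    by (auto simp: nor_eval_def nor_def)
next
  case (Cons S' Ss)
  let ?rest = "nor_code (Suc (length v)) (Ss @ [S])"
  let ?acc = "\<exists>i<length v. i \<in> S' \<and> v ! i"
  \<comment> \<open>A row is closed only when another bit follows. All rows after the first have
    positive length, so such a bit exists.\<close>
  have "?rest \<noteq> []" by (cases Ss) auto
  then obtain b w where rest: "?rest = b # w" by (cases ?rest) auto
  have "nor_eval (nor_code (length v) ((S' # Ss) @ [S])) v = nor_run ?rest (rev v) [] ?acc"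
    using nor_run_row[of "map (\<lambda>i. i \<in> S') [0..<length v]" v ?rest "[]" False]
    by (simp add: nor_eval_def cong: conj_cong)
  also have "\<dots> = nor_run ?rest [] (v @ [\<not> ?acc]) False" unfolding rest by simp
  also have "(\<not> ?acc) = nor S' v" unfolding nor_def by auto
  finally show ?case using Cons.IH[of "v @ [nor S' v]"] by (simp add: nor_eval_def)
qed

lemma length_nor_code: "length (nor_code l Ss) \<le> length Ss * (l + length Ss)"
proof (induction Ss arbitrary: l)
  case (Cons S Ss)
  show ?case using Cons.IH[of "Suc l"] by simp
qed simp

lemma length_vals [simp]: "length (vals Ss v) = length v + length Ss"
  by (induction Ss arbitrary: v) auto

lemma vals_append: "vals (A @ B) v = vals B (vals A v)"
  by (induction A arbitrary: v) auto

text \<open>No row of the block selects a value produced by the block, so its rows act as one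
  parallel layer on \<open>v\<close>.\<close>

lemma vals_independent:
  assumes "\<And>S. S \<in> set As \<Longrightarrow> S \<subseteq> {..<length v}"
  shows "vals As v = v @ map (\<lambda>S. nor S v) As"
  using assms
proof (induction As rule: rev_induct)
  case (snoc S As)
  have "S \<subseteq> {..<length v}" using snoc.prems by simp
  then have "nor S (v @ map (\<lambda>S. nor S v) As) = nor S v"
    unfolding nor_def by (auto simp: nth_append)
  then show ?case using snoc by (simp add: vals_append)
qed simp

lemma circ_vals_snoc: "circ_vals (C @ [g]) x = circ_vals C x @ [gval x (circ_vals C x) g]"
  by (simp add: circ_vals_def)

lemma length_circ_vals [simp]: "length (circ_vals C x) = length C"
  by (induction C rule: rev_induct) (auto simp: circ_vals_snoc, simp add: circ_vals_def)

lemma circ_eval_last: "C \<noteq> [] \<Longrightarrow> circ_vals C x ! (length C - 1) = circ_eval C x"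
  unfolding circ_eval_def using length_circ_vals[of C x]
  by (metis last_conv_nth length_0_conv)

text \<open>The part of well-formedness inherited by prefixes of a circuit. Having a unique sink is
  not inherited, so inductions over circuits run on this predicate.\<close>

definition gates_ok :: "nat \<Rightarrow> gate list \<Rightarrow> bool" where
  "gates_ok n C \<longleftrightarrow> (\<forall>i < length C. (\<forall>j. C ! i = Inp j \<longrightarrow> 1 \<le> j \<and> j \<le> n) \<and> (\<forall>p \<in> parents (C ! i). p < i))"

lemma gates_ok_snoc:
  "gates_ok n (C @ [g]) \<longleftrightarrow> gates_ok n C \<and> (\<forall>j. g = Inp j \<longrightarrow> 1 \<le> j \<and> j \<le> n) \<and> (\<forall>p \<in> parents g. p < length C)"
  unfolding gates_ok_def by (auto simp: less_Suc_eq nth_append)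

text \<open>Each vertex becomes two rows, computing its value and the negation of it:
  \<open>P i b\<close> is the position of the value of ``vertex \<open>i\<close> evaluates to \<open>b\<close>''.\<close>

lemma circuit_to_nor:
  assumes "gates_ok n C"
  shows "\<exists>Ss P. length Ss = 2 * length C \<and> (\<forall>i<length C. \<forall>b. P i b < n + 2 * length C \<and>
     (\<forall>x. length x = n \<longrightarrow> vals Ss x ! P i b = (circ_vals C x ! i = b)))"
  using assms
proof (induction C rule: rev_induct)
  case Nil
  then show ?case by simp
next
  case (snoc g C)
  define l where "l = n + 2 * length C"
  obtain Ss P where Ss: "length Ss = 2 * length C"
    and P: "\<And>i b. i < length C \<Longrightarrow> P i b < l"
      "\<And>i b x. i < length C \<Longrightarrow> length x = n \<Longrightarrow> vals Ss x ! P i b = (circ_vals C x ! i = b)"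
    using snoc unfolding gates_ok_snoc l_def by blast
  have g: "\<And>j. g = Inp j \<Longrightarrow> 1 \<le> j \<and> j \<le> n" "\<And>p. p \<in> parents g \<Longrightarrow> p < length C"
    using snoc.prems unfolding gates_ok_snoc by auto
  have vl: "length (vals Ss x) = l" if "length x = n" for x
    using that Ss by (simp add: l_def)
  have pre: "vals Ss x ! i = x ! i" if "i < length x" for i x
  proof -
    have "\<exists>z. vals A x = x @ z" for A
      by (induction A arbitrary: x) (auto, metis append_assoc)
    then obtain z where "vals Ss x = x @ z" by blast
    then show ?thesis using that by (simp add: nth_append)
  qed
  \<comment> \<open>One NOR row yields the gate or its negation: AND is the NOR of the negated
    operands, OR comes out negated. \<open>pol\<close> records the polarity, and the extra row
    \<open>{l}\<close> supplies the opposite one.\<close>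
  have "\<exists>S pol. \<forall>x. length x = n \<longrightarrow> nor S (vals Ss x) = (gval x (circ_vals C x) g = pol)"
  proof (cases g)
    case (Inp j)
    have j: "j - 1 < n" "1 \<le> j" using g(1)[OF Inp] by auto
    have "nor {j - 1} (vals Ss x) = (gval x (circ_vals C x) g = False)" if "length x = n" for x
      using j that pre[of "j - 1" x] vl[OF that] unfolding nor_def Inp l_def by simp
    then show ?thesis by blast
  next
    case (AndG a b)
    have "nor {P a False, P b False} (vals Ss x) = (gval x (circ_vals C x) g = True)" if "length x = n" for x
      using g(2) that P vl[OF that] by (subst nor_subset) (auto simp: AndG)
    then show ?thesis by blast
  next
    case (OrG a b)
    have "nor {P a True, P b True} (vals Ss x) = (gval x (circ_vals C x) g = False)" if "length x = n" for x
      using g(2) that P vl[OF that] by (subst nor_subset) (auto simp: OrG)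
    then show ?thesis by blast
  next
    case (NotG a)
    have "nor {P a False} (vals Ss x) = (gval x (circ_vals C x) g = False)" if "length x = n" for x
      using g(2) that P vl[OF that] by (subst nor_subset) (auto simp: NotG)
    then show ?thesis by blast
  qed
  then obtain S pol where S: "\<And>x. length x = n \<Longrightarrow> nor S (vals Ss x) = (gval x (circ_vals C x) g = pol)"
    by blast
  define Ss' where "Ss' = Ss @ [S, {l}]"
  define P' where "P' i b = (if i < length C then P i b else if b = pol then l else l + 1)" for i b
  have vals': "vals Ss' x = vals Ss x @ [gval x (circ_vals C x) g = pol, gval x (circ_vals C x) g \<noteq> pol]"
    if "length x = n" for x
  proof -
    have "nor {l} (vals Ss x @ [c]) = (\<not> c)" for c
      unfolding nor_def using vl[OF that] by (auto simp: nth_append)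
    then show ?thesis unfolding Ss'_def vals_append using S[OF that] by simp
  qed
  have "P' i b < n + 2 * length (C @ [g]) \<and> (\<forall>x. length x = n \<longrightarrow>
      vals Ss' x ! P' i b = (circ_vals (C @ [g]) x ! i = b))" if "i < length (C @ [g])" for i b
  proof (cases "i < length C")
    case True
    then show ?thesis using P(1)[of i b] P(2)[of i _ b] vl vals' unfolding P'_def circ_vals_snoc
      by (auto simp: nth_append l_def)
  next
    case False
    then have "i = length C" using that by simp
    then show ?thesis using vl vals' unfolding P'_def circ_vals_snoc
      by (auto simp: nth_append l_def)
  qed
  moreover have "length Ss' = 2 * length (C @ [g])" using Ss by (simp add: Ss'_def)
  ultimately show ?case by blast
qed

text \<open>Both polarities of every vertex are available, so the last row can output agreement with
  either \<open>b\<close> at the same cost. There are 2 s + 1 rows for a circuit of size s, each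
  with at most n + 2 s + 1 bits.\<close>

lemma nor_of_circuit:
  assumes "wf_circuit n C"
  shows "\<exists>w. length w \<le> (2 * length C + 1) * (n + 2 * length C + 1) \<and>
    (\<forall>x. length x = n \<longrightarrow> nor_eval w x = (circ_eval C x = b))"
proof -
  have C: "gates_ok n C" "C \<noteq> []" using assms unfolding wf_circuit_def gates_ok_def by auto
  obtain Ss P where Ss: "length Ss = 2 * length C"
    and P: "\<And>i b. i < length C \<Longrightarrow> P i b < n + 2 * length C"
      "\<And>i b x. i < length C \<Longrightarrow> length x = n \<Longrightarrow> vals Ss x ! P i b = (circ_vals C x ! i = b)"
    using circuit_to_nor[OF C(1)] by blast
  let ?o = "length C - 1"
  let ?S = "{P ?o (\<not> b)}"
  have "nor_eval (nor_code n (Ss @ [?S])) x = (circ_eval C x = b)" if "length x = n" for x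
  proof -
    have "nor ?S (vals Ss x) = (circ_vals C x ! ?o = b)"
      unfolding nor_def using P(1)[of ?o "\<not> b"] P(2)[of ?o x "\<not> b"] C(2) Ss that by auto
    moreover have "circ_eval C x = circ_vals C x ! ?o" using circ_eval_last[OF C(2)] by simp
    ultimately show ?thesis using nor_eval_code[of x Ss ?S] that by simp
  qed
  then show ?thesis using length_nor_code[of n "Ss @ [?S]"] Ss
    by (intro exI[of _ "nor_code n (Ss @ [?S])"]) simp
qed

text \<open>A table lookup: \<open>As\<close> negates the inputs, \<open>S y\<close> selects the
  literals that are all false exactly when the input is \<open>y\<close>, and the final row
  \<open>F\<close> takes the NOR of these equality tests. This is why the complement of the set is
  what gets computed.\<close>

lemma nor_of_set:
  assumes "\<And>y. y \<in> set ys \<Longrightarrow> length y = n"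
  shows "\<exists>w. length w \<le> (n + length ys + 1) * (2 * n + length ys + 1) \<and>
    (\<forall>x. length x = n \<longrightarrow> nor_eval w x = (x \<notin> set ys))"
proof -
  define As where "As = map (\<lambda>i. {i}) [0..<n]"
  define S where "S y = (\<lambda>i. if y ! i then n + i else i) ` {..<n}" for y :: "bool list"
  define F where "F = {2 * n..<2 * n + length ys}"
  let ?w = "nor_code n ((As @ map S ys) @ [F])"
  have "nor_eval ?w x = (x \<notin> set ys)" if x: "length x = n" for x
  proof -
    have v1: "vals As x = x @ map Not x"
    proof -
      have "map (\<lambda>S. nor S x) As = map (\<lambda>i. \<not> x ! i) [0..<n]"
        unfolding As_def using x by (auto simp: nor_def)
      also have "\<dots> = map Not x" by (rule nth_equalityI) (use x in auto)
      finally have e: "map (\<lambda>S. nor S x) As = map Not x" .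
      show ?thesis
        by (subst vals_independent) (use x e in \<open>auto simp: As_def\<close>)
    qed
    have sel: "nor (S y) (x @ map Not x) = (x = y)" if "y \<in> set ys" for y
    proof -
      have "nor (S y) (x @ map Not x) \<longleftrightarrow> (\<forall>i<n. \<not> (x @ map Not x) ! (if y ! i then n + i else i))"
        by (subst nor_subset) (use x in \<open>auto simp: S_def split: if_splits\<close>)
      also have "\<dots> \<longleftrightarrow> (\<forall>i<n. x ! i = y ! i)" using x by (auto simp: nth_append)
      also have "\<dots> \<longleftrightarrow> x = y" using x assms[OF that] by (auto simp: list_eq_iff_nth_eq)
      finally show ?thesis .
    qed
    have "vals (map S ys) (x @ map Not x) = (x @ map Not x) @ map (\<lambda>S. nor S (x @ map Not x)) (map S ys)"
      by (rule vals_independent) (use x in \<open>auto simp: S_def split: if_splits\<close>)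
    also have "map (\<lambda>S. nor S (x @ map Not x)) (map S ys) = map (\<lambda>y. x = y) ys"
      using sel by simp
    finally have v2: "vals (As @ map S ys) x = (x @ map Not x) @ map (\<lambda>y. x = y) ys"
      by (simp add: vals_append v1)
    have "nor F ((x @ map Not x) @ map (\<lambda>y. x = y) ys) \<longleftrightarrow> (\<forall>i<length ys. x \<noteq> ys ! i)"
    proof
      assume L: "nor F ((x @ map Not x) @ map (\<lambda>y. x = y) ys)"
      show "\<forall>i<length ys. x \<noteq> ys ! i"
      proof (intro allI impI)
        fix i assume "i < length ys"
        then show "x \<noteq> ys ! i" using L[unfolded nor_def, rule_format, of "2 * n + i"] x
          by (simp add: F_def nth_append)
      qed
    next
      assume "\<forall>i<length ys. x \<noteq> ys ! i"
      then show "nor F ((x @ map Not x) @ map (\<lambda>y. x = y) ys)"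
        unfolding nor_def F_def using x by (auto simp: nth_append)
    qed
    then show ?thesis using nor_eval_code[of x "As @ map S ys" F] x v2 by (auto simp: in_set_conv_nth)
  qed
  moreover have "length ?w \<le> (n + length ys + 1) * (2 * n + length ys + 1)"
    using length_nor_code[of n "(As @ map S ys) @ [F]"] by (simp add: As_def algebra_simps)
  ultimately show ?thesis by blast
qed

section \<open>Counting short programs\<close>

lemma card_lists_bounded: "finite {w :: bool list. length w \<le> l}" "card {w :: bool list. length w \<le> l} < 2 ^ Suc l"
proof -
  have "rank w \<in> {0<..<2 ^ Suc l}" if "length w \<le> l" for w
  proof -
    have "(2::nat) ^ Suc (length w) \<le> 2 ^ Suc l" by (rule power_increasing) (use that in auto)
    then have "rank w < 2 ^ Suc l" using rank_bounds(2)[of w] by (rule less_le_trans[rotated])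
    then show ?thesis using rank_pos[of w] by simp
  qed
  then have sub: "rank ` {w. length w \<le> l} \<subseteq> {0<..<2 ^ Suc l}" by auto
  have inj: "inj_on rank {w. length w \<le> l}" by (auto intro: inj_onI rank_inject)
  show "finite {w :: bool list. length w \<le> l}"
    by (rule inj_on_finite[OF inj sub]) simp
  have "card {w :: bool list. length w \<le> l} \<le> card {0<..<(2::nat) ^ Suc l}"
    by (rule card_inj_on_le[OF inj sub]) simp
  also have "\<dots> < 2 ^ Suc l" by simp
  finally show "card {w :: bool list. length w \<le> l} < 2 ^ Suc l" .
qed

text \<open>On \<open>l + 1\<close> points there are more Boolean functions than programs of length at most \<open>l\<close>.\<close>

lemma hard_program_exists:
  assumes "l + 1 \<le> 2 ^ n"
  shows "\<exists>h. length h \<le> (n + l + 2) * (2 * n + l + 2) \<and>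
    (\<forall>w. length w \<le> l \<longrightarrow> (\<exists>z. length z = n \<and> nor_eval w z \<noteq> nor_eval h z))"
proof -
  have "card {x :: bool list. length x = n} = 2 ^ n"
    using card_lists_length_eq[of "UNIV :: bool set" n] by simp
  \<comment> \<open>Varying the function only on \<open>l + 1\<close> points, not on all strings of
    length \<open>n\<close>, keeps the table and thus the hard program polynomially long in
    \<open>n\<close> and \<open>l\<close>.\<close>
  then obtain X :: "bool list set" where X: "X \<subseteq> {x. length x = n}" "card X = l + 1"
    using obtain_subset_with_card_n[of "l + 1" "{x :: bool list. length x = n}"] assms by auto
  then have finX: "finite X" using card.infinite[of X] by fastforce
  have "\<exists>Y\<subseteq>X. \<forall>w. length w \<le> l \<longrightarrow> (\<exists>z. length z = n \<and> nor_eval w z \<noteq> (z \<notin> Y))"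
  proof (rule ccontr)
    assume "\<not> ?thesis"
    then have "\<forall>Y\<in>Pow X. \<exists>w. length w \<le> l \<and> (\<forall>z. length z = n \<longrightarrow> nor_eval w z = (z \<notin> Y))" by auto
    from bchoice[OF this] obtain f where f: "\<And>Y. Y \<subseteq> X \<Longrightarrow> length (f Y) \<le> l"
       "\<And>Y z. Y \<subseteq> X \<Longrightarrow> length z = n \<Longrightarrow> nor_eval (f Y) z = (z \<notin> Y)"
      by auto
    \<comment> \<open>\<open>Y\<close> can be recovered from its program, so distinct subsets would
      need distinct short programs.\<close>
    have Y: "Y = X - {z. nor_eval (f Y) z}" if "Y \<subseteq> X" for Y
    proof -
      have "nor_eval (f Y) z = (z \<notin> Y)" if "z \<in> X" for z
        using f(2)[OF \<open>Y \<subseteq> X\<close>, of z] that X(1) by auto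
      then show ?thesis using that by auto
    qed
    have "inj_on f (Pow X)"
    proof (rule inj_onI)
      fix Y Z assume "Y \<in> Pow X" "Z \<in> Pow X" "f Y = f Z"
      then show "Y = Z" using Y[of Y] Y[of Z] by simp
    qed
    moreover have "f ` Pow X \<subseteq> {w. length w \<le> l}" using f(1) by auto
    ultimately have "card (Pow X) \<le> card {w :: bool list. length w \<le> l}"
      using card_lists_bounded(1) by (rule card_inj_on_le)
    then show False using card_lists_bounded(2)[of l] X finX by (simp add: card_Pow)
  qed
  then obtain Y where Y: "Y \<subseteq> X" "\<And>w. length w \<le> l \<Longrightarrow> \<exists>z. length z = n \<and> nor_eval w z \<noteq> (z \<notin> Y)" by blast
  obtain ys where ys: "set ys = Y" "distinct ys"
    using finite_distinct_list[of Y] finite_subset[OF Y(1) finX] by blast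
  have "length ys \<le> l + 1"
    using distinct_card[OF ys(2)] card_mono[OF finX Y(1)] X(2) ys(1) by simp
  then have "(n + length ys + 1) * (2 * n + length ys + 1) \<le> (n + l + 2) * (2 * n + l + 2)"
    by (intro mult_mono) auto
  moreover obtain h where h: "length h \<le> (n + length ys + 1) * (2 * n + length ys + 1)"
    "\<And>x. length x = n \<Longrightarrow> nor_eval h x = (x \<notin> Y)"
    using nor_of_set[of ys n] ys(1) Y(1) X(1) by blast
  moreover have "\<exists>z. length z = n \<and> nor_eval w z \<noteq> nor_eval h z" if "length w \<le> l" for w
    using Y(2)[OF that] h(2) by auto
  ultimately show ?thesis by (meson le_trans)
qed

section \<open>Every Boolean function has a circuit\<close>

definition computable :: "nat \<Rightarrow> (bool list \<Rightarrow> bool) \<Rightarrow> bool" where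
  "computable n f \<longleftrightarrow> (\<exists>C. wf_circuit n C \<and> (\<forall>x. length x = n \<longrightarrow> circ_eval C x = f x))"

lemma wf_circuit_snoc:
  "wf_circuit n (C @ [g]) \<longleftrightarrow> gates_ok n (C @ [g]) \<and> (\<forall>i<length C. \<exists>k\<le>length C. i \<in> parents ((C @ [g]) ! k))"
  unfolding wf_circuit_def gates_ok_def by (auto simp: less_Suc_eq_le)

lemma wf_circuit_alt: "wf_circuit n C \<longleftrightarrow> C \<noteq> [] \<and> gates_ok n C \<and>
     (\<forall>i < length C - 1. \<exists>k < length C. i \<in> parents (C ! k))"
  unfolding wf_circuit_def gates_ok_def by auto

lemma circ_eval_snoc: "circ_eval (C @ [g]) x = gval x (circ_vals C x) g"
  unfolding circ_eval_def circ_vals_snoc by simp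

lemma computable_Inp:
  assumes "1 \<le> j" "j \<le> n"
  shows "computable n (\<lambda>x. x ! (j - 1))"
  unfolding computable_def
  by (rule exI[of _ "[Inp j]"]) (use assms in \<open>auto simp: wf_circuit_def circ_eval_def circ_vals_def\<close>)

lemma computable_Not:
  assumes "computable n f"
  shows "computable n (\<lambda>x. \<not> f x)"
proof -
  obtain C where C: "wf_circuit n C" "\<And>x. length x = n \<Longrightarrow> circ_eval C x = f x"
    using assms unfolding computable_def by auto
  let ?g = "NotG (length C - 1)"
  have C': "C \<noteq> []" "gates_ok n C" "\<And>i. i < length C - 1 \<Longrightarrow> \<exists>k < length C. i \<in> parents (C ! k)"
    using C(1) unfolding wf_circuit_alt by auto
  have "\<exists>k\<le>length C. i \<in> parents ((C @ [?g]) ! k)" if "i < length C" for i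
  proof (cases "i < length C - 1")
    case True
    then obtain k where "k < length C" "i \<in> parents (C ! k)" using C'(3) by blast
    then show ?thesis by (intro exI[of _ k]) (auto simp: nth_append)
  next
    case False
    then show ?thesis using that by (intro exI[of _ "length C"]) auto
  qed
  then have "wf_circuit n (C @ [?g])"
    unfolding wf_circuit_snoc using C' by (auto simp: gates_ok_snoc)
  moreover have "circ_eval (C @ [?g]) x = (\<not> f x)" if "length x = n" for x
    using C(2)[OF that] circ_eval_last[OF C'(1), of x] by (simp add: circ_eval_snoc)
  ultimately show ?thesis unfolding computable_def by blast
qed

fun shift_gate :: "nat \<Rightarrow> gate \<Rightarrow> gate" where
  "shift_gate k (Inp j) = Inp j"
| "shift_gate k (AndG a b) = AndG (k + a) (k + b)"
| "shift_gate k (OrG a b) = OrG (k + a) (k + b)"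
| "shift_gate k (NotG a) = NotG (k + a)"

lemma parents_shift_gate: "parents (shift_gate k g) = (+) k ` parents g"
  by (cases g) auto

lemma shift_gate_Inp: "shift_gate k g = Inp j \<longleftrightarrow> g = Inp j"
  by (cases g) auto

lemma circ_vals_shift:
  assumes "gates_ok n D"
  shows "circ_vals (C @ map (shift_gate (length C)) D) x = circ_vals C x @ circ_vals D x"
  using assms
proof (induction D rule: rev_induct)
  case Nil
  then show ?case by (simp add: circ_vals_def)
next
  case (snoc g D)
  have "gval x (circ_vals C x @ circ_vals D x) (shift_gate (length C) g) = gval x (circ_vals D x) g"
    using snoc.prems by (cases g) (auto simp: gates_ok_snoc nth_append)
  then show ?case using snoc circ_vals_snoc[of "C @ map (shift_gate (length C)) D"]
    by (simp add: gates_ok_snoc circ_vals_snoc)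
qed

lemma gates_ok_shift:
  assumes "gates_ok n C" "gates_ok n D"
  shows "gates_ok n (C @ map (shift_gate (length C)) D)"
  using assms(2)
proof (induction D rule: rev_induct)
  case Nil
  then show ?case using assms(1) by simp
next
  case (snoc g D)
  then have "gates_ok n ((C @ map (shift_gate (length C)) D) @ [shift_gate (length C) g])"
    unfolding gates_ok_snoc by (auto simp: parents_shift_gate shift_gate_Inp)
  then show ?case by simp
qed

text \<open>The second circuit is placed after the first with its pointers shifted. Both former
  sinks become parents of the new gate and every other vertex keeps a child, so the new gate is the
  only sink.\<close>

lemma computable_And:
  assumes "computable n f" "computable n g"
  shows "computable n (\<lambda>x. f x \<and> g x)"
proof -
  obtain C where C: "wf_circuit n C" "\<And>x. length x = n \<Longrightarrow> circ_eval C x = f x"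
    using assms unfolding computable_def by auto
  obtain D where D: "wf_circuit n D" "\<And>x. length x = n \<Longrightarrow> circ_eval D x = g x"
    using assms unfolding computable_def by auto
  have C': "C \<noteq> []" "gates_ok n C" "\<And>i. i < length C - 1 \<Longrightarrow> \<exists>k < length C. i \<in> parents (C ! k)"
    using C(1) unfolding wf_circuit_alt by auto
  have D': "D \<noteq> []" "gates_ok n D" "\<And>i. i < length D - 1 \<Longrightarrow> \<exists>k < length D. i \<in> parents (D ! k)"
    using D(1) unfolding wf_circuit_alt by auto
  let ?E = "C @ map (shift_gate (length C)) D"
  let ?g = "AndG (length C - 1) (length C + (length D - 1))"
  have "\<exists>k\<le>length ?E. i \<in> parents ((?E @ [?g]) ! k)" if "i < length ?E" for i
  proof -
    consider "i < length C - 1" | "i = length C - 1" | "length C \<le> i" "i - length C < length D - 1"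
      | "i = length C + (length D - 1)"
      using \<open>i < length ?E\<close> by fastforce
    then show ?thesis
    proof cases
      case 1
      then obtain k where "k < length C" "i \<in> parents (C ! k)" using C'(3) by blast
      then show ?thesis by (intro exI[of _ k]) (auto simp: nth_append)
    next
      case 3
      then obtain k where "k < length D" "i - length C \<in> parents (D ! k)" using D'(3) by blast
      then show ?thesis using 3(1)
        by (intro exI[of _ "length C + k"]) (force simp: nth_append parents_shift_gate)
    qed (auto intro!: exI[of _ "length ?E"] simp: nth_append)
  qed
  then have "wf_circuit n (?E @ [?g])"
    unfolding wf_circuit_snoc using gates_ok_shift[OF C'(2) D'(2)] C'(1) D'(1)
    by (auto simp: gates_ok_snoc less_Suc_eq_le simp del: append_assoc simp flip: length_greater_0_conv)
  moreover have "circ_eval (?E @ [?g]) x = (f x \<and> g x)" if "length x = n" for x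
    unfolding circ_eval_snoc circ_vals_shift[OF D'(2)]
    using C(2)[OF that] D(2)[OF that] C'(1) D'(1) circ_eval_last[of C x] circ_eval_last[of D x]
    by (simp add: nth_append)
  ultimately show ?thesis unfolding computable_def by blast
qed

lemma computable_cong:
  "computable n f \<Longrightarrow> (\<And>x. length x = n \<Longrightarrow> f x = g x) \<Longrightarrow> computable n g"
  unfolding computable_def by auto

text \<open>Size is irrelevant here: existence guarantees that the minimum in
  \<open>circ_cplx\<close> is attained. The function is a disjunction of point indicators. For
  \<open>n = 0\<close> there are no sources and hence no circuits.\<close>

lemma computable_any:
  assumes n: "0 < n"
  shows "computable n f"
proof -
  have bit: "computable n (\<lambda>x. x ! i)" if "i < n" for i
    using computable_Inp[of "Suc i" n] that by simp
  have F: "computable n (\<lambda>x. False)"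
    using computable_And[OF bit[OF n] computable_Not[OF bit[OF n]]] by simp
  have point: "computable n (\<lambda>x. \<forall>i<k. x ! i = y ! i)" if "k \<le> n" for k and y :: "bool list"
    using that
  proof (induction k)
    case 0
    show ?case using computable_Not[OF F] by simp
  next
    case (Suc k)
    have "computable n (\<lambda>x. x ! k = y ! k)"
      using bit[of k] computable_Not[OF bit[of k]] Suc.prems by (cases "y ! k") auto
    then show ?case using computable_And[of n "\<lambda>x. \<forall>i<k. x ! i = y ! i" "\<lambda>x. x ! k = y ! k"] Suc
      by (simp add: less_Suc_eq all_conj_distrib imp_disjL conj_commute)
  qed
  have ind: "computable n (\<lambda>x. x \<in> A)" if "finite A" "A \<subseteq> {x. length x = n}" for A
    using that
  proof (induction A rule: finite_induct)
    case empty
    show ?case using F by simp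
  next
    case (insert y A)
    have "computable n (\<lambda>x. \<not> ((\<not> (\<forall>i<n. x ! i = y ! i)) \<and> \<not> x \<in> A))"
      by (intro computable_Not computable_And point) (use insert in auto)
    then show ?case
      by (rule computable_cong) (use insert.prems in \<open>auto simp: list_eq_iff_nth_eq\<close>)
  qed
  have "computable n (\<lambda>x. x \<in> {x. length x = n \<and> f x})"
    by (rule ind) (auto intro: finite_subset[OF _ card_lists_bounded(1)[of n]])
  then show ?thesis by (rule computable_cong) auto
qed

section \<open>The hard language\<close>

text \<open>In this and the next three relations \<open>x\<close> supplies the input length, while
  \<open>u\<close> and \<open>g\<close> are bounds in unary. Every quantified string is thereby no
  longer than one of the arguments, as elimination of quantifiers requires.\<close>

definition differ :: "bool list \<Rightarrow> bool list \<Rightarrow> bool list \<Rightarrow> bool" where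
  "differ w h x \<longleftrightarrow> (\<exists>z. length z = length x \<and> nor_eval w z \<noteq> nor_eval h z)"

definition easy :: "bool list \<Rightarrow> bool list \<Rightarrow> bool list \<Rightarrow> bool" where
  "easy h x u \<longleftrightarrow> (\<exists>w. length w \<le> length u \<and> \<not> differ w h x)"

definition preceded :: "bool list \<Rightarrow> bool list \<Rightarrow> bool list \<Rightarrow> bool" where
  "preceded h x u \<longleftrightarrow> (\<exists>h'. rank h' < rank h \<and> \<not> easy h' x u)"

definition first_hard :: "bool list \<Rightarrow> bool list \<Rightarrow> bool list \<Rightarrow> bool" where
  "first_hard x u g \<longleftrightarrow>
     (\<exists>h. length h \<le> length g \<and> \<not> easy h x u \<and> \<not> preceded h x u \<and> nor_eval h x)"

lemma inPm_differ:
  assumes "P_class = NP_class"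
  shows "inPm 3 (\<lambda>xs. differ (xs ! 0) (xs ! 1) (xs ! 2))"
proof (rule inPm_Ex[OF assms])
  have "inPm 4 (\<lambda>xs. nor_eval (xs ! 0) (xs ! 3) \<noteq> nor_eval (xs ! 1) (xs ! 3))"
    by (rule inPm_combineI[OF inPm_nor_eval inPm_nor_eval, where I = "[0,3]" and J = "[1,3]" and g = "\<lambda>a b. a \<noteq> b"]) auto
  moreover have "inPm 2 (\<lambda>xs. length (xs ! 0) = length (xs ! 1))"
    by (rule inPm_combineI[OF inPm_length_le inPm_length_le, where I = "[0,1]" and J = "[1,0]" and g = "\<lambda>a b. a \<and> b"]) auto
  ultimately show "inPm (Suc 3) (\<lambda>xs. nor_eval (xs ! 0) (xs ! 3) \<noteq> nor_eval (xs ! 1) (xs ! 3)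
       \<and> length (xs ! 3) = length (xs ! 2))"
    by (rule inPm_combineI[where I = "[0,1,2,3]" and J = "[3,2]" and g = "\<lambda>a b. a \<and> b"])
      (auto simp: eval_nat_numeral)
next
  fix xs :: "bool list list" and w :: "bool list"
  assume l: "length xs = 3"
  then show "nor_eval ((xs @ [w]) ! 0) ((xs @ [w]) ! 3) \<noteq> nor_eval ((xs @ [w]) ! 1) ((xs @ [w]) ! 3)
       \<and> length ((xs @ [w]) ! 3) = length ((xs @ [w]) ! 2) \<Longrightarrow> length w \<le> tot xs"
    using length_le_tot[of 2 xs] by (simp add: nth_append)
  show "differ (xs ! 0) (xs ! 1) (xs ! 2) \<longleftrightarrow> (\<exists>w. nor_eval ((xs @ [w]) ! 0) ((xs @ [w]) ! 3) \<noteq>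
     nor_eval ((xs @ [w]) ! 1) ((xs @ [w]) ! 3) \<and> length ((xs @ [w]) ! 3) = length ((xs @ [w]) ! 2))"
    using l by (auto simp: nth_append differ_def)
qed

text \<open>That two programs agree on all inputs is a universal statement, but it is the negation
  of \<open>differ\<close>, which is already in P; a single existential quantifier remains to be
  removed. The next two relations are treated in the same way.\<close>

lemma inPm_easy:
  assumes "P_class = NP_class"
  shows "inPm 3 (\<lambda>xs. easy (xs ! 0) (xs ! 1) (xs ! 2))"
proof (rule inPm_Ex[OF assms])
  show "inPm (Suc 3) (\<lambda>xs. length (xs ! 3) \<le> length (xs ! 2) \<and> \<not> differ (xs ! 3) (xs ! 0) (xs ! 1))"
    by (rule inPm_combineI[OF inPm_length_le inPm_differ[OF assms], where I = "[3,2]" and J = "[3,0,1]" and g = "\<lambda>a b. a \<and> \<not> b"]) auto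
next
  fix xs :: "bool list list" and w :: "bool list"
  assume l: "length xs = 3"
  then show "length ((xs @ [w]) ! 3) \<le> length ((xs @ [w]) ! 2) \<and>
      \<not> differ ((xs @ [w]) ! 3) ((xs @ [w]) ! 0) ((xs @ [w]) ! 1) \<Longrightarrow> length w \<le> tot xs"
    using length_le_tot[of 2 xs] by (simp add: nth_append)
  show "easy (xs ! 0) (xs ! 1) (xs ! 2) \<longleftrightarrow> (\<exists>w. length ((xs @ [w]) ! 3) \<le> length ((xs @ [w]) ! 2) \<and>
      \<not> differ ((xs @ [w]) ! 3) ((xs @ [w]) ! 0) ((xs @ [w]) ! 1))"
    using l by (auto simp: nth_append easy_def)
qed

lemma length_le_of_rank: "rank u \<le> rank v \<Longrightarrow> length u \<le> length v"
  using rank_less_of_length[of v u] by linarith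

lemma inPm_preceded:
  assumes "P_class = NP_class"
  shows "inPm 3 (\<lambda>xs. preceded (xs ! 0) (xs ! 1) (xs ! 2))"
proof (rule inPm_Ex[OF assms])
  show "inPm (Suc 3) (\<lambda>xs. rank (xs ! 3) < rank (xs ! 0) \<and> \<not> easy (xs ! 3) (xs ! 1) (xs ! 2))"
    by (rule inPm_combineI[OF inPm_rank_less inPm_easy[OF assms], where I = "[3,0]" and J = "[3,1,2]" and g = "\<lambda>a b. a \<and> \<not> b"]) auto
next
  fix xs :: "bool list list" and w :: "bool list"
  assume l: "length xs = 3"
  then show "rank ((xs @ [w]) ! 3) < rank ((xs @ [w]) ! 0) \<and>
      \<not> easy ((xs @ [w]) ! 3) ((xs @ [w]) ! 1) ((xs @ [w]) ! 2) \<Longrightarrow> length w \<le> tot xs"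
    using length_le_tot[of 0 xs] length_le_of_rank[of w "xs ! 0"] by (simp add: nth_append)
  show "preceded (xs ! 0) (xs ! 1) (xs ! 2) \<longleftrightarrow> (\<exists>w. rank ((xs @ [w]) ! 3) < rank ((xs @ [w]) ! 0) \<and>
      \<not> easy ((xs @ [w]) ! 3) ((xs @ [w]) ! 1) ((xs @ [w]) ! 2))"
    using l by (auto simp: nth_append preceded_def)
qed

lemma inPm_first_hard:
  assumes "P_class = NP_class"
  shows "inPm 3 (\<lambda>xs. first_hard (xs ! 0) (xs ! 1) (xs ! 2))"
proof (rule inPm_Ex[OF assms])
  have "inPm 4 (\<lambda>xs. \<not> easy (xs ! 3) (xs ! 0) (xs ! 1) \<and> \<not> preceded (xs ! 3) (xs ! 0) (xs ! 1))"
    by (rule inPm_combineI[OF inPm_easy[OF assms] inPm_preceded[OF assms], where I = "[3,0,1]" and J = "[3,0,1]" and g = "\<lambda>a b. \<not> a \<and> \<not> b"]) auto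
  moreover have "inPm 4 (\<lambda>xs. length (xs ! 3) \<le> length (xs ! 2) \<and> nor_eval (xs ! 3) (xs ! 0))"
    by (rule inPm_combineI[OF inPm_length_le inPm_nor_eval, where I = "[3,2]" and J = "[3,0]" and g = "\<lambda>a b. a \<and> b"]) auto
  ultimately show "inPm (Suc 3) (\<lambda>xs. (\<not> easy (xs ! 3) (xs ! 0) (xs ! 1) \<and> \<not> preceded (xs ! 3) (xs ! 0) (xs ! 1))
      \<and> (length (xs ! 3) \<le> length (xs ! 2) \<and> nor_eval (xs ! 3) (xs ! 0)))"
    by (rule inPm_combineI[where I = "[0,1,2,3]" and J = "[0,1,2,3]" and g = "\<lambda>a b. a \<and> b"])
      (auto simp: eval_nat_numeral)
next
  fix xs :: "bool list list" and w :: "bool list"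
  assume l: "length xs = 3"
  then show "(\<not> easy ((xs @ [w]) ! 3) ((xs @ [w]) ! 0) ((xs @ [w]) ! 1) \<and>
       \<not> preceded ((xs @ [w]) ! 3) ((xs @ [w]) ! 0) ((xs @ [w]) ! 1))
      \<and> (length ((xs @ [w]) ! 3) \<le> length ((xs @ [w]) ! 2) \<and> nor_eval ((xs @ [w]) ! 3) ((xs @ [w]) ! 0))
      \<Longrightarrow> length w \<le> tot xs"
    using length_le_tot[of 2 xs] by (simp add: nth_append)
  show "first_hard (xs ! 0) (xs ! 1) (xs ! 2) \<longleftrightarrow> (\<exists>w.
       (\<not> easy ((xs @ [w]) ! 3) ((xs @ [w]) ! 0) ((xs @ [w]) ! 1) \<and>
       \<not> preceded ((xs @ [w]) ! 3) ((xs @ [w]) ! 0) ((xs @ [w]) ! 1))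
      \<and> (length ((xs @ [w]) ! 3) \<le> length ((xs @ [w]) ! 2) \<and> nor_eval ((xs @ [w]) ! 3) ((xs @ [w]) ! 0)))"
    using l by (auto simp: nth_append first_hard_def)
qed

text \<open>Both exponents are reached by repeated squaring: n^4 exceeds the O(n^3) codes of the
  circuits to be excluded, and n^16 leaves room for a hard program, whose length is of order
  n^8.\<close>

definition hard_lang :: "bool list set" where
  "hard_lang = {x. first_hard x (replicate (length x ^ 4) True) (replicate (length x ^ 16) True)}"

lemma inPm_hard_lang:
  assumes "P_class = NP_class"
  shows "inPm 1 (\<lambda>xs. xs ! 0 \<in> hard_lang)"
proof -
  let ?pad = "\<lambda>xs :: bool list list. xs @ [replicate ((length (last xs))\<^sup>2) True]"
  have "inPm 5 (\<lambda>xs. first_hard (xs ! 0) (xs ! 2) (xs ! 4))"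
    \<comment> \<open>Four squarings extend a single input to strings of lengths n, n^2, n^4, n^8
      and n^16, of which positions 0, 2 and 4 are used. The selection combines the relation with
      itself and ignores the second verdict.\<close>
    by (rule inPm_combineI[OF inPm_first_hard[OF assms] inPm_first_hard[OF assms], where I = "[0,2,4]" and J = "[0,2,4]" and g = "\<lambda>a b. a"]) auto
  then have "inPm (Suc (Suc (Suc (Suc 1)))) (\<lambda>xs. first_hard (xs ! 0) (xs ! 2) (xs ! 4))"
    by (simp add: eval_nat_numeral)
  note inPm_pad_square[OF inPm_pad_square[OF inPm_pad_square[OF inPm_pad_square[OF this]]]]
  then show ?thesis
  proof (rule inPm_cong)
    fix xs :: "bool list list" assume "length xs = 1"
    then obtain x where x: "xs = [x]" by (auto simp: length_Suc_conv)
    have "((length x)\<^sup>2)\<^sup>2 = length x ^ 4" "((length x ^ 4)\<^sup>2)\<^sup>2 = length x ^ 16"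
      by (simp_all flip: power_mult)
    then show "first_hard (?pad (?pad (?pad (?pad xs))) ! 0) (?pad (?pad (?pad (?pad xs))) ! 2)
        (?pad (?pad (?pad (?pad xs))) ! 4) \<longleftrightarrow> xs ! 0 \<in> hard_lang"
      unfolding x hard_lang_def by (simp add: numeral_2_eq_2[symmetric])
  qed simp_all
qed

lemma inP_of_inPm:
  assumes "inPm 1 R"
  shows "inP {x. R [x]}"
proof -
  obtain M B where M: "wf_tm 1 M" "poly_bounded B"
     "\<And>xs. length xs = 1 \<Longrightarrow> (\<exists>t\<le>B (tot xs). halts_within M xs t) \<and> tm_output M xs = Some (R xs)"
    using assms unfolding inPm_def by auto
  obtain a k where a: "\<And>n. B n \<le> a * n ^ k + a" using M(2) unfolding poly_bounded_def by auto
  have "\<exists>t\<le>a * length x ^ k + a. halts_within M [x] t" for x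
  proof -
    obtain t where "t \<le> B (tot [x])" "halts_within M [x] t" using M(3)[of "[x]"] by auto
    then show ?thesis using a[of "length x"] by (intro exI[of _ t]) (simp add: tot_def)
  qed
  moreover have "tm_output M [x] = Some (x \<in> {x. R [x]})" for x
    using M(3)[of "[x]"] by simp
  ultimately show ?thesis unfolding inP_def using M(1) by blast
qed

lemma inP_hard_lang:
  assumes "P_class = NP_class"
  shows "inP hard_lang" "inP (- hard_lang)"
proof -
  show "inP hard_lang" using inP_of_inPm[OF inPm_hard_lang[OF assms]] by simp
  have "inPm 1 (\<lambda>xs. \<not> xs ! 0 \<in> hard_lang)"
    by (rule inPm_combineI[OF inPm_hard_lang[OF assms] inPm_hard_lang[OF assms], where I = "[0]" and J = "[0]"
          and g = "\<lambda>a b. \<not> a"]) auto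
  from inP_of_inPm[OF this] show "inP (- hard_lang)" by (simp add: Compl_eq)
qed

section \<open>Hardness of the language on long inputs\<close>

lemma power4_less_power2: "17 \<le> n \<Longrightarrow> n ^ 4 + 1 \<le> (2::nat) ^ n"
proof (induction n rule: nat_induct_at_least)
  \<comment> \<open>The start 17 is best possible, as 16^4 = 2^16. The inequality is the condition
    of \<open>hard_program_exists\<close> for the threshold n^4.\<close>
  case base
  show ?case by simp
next
  case (Suc n)
  have "17 * n ^ 3 \<le> n * n ^ 3" using Suc(1) by (rule mult_right_mono) simp
  also have "n * n ^ 3 = n ^ 4" by (simp add: eval_nat_numeral)
  finally have "17 * n ^ 3 \<le> n ^ 4" .
  moreover have "n ^ 2 \<le> n ^ 3" "n \<le> n ^ 3"
    using Suc(1) by (auto intro: power_increasing self_le_power)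
  ultimately have "n ^ 4 + 4 * n ^ 3 + 6 * n ^ 2 + 4 * n + 1 + 1 \<le> 2 * (n ^ 4 + 1)"
    unfolding distrib_left by linarith
  moreover have "Suc n ^ 4 = n ^ 4 + 4 * n ^ 3 + 6 * n ^ 2 + 4 * n + 1"
    by (simp add: eval_nat_numeral algebra_simps)
  ultimately have "Suc n ^ 4 + 1 \<le> 2 * (n ^ 4 + 1)" by simp
  then show ?case using Suc(2) by simp
qed

text \<open>On inputs of length \<open>n\<close> all bounds are fixed, so \<open>first_hard\<close>
  speaks of the hard program of least rank. It fits into n^16 because some hard program does and a
  smaller rank never means a longer string. Injectivity of \<open>rank\<close> makes it unique, so
  the slice of the language is exactly what it computes.\<close>

lemma hard_lang_hard:
  assumes n: "17 \<le> n" and w: "length w \<le> n ^ 4"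
  shows "\<exists>z. length z = n \<and> nor_eval w z \<noteq> (z \<in> hard_lang)"
proof -
  define hard where "hard h \<longleftrightarrow> (\<forall>w. length w \<le> n ^ 4 \<longrightarrow> (\<exists>z. length z = n \<and> nor_eval w z \<noteq> nor_eval h z))" for h
  have e: "hard h \<longleftrightarrow> \<not> easy h x (replicate (n ^ 4) True)" if "length x = n" for h x
    using that by (auto simp: easy_def differ_def hard_def)
  obtain h0 where h0: "length h0 \<le> (n + n ^ 4 + 2) * (2 * n + n ^ 4 + 2)" "hard h0"
    using hard_program_exists[OF power4_less_power2[OF n]] unfolding hard_def by auto
  \<comment> \<open>Each factor is at most 4 n^4 and hence at most n^8.\<close>
  have "(n + n ^ 4 + 2) * (2 * n + n ^ 4 + 2) \<le> n ^ 8 * n ^ 8"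
  proof -
    have "n \<le> n ^ 4" by (rule self_le_power) (use n in auto)
    moreover have "4 * n ^ 4 \<le> n ^ 4 * n ^ 4" using n calculation by (intro mult_right_mono) auto
    moreover have "n ^ 4 * n ^ 4 = n ^ 8" by (simp flip: power_add)
    ultimately show ?thesis using n by (intro mult_mono) linarith+
  qed
  then have l0: "length h0 \<le> n ^ 16" using h0(1) by (simp flip: power_add)
  obtain h where h: "hard h" "\<And>h'. hard h' \<Longrightarrow> rank h \<le> rank h'"
    using ex_has_least_nat[of hard h0 rank] h0(2) by blast
  have l: "length h \<le> n ^ 16" using length_le_of_rank[OF h(2)[OF h0(2)]] l0 by simp
  have "z \<in> hard_lang \<longleftrightarrow> nor_eval h z" if z: "length z = n" for z
  proof -
    have p: "preceded h' z (replicate (n ^ 4) True) \<longleftrightarrow> (\<exists>h''. rank h'' < rank h' \<and> hard h'')" for h'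
      unfolding preceded_def e[OF z] by simp
    have np: "\<not> preceded h z (replicate (n ^ 4) True)" unfolding p using h(2) not_less by blast
    have uniq: "h' = h" if "hard h'" "\<not> preceded h' z (replicate (n ^ 4) True)" for h'
    proof (rule rank_inject)
      have "\<not> rank h < rank h'" using h(1) that(2)[unfolded p] by blast
      then have "rank h' \<le> rank h" by simp
      then show "rank h' = rank h" using h(2)[OF that(1)] by (rule antisym)
    qed
    have "first_hard z (replicate (n ^ 4) True) (replicate (n ^ 16) True) \<longleftrightarrow> nor_eval h z"
      unfolding first_hard_def e[OF z, symmetric] length_replicate using h(1) l np uniq by blast
    then show ?thesis using z unfolding hard_lang_def by simp
  qed
  moreover obtain z where "length z = n" "nor_eval w z \<noteq> nor_eval h z"
    using h(1) w unfolding hard_def by blast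
  ultimately show ?thesis by blast
qed

text \<open>Since \<open>nor_of_circuit\<close> reaches either polarity at the same cost, a small
  circuit for the complement is as impossible as one for the language.\<close>

lemma no_small_circuit:
  assumes n: "17 \<le> n" and C: "wf_circuit n C" "\<And>x. length x = n \<Longrightarrow> circ_eval C x = ((x \<in> hard_lang) = b)"
  shows "n ^ 4 < (2 * length C + 1) * (n + 2 * length C + 1)"
proof (rule ccontr)
  assume "\<not> ?thesis"
  moreover obtain w where w: "length w \<le> (2 * length C + 1) * (n + 2 * length C + 1)"
    "\<And>x. length x = n \<Longrightarrow> nor_eval w x = (circ_eval C x = b)"
    using nor_of_circuit[OF C(1)] by blast
  ultimately have "length w \<le> n ^ 4" by simp
  from hard_lang_hard[OF n this] show False using w(2) C(2) by auto
qed

section \<open>Complexity measures and the contradiction\<close>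

lemma circ_cplx_witness:
  assumes "0 < n"
  shows "\<exists>C. wf_circuit n C \<and> (\<forall>x. length x = n \<longrightarrow> circ_eval C x = f x) \<and> length C \<le> circ_cplx n f"
proof -
  let ?P = "\<lambda>l. \<exists>C. wf_circuit n C \<and> (\<forall>x. length x = n \<longrightarrow> circ_eval C x = f x) \<and> l = enc_len (length C) n"
  have "\<exists>l. ?P l" using computable_any[OF assms, of f] unfolding computable_def by blast
  then have "?P (circ_cplx n f)" unfolding circ_cplx_def by (rule LeastI_ex)
  \<comment> \<open>Each vertex takes at least three bits of the encoding, so a bound on the
    encoding length bounds the size.\<close>
  moreover have "s \<le> enc_len s n" for s
    unfolding enc_len_def by (rule trans_le_add2) simp
  ultimately show ?thesis by auto
qed

lemma prog_cplx_le:
  assumes "\<And>x. length x = n \<Longrightarrow> \<phi> h x = Some (f x)"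
  shows "\<exists>m\<le>length h. prog_cplx \<phi> n f = enat m"
  unfolding prog_cplx_def using assms by (auto intro!: Least_le)

text \<open>Complexity 0 makes the quotient of the hypothesis 0 by the convention for division by
  zero. The only program of that length is the empty one, so it must compute the function
  itself.\<close>

lemma prog_cplx_eq_0:
  assumes "prog_cplx \<phi> n f = 0" "length x = n"
  shows "\<phi> [] x = Some (f x)"
proof -
  have ex: "\<exists>h. \<forall>x. length x = n \<longrightarrow> \<phi> h x = Some (f x)"
    using assms(1) unfolding prog_cplx_def by (auto split: if_splits)
  let ?P = "\<lambda>m. \<exists>h. length h = m \<and> (\<forall>x. length x = n \<longrightarrow> \<phi> h x = Some (f x))"
  have "?P (LEAST m. ?P m)" by (rule LeastI_ex) (use ex in auto)
  moreover have "(LEAST m. ?P m) = 0"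
    using assms(1) ex unfolding prog_cplx_def by (simp add: zero_enat_def)
  ultimately show ?thesis using assms(2) by auto
qed

lemma universal_inP:
  assumes "universal_family U" "inP L"
  shows "\<exists>k. \<forall>c>k. \<exists>h N. \<forall>x. N \<le> length x \<longrightarrow> U c h x = Some (x \<in> L)"
proof -
  obtain M k a where M: "wf_tm 1 M" "\<And>x. \<exists>t\<le>a * length x ^ k + a. halts_within M [x] t"
      "\<And>x. tm_output M [x] = Some (x \<in> L)"
    using assms(2) unfolding inP_def by auto
  \<comment> \<open>The factor 2 absorbs the empty input with \<open>k = 0\<close>: there
    \<open>length x ^ k\<close> is 1, whereas 0 powr 0 is 0.\<close>
  have t: "\<exists>t. real t \<le> real (2 * a) * real (length x) powr real k + real (2 * a) \<and> halts_within M [x] t" for x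
  proof -
    obtain t where t: "t \<le> a * length x ^ k + a" "halts_within M [x] t" using M(2) by blast
    have "real (a * length x ^ k) \<le> real (2 * a) * real (length x) powr real k + real a"
    proof (cases "length x = 0")
      case True
      then show ?thesis by (cases k) auto
    next
      case False
      then show ?thesis by (simp add: powr_realpow)
    qed
    then show ?thesis using t by (intro exI[of _ t]) linarith
  qed
  have "\<exists>h N. \<forall>x. N \<le> length x \<longrightarrow> U c h x = Some (x \<in> L)" if "k < c" for c
    using assms(1)[unfolded universal_family_def, rule_format, of c "real k" M "real (2 * a)" "\<lambda>x. x \<in> L"]
      that M(1,3) t by auto
  then show ?thesis by blast
qed

theorem mainTheorem14:
  fixes U :: "nat \<Rightarrow> interpreter"
  assumes univ: "universal_family U"
    and hyp: "\<forall>(c::nat) (\<gamma>::real). 1 \<le> c \<longrightarrow> 0 < \<gamma> \<longrightarrow>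
       (\<exists>K N. \<forall>n \<ge> N. \<forall>f :: bool list \<Rightarrow> bool. prog_cplx (U c) n f \<noteq> \<infinity> \<longrightarrow>
          real (circ_cplx n f) / real (the_enat (prog_cplx (U c) n f)) \<le> K * real n powr (1 + \<gamma>))"
  shows "P_class \<noteq> NP_class"
proof
  assume PNP: "P_class = NP_class"
  obtain k1 where k1: "\<forall>c>k1. \<exists>h N. \<forall>x. N \<le> length x \<longrightarrow> U c h x = Some (x \<in> hard_lang)"
    using universal_inP[OF univ inP_hard_lang(1)[OF PNP]] by blast
  obtain k2 where k2: "\<forall>c>k2. \<exists>h N. \<forall>x. N \<le> length x \<longrightarrow> U c h x = Some (x \<in> - hard_lang)"
    using universal_inP[OF univ inP_hard_lang(2)[OF PNP]] by blast
  \<comment> \<open>Above both thresholds, so a single interpreter has programs for the language and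
    for its complement.\<close>
  define c where "c = k1 + k2 + 1"
  obtain h1 N1 where h1: "\<And>x. N1 \<le> length x \<Longrightarrow> U c h1 x = Some (x \<in> hard_lang)"
    using k1[rule_format, of c] unfolding c_def by auto
  obtain h2 N2 where h2: "\<And>x. N2 \<le> length x \<Longrightarrow> U c h2 x = Some (x \<in> - hard_lang)"
    using k2[rule_format, of c] unfolding c_def by auto
  have "1 \<le> c" "0 < (1/2 :: real)" unfolding c_def by auto
  with hyp obtain K N0 where K: "\<And>n f. N0 \<le> n \<Longrightarrow> prog_cplx (U c) n f \<noteq> \<infinity> \<Longrightarrow>
      real (circ_cplx n f) / real (the_enat (prog_cplx (U c) n f)) \<le> K * real n powr (1 + 1/2)"
    by blast
  \<comment> \<open>The circuit will have size at most \<open>D\<close> times n powr 1.5: the bound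
    on the quotient times a constant program length. The absolute value makes this monotone in the
    program length whatever the sign of \<open>K\<close>.\<close>
  define D where "D = \<bar>K\<bar> * real (length h1 + length h2)"
  \<comment> \<open>The last summand yields (2 D + 2)^2 \<le> n, which pushes a code length of at
    most (2 D + 2)^2 n^3 below the threshold n^4.\<close>
  define n where "n = N0 + N1 + N2 + 17 + nat \<lceil>(2 * D + 2)\<^sup>2\<rceil>"
  have n: "N0 \<le> n" "N1 \<le> n" "N2 \<le> n" "17 \<le> n" unfolding n_def by auto
  have nD: "(2 * D + 2)\<^sup>2 \<le> real n" unfolding n_def using real_nat_ceiling_ge[of "(2 * D + 2)\<^sup>2"] by linarith
  define f where "f b x \<longleftrightarrow> (x \<in> hard_lang) = b" for b x
  have fin: "\<exists>m\<le>length h1 + length h2. prog_cplx (U c) n (f b) = enat m" for b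
  proof -
    have "\<exists>h\<in>{h1, h2}. \<forall>x. length x = n \<longrightarrow> U c h x = Some (f b x)"
      using h1 h2 n by (cases b) (auto simp: f_def)
    then obtain h where h: "h \<in> {h1, h2}" "\<And>x. length x = n \<Longrightarrow> U c h x = Some (f b x)" by blast
    obtain m where "m \<le> length h" "prog_cplx (U c) n (f b) = enat m" using prog_cplx_le[of n "U c" h "f b", OF h(2)] by blast
    then show ?thesis using h(1) by (intro exI[of _ m]) auto
  qed
  \<comment> \<open>The quotient is junk when the empty program computes the function; it cannot compute both
    the language and its complement.\<close>
  have "\<exists>b. prog_cplx (U c) n (f b) \<noteq> 0"
  proof (rule ccontr)
    assume "\<not> ?thesis"
    then have "U c [] (replicate n True) = Some (f b (replicate n True))" for b
      by (intro prog_cplx_eq_0[of _ n]) auto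
    from this[of True] this[of False] show False by (simp add: f_def)
  qed
  then obtain b where b: "prog_cplx (U c) n (f b) \<noteq> 0" by blast
  obtain m where m: "m \<le> length h1 + length h2" "prog_cplx (U c) n (f b) = enat m" using fin by blast
  have m0: "0 < m" using b m(2) by (cases m) (auto simp: zero_enat_def)
  obtain C where C: "wf_circuit n C" "\<And>x. length x = n \<Longrightarrow> circ_eval C x = f b x" "length C \<le> circ_cplx n (f b)"
    using circ_cplx_witness[of n "f b"] n(4) by auto
  define q where "q = real n powr (1 + 1/2)"
  have q: "q * q = real n ^ 3" "real n \<le> q" "1 \<le> q"
  proof -
    have "q * q = real n powr ((1 + 1/2) + (1 + 1/2))" unfolding q_def by (rule powr_add[symmetric])
    also have "(1 + 1/2) + (1 + 1/2) = real 3" by simp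
    also have "real n powr real 3 = real n ^ 3" by (rule powr_realpow) (use n(4) in simp)
    finally show "q * q = real n ^ 3" .
    have "real n powr 1 \<le> q" unfolding q_def using n(4) by (intro powr_mono) auto
    then show "real n \<le> q" "1 \<le> q" using n(4) by auto
  qed
  have "real (circ_cplx n (f b)) / real m \<le> K * q"
    using K[OF n(1), of "f b"] m(2) unfolding q_def by simp
  then have "real (circ_cplx n (f b)) \<le> K * q * real m" using m0 by (simp add: field_simps)
  also have "\<dots> \<le> \<bar>K\<bar> * q * real (length h1 + length h2)"
    using m(1) q(3) by (intro mult_mono) auto
  finally have s: "real (length C) \<le> D * q" using C(3) unfolding D_def by (simp add: mult_ac)
  \<comment> \<open>As n \<le> q and 1 \<le> q, each of the two factors is at most (2 D + 2)
    q.\<close>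
  have "real ((2 * length C + 1) * (n + 2 * length C + 1)) \<le> ((2 * D + 2) * q) * ((2 * D + 2) * q)"
    unfolding of_nat_mult using s q(2,3) by (intro mult_mono) (auto simp: algebra_simps)
  also have "\<dots> = (2 * D + 2)\<^sup>2 * real n ^ 3"
    unfolding q(1)[symmetric] power2_eq_square by (simp only: mult_ac)
  also have "\<dots> \<le> real n * real n ^ 3" by (intro mult_right_mono nD) auto
  also have "\<dots> = real (n ^ 4)" by (simp add: eval_nat_numeral)
  finally have "(2 * length C + 1) * (n + 2 * length C + 1) \<le> n ^ 4" by (simp only: of_nat_le_iff)
  then show False using no_small_circuit[OF n(4) C(1,2)[unfolded f_def]] by simp
qed

end
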